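(* Let $n\geqslant2$ and $(V,\rho)\simeq(V_{n+2},\rho_{n+2})\oplus(V_n,\rho_n)$, and let $\mathcal{T}=(T_1,T_2,T_3)$ be a spherically symmetric solution to Nahm's equations on a connected open interval $I$ whose generators induce the representation $(V,\rho)$. Let $Y_i^+:=\rho_{n+2}(X_i)$, $Y_i^-:=\rho_n(X_i)$ and $B_i:=B_i^n$. Then, in some gauge, there are real-valued analytic functions $f^+,f^-,g$ on $I$ such that for all $i\in\{1,2,3\}$ $$T_i=\begin{pmatrix} f^+Y_i^+ & gB_i\\ -gB_i^* & f^-Y_i^-\end{pmatrix},$$ and they satisfy $$\dot f^+=(f^+)^2+\frac{2}{n+1}g^2,\qquad \dot g=\left(\frac{n+3}{2}f^+-\frac{n-1}{2}f^-\right)g,\qquad \dot f^-=(f^-)^2-\frac{2(n+2)}{n(n+1)}g^2.$$ These equations have the following maximally extended, irreducible solution on $(-1,1)$ (which is not claimed to be unique in any sense): $$f^+(t)=-\frac{(n+1)t+(n-1)}{(n+1)(t^2-1)},\quad f^-(t)=-\frac{(n+1)t+(n+3)}{(n+1)(t^2-1)},\quad g(t)=\left(\frac{2n}{n+1}\right)^{1/2}\frac{1}{t^2-1},$$ with residues given by $$\mathrm{Res}(f^+,\pm1)=\frac{(2-n)\mp(n+2)}{2(n+1)},\quad \mathrm{Res}(f^-,\pm1)=\frac12\mp\frac{n+3}{2(n+1)},\quad \mathrm{Res}(g,\pm1)=\pm\sqrt{\frac{n}{2(n+1)}}.$$ The spherically symmetric Nahm datum given by the displayed form of $T_i$ with these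 functions $f^+,f^-,g$ induces representations of $\mathfrak{so}(3)$ that are isomorphic to $(V_{n+1},\rho_{n+1})^{\oplus2}$ at $t=1$ and to $(V_2,\rho_2)^{\oplus(n+1)}$ at $t=-1$.
   Context: Nahm's equations for a triple $\mathcal{T}=(T_1,T_2,T_3)$ of functions from an open interval to $\mathfrak{su}(N)$ (here $N=2n+2$) are $\dot T_1=[T_2,T_3]$, $\dot T_2=[T_3,T_1]$, $\dot T_3=[T_1,T_2]$. A solution is also called a Nahm datum. For $A\in\mathrm{SO}(3)$ and $U\in\mathrm{SU}(N)$ set ${}^AT_i:=\sum_jA_{ij}T_j$ and ${}_UT_i:=UT_iU^{-1}$. A solution is spherically symmetric if for every $A\in\mathrm{SO}(3)$ there is $U_A\in\mathrm{SU}(N)$ with ${}^A\mathcal{T}={}_{U_A^{-1}}\mathcal{T}$. A triple $(Y_1,Y_2,Y_3)\in\mathfrak{su}(N)^{\oplus3}$ is a triple of generators of the spherical symmetry for $\mathcal{T}$ if $[Y_i,T_j]=\sum_{k}\epsilon_{ijk}T_k$ for all $i,j$ at every point of the domain ($\epsilon_{ijk}$ the Levi-Civita symbol). $(X_1,X_2,X_3)$ is the standard basis of $\mathfrak{so}(3)$, $(X_i)_{jk}=-\epsilon_{ijk}$. The generators induce the representation $\rho$ of $\mathfrak{so}(3)$ if $[Y_i,Y_j]=\sum_k\epsilon_{ijk}Y_k$ for all $i,j$ and $\rho(X_i)=Y_i$. "In some gauge" means after replacing all $T_i$ by $UT_iU^{-1}$ for some constant $U\in\mathrm{SU}(N)$.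 $(V_m,\rho_m)$ is the $m$-dimensional irreducible complex representation of the Lie algebra $\mathfrak{so}(3)$, with an invariant Hermitian inner product; $V\cong\mathbb{C}^N$ is the orthogonal direct sum, and block matrices are with respect to it. $(B_1^n,B_2^n,B_3^n)$ is the triple of linear maps $B_i^n:V_n\to V_{n+2}$ (unique up to a $\mathrm{U}(1)$ factor) with $\rho_{n+2}(X_j)B_k^n-B_k^n\rho_n(X_j)=\sum_{i=1}^3\epsilon_{ijk}B_i^n$ for all $j,k$, normalized by $\sum_{i=1}^3B_i^n(B_i^n)^*=\mathrm{Id}_{V_{n+2}}$. A Nahm datum is irreducible if there is no proper nonzero subspace of $\mathbb{C}^N$ invariant under $T_1(t),T_2(t),T_3(t)$ for all $t$ in the domain; a solution of the differential equations for $f^\pm,g$ is called irreducible if the corresponding Nahm datum is. Maximally extended means that the solution does not extend to a solution on a larger open interval. $\mathrm{Res}(h,t_* )$ denotes the residue of $h$ at a simple pole $t_*$. If $\mathcal{T}$ has a simple pole at $t_*$, the representation of $\mathfrak{so}(3)$ on $\mathbb{C}^N$ induced at $t_*$ is the linear map $a_1X_1+a_2X_2+a_3X_3\mapsto a_1\mathrm{Res}(T_1,t_* )+a_2\mathrm{Res}(T_2,t_* )+a_3\mathrm{Res}(T_3,t_* )$.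
   Formalization: Residues are corrected to Res(f^±,·): Res(f^+,±1)=-1/2∓(n-1)/(2(n+1)), Res(f^-,±1)=-1/2∓(n+3)/(2(n+1)), as the displayed functions give; the representation induced at a pole is X_i↦-Res(T_i), since X_i↦Res(T_i) is not a representation. *)

theory Defs
  imports "HOL-Analysis.Analysis"
begin

section \<open>Matrices\<close>

definition mcomm :: "'a::ring_1^'n^'n \<Rightarrow> 'a^'n^'n \<Rightarrow> 'a^'n^'n" where
  "mcomm A B = A ** B - B ** A"

definition cadjoint :: "complex^'n^'m \<Rightarrow> complex^'m^'n" where
  "cadjoint A = (\<chi> i j. cnj (A $ j $ i))"

definition su :: "(complex^'n^'n) set" where
  "su = {M. cadjoint M = - M \<and> trace M = 0}"

definition SU :: "(complex^'n^'n) set" where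
  "SU = {U. cadjoint U ** U = mat 1 \<and> det U = 1}"

definition SO3 :: "(real^3^3) set" where
  "SO3 = {A. orthogonal_matrix A \<and> det A = 1}"

definition gauge_act :: "complex^'n^'n \<Rightarrow> complex^'n^'n \<Rightarrow> complex^'n^'n" where
  "gauge_act U M = U ** M ** matrix_inv U"

definition block_mat ::
  "complex^'p^'p \<Rightarrow> complex^'m^'p \<Rightarrow> complex^'p^'m \<Rightarrow> complex^'m^'m
    \<Rightarrow> complex^('p + 'm)^('p + 'm)" where
  "block_mat A B C D = (\<chi> i j.
     (case i of
        Inl a \<Rightarrow> (case j of Inl b \<Rightarrow> A $ a $ b | Inr b \<Rightarrow> B $ a $ b)
      | Inr a \<Rightarrow> (case j of Inl b \<Rightarrow> C $ a $ b | Inr b \<Rightarrow> D $ a $ b)))"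

text \<open>The index type \<open>3\<close> has the elements \<open>1\<close>, \<open>2\<close> and \<open>3\<close> (with \<open>3 = 0\<close>).\<close>

definition levi_civita :: "3 \<Rightarrow> 3 \<Rightarrow> 3 \<Rightarrow> real" where
  "levi_civita i j k =
     (if (i, j, k) \<in> {(1, 2, 3), (2, 3, 1), (3, 1, 2)} then 1
      else if (i, j, k) \<in> {(1, 3, 2), (2, 1, 3), (3, 2, 1)} then - 1
      else 0)"


section \<open>Representations of the Lie algebra so(3)\<close>

definition so3 :: "(real^3^3) set" where
  "so3 = {A. transpose A = - A}"

definition so3_basis :: "3 \<Rightarrow> real^3^3" where
  "so3_basis i = (\<chi> j k. - levi_civita i j k)"

definition so3_rep :: "(real^3^3 \<Rightarrow> complex^'n^'n) \<Rightarrow> bool" where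
  "so3_rep \<rho> \<longleftrightarrow>
     (\<forall>A\<in>so3. \<forall>B\<in>so3. \<rho> (A + B) = \<rho> A + \<rho> B) \<and>
     (\<forall>c. \<forall>A\<in>so3. \<rho> (c *\<^sub>R A) = c *\<^sub>R \<rho> A) \<and>
     (\<forall>A\<in>so3. \<forall>B\<in>so3. \<rho> (mcomm A B) = mcomm (\<rho> A) (\<rho> B))"

text \<open>
  An irreducible representation with an invariant Hermitian inner product, written in an
  orthonormal basis: invariance then says that the representing matrices are anti-Hermitian.
  The dimension is the cardinality of the index type, so it is positive.
\<close>

definition so3_unitary_irrep :: "(real^3^3 \<Rightarrow> complex^'n^'n) \<Rightarrow> bool" where
  "so3_unitary_irrep \<rho> \<longleftrightarrow>
     so3_rep \<rho> \<and>
     (\<forall>A\<in>so3. cadjoint (\<rho> A) = - \<rho> A) \<and>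
     (\<forall>S. vec.subspace S \<and> (\<forall>A\<in>so3. \<forall>v\<in>S. \<rho> A *v v \<in> S) \<longrightarrow> S = {0} \<or> S = UNIV)"

definition so3_rep_iso ::
  "(real^3^3 \<Rightarrow> complex^'a^'a) \<Rightarrow> (real^3^3 \<Rightarrow> complex^'b^'b) \<Rightarrow> bool" where
  "so3_rep_iso \<rho> \<sigma> \<longleftrightarrow>
     so3_rep \<rho> \<and> so3_rep \<sigma> \<and>
     (\<exists>P :: complex^'a^'b. invertible P \<and> (\<forall>A\<in>so3. P ** \<rho> A = \<sigma> A ** P))"

definition rep_sum ::
  "(real^3^3 \<Rightarrow> complex^'p^'p) \<Rightarrow> (real^3^3 \<Rightarrow> complex^'m^'m)
    \<Rightarrow> real^3^3 \<Rightarrow> complex^('p + 'm)^('p + 'm)" where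
  "rep_sum \<rho> \<sigma> A = block_mat (\<rho> A) 0 0 (\<sigma> A)"

text \<open>The direct sum of copies of \<open>\<rho>\<close>, one for each element of the index type \<open>'k\<close>.\<close>

definition rep_copies ::
  "(real^3^3 \<Rightarrow> complex^'b^'b) \<Rightarrow> real^3^3 \<Rightarrow> complex^('k::finite \<times> 'b)^('k \<times> 'b)" where
  "rep_copies \<rho> A =
     (\<chi> i j. if fst i = fst j then \<rho> A $ snd i $ snd j else 0)"

text \<open>
  The triple \<open>B\<close> of maps from the representation space of \<open>\<sigma>\<close> to that of \<open>\<rho>\<close>; it is
  determined by these conditions only up to a phase.
\<close>

definition intertwining_triple ::
  "(real^3^3 \<Rightarrow> complex^'p^'p) \<Rightarrow> (real^3^3 \<Rightarrow> complex^'m^'m)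
    \<Rightarrow> (3 \<Rightarrow> complex^'m^'p) \<Rightarrow> bool" where
  "intertwining_triple \<rho> \<sigma> B \<longleftrightarrow>
     (\<forall>j k. \<rho> (so3_basis j) ** B k - B k ** \<sigma> (so3_basis j)
        = (\<Sum>i\<in>UNIV. levi_civita i j k *\<^sub>R B i)) \<and>
     (\<Sum>i\<in>UNIV. B i ** cadjoint (B i)) = mat 1"


section \<open>Analytic functions and residues\<close>

definition real_analytic_on :: "(real \<Rightarrow> real) \<Rightarrow> real set \<Rightarrow> bool" where
  "real_analytic_on f I \<longleftrightarrow>
     (\<forall>t\<in>I. \<exists>\<delta>>0. \<exists>a :: nat \<Rightarrow> real.
        \<forall>s\<in>I. \<bar>s - t\<bar> < \<delta> \<longrightarrow> (\<lambda>k. a k * (s - t) ^ k) sums f s)"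

text \<open>
  The function \<open>h\<close>, of interest only on \<open>I\<close>, has a simple pole at the limit point \<open>p\<close> of \<open>I\<close>
  with residue \<open>r\<close>: the function \<open>(t - p) h(t)\<close> is the restriction to \<open>I\<close> of
  a function that is analytic near \<open>p\<close> and takes the nonzero value \<open>r\<close> at \<open>p\<close>.
\<close>

definition has_simple_pole_residue ::
  "(real \<Rightarrow> 'a::real_normed_vector) \<Rightarrow> real set \<Rightarrow> real \<Rightarrow> 'a \<Rightarrow> bool" where
  "has_simple_pole_residue h I p r \<longleftrightarrow>
     p islimpt I \<and> p \<notin> I \<and> r \<noteq> 0 \<and>
     (\<exists>\<delta>>0. \<exists>a :: nat \<Rightarrow> 'a. a 0 = r \<and>
        (\<forall>t\<in>I. \<bar>t - p\<bar> < \<delta> \<longrightarrow> (\<lambda>k. (t - p) ^ k *\<^sub>R a k) sums ((t - p) *\<^sub>R h t)))"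


section \<open>Nahm data\<close>

definition nahm_datum :: "real set \<Rightarrow> (3 \<Rightarrow> real \<Rightarrow> complex^'n^'n) \<Rightarrow> bool" where
  "nahm_datum I T \<longleftrightarrow>
     (\<forall>t\<in>I. (\<forall>i. T i t \<in> su) \<and>
        (T 1 has_vector_derivative mcomm (T 2 t) (T 3 t)) (at t) \<and>
        (T 2 has_vector_derivative mcomm (T 3 t) (T 1 t)) (at t) \<and>
        (T 3 has_vector_derivative mcomm (T 1 t) (T 2 t)) (at t))"

definition spherically_symmetric ::
  "real set \<Rightarrow> (3 \<Rightarrow> real \<Rightarrow> complex^'n^'n) \<Rightarrow> bool" where
  "spherically_symmetric I T \<longleftrightarrow>
     (\<forall>A\<in>SO3. \<exists>U\<in>SU. \<forall>t\<in>I. \<forall>i.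
        (\<Sum>j\<in>UNIV. A $ i $ j *\<^sub>R T j t) = gauge_act (matrix_inv U) (T i t))"

definition symmetry_generators ::
  "real set \<Rightarrow> (3 \<Rightarrow> real \<Rightarrow> complex^'n^'n) \<Rightarrow> (3 \<Rightarrow> complex^'n^'n) \<Rightarrow> bool" where
  "symmetry_generators I T Y \<longleftrightarrow>
     (\<forall>i. Y i \<in> su) \<and>
     (\<forall>t\<in>I. \<forall>i j. mcomm (Y i) (T j t) = (\<Sum>k\<in>UNIV. levi_civita i j k *\<^sub>R T k t))"

definition induces_rep ::
  "(3 \<Rightarrow> complex^'n^'n) \<Rightarrow> (real^3^3 \<Rightarrow> complex^'n^'n) \<Rightarrow> bool" where
  "induces_rep Y \<rho> \<longleftrightarrow>
     (\<forall>i j. mcomm (Y i) (Y j) = (\<Sum>k\<in>UNIV. levi_civita i j k *\<^sub>R Y k)) \<and>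
     so3_rep \<rho> \<and> (\<forall>i. \<rho> (so3_basis i) = Y i)"

definition irreducible_datum ::
  "real set \<Rightarrow> (3 \<Rightarrow> real \<Rightarrow> complex^'n^'n) \<Rightarrow> bool" where
  "irreducible_datum I T \<longleftrightarrow>
     (\<forall>S. vec.subspace S \<and> (\<forall>t\<in>I. \<forall>i. \<forall>v\<in>S. T i t *v v \<in> S) \<longrightarrow> S = {0} \<or> S = UNIV)"

text \<open>
  The representation of so(3) induced by the residues \<open>R i\<close> of \<open>T i\<close> at \<open>p\<close>. Inserting
  \<open>T i t = R i / (t - p) + \<dots>\<close> into Nahm's equations gives \<open>[R 1, R 2] = - R 3\<close>
  and its cyclic permutations, so it is the negated residues that satisfy the commutation
  relations of the basis \<open>so3_basis\<close>; hence the minus sign. A matrix \<open>A \<in> so3\<close> is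
  \<open>a\<^sub>1 X\<^sub>1 + a\<^sub>2 X\<^sub>2 + a\<^sub>3 X\<^sub>3\<close>, where \<open>X\<^sub>i\<close> is \<open>so3_basis i\<close>.
\<close>

definition induces_rep_at ::
  "real set \<Rightarrow> (3 \<Rightarrow> real \<Rightarrow> complex^'n^'n) \<Rightarrow> real \<Rightarrow> (real^3^3 \<Rightarrow> complex^'n^'n) \<Rightarrow> bool" where
  "induces_rep_at I T p \<rho> \<longleftrightarrow>
     (\<exists>R. (\<forall>i. has_simple_pole_residue (T i) I p (R i)) \<and>
        (\<forall>a :: 3 \<Rightarrow> real.
           \<rho> (\<Sum>i\<in>UNIV. a i *\<^sub>R so3_basis i) = - (\<Sum>i\<in>UNIV. a i *\<^sub>R R i)))"


section \<open>The reduced system\<close>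

definition reduced_datum ::
  "(real^3^3 \<Rightarrow> complex^'p^'p) \<Rightarrow> (real^3^3 \<Rightarrow> complex^'m^'m) \<Rightarrow> (3 \<Rightarrow> complex^'m^'p)
    \<Rightarrow> (real \<Rightarrow> real) \<Rightarrow> (real \<Rightarrow> real) \<Rightarrow> (real \<Rightarrow> real)
    \<Rightarrow> 3 \<Rightarrow> real \<Rightarrow> complex^('p + 'm)^('p + 'm)" where
  "reduced_datum \<rho> \<sigma> B fp fm g i t =
     block_mat (fp t *\<^sub>R \<rho> (so3_basis i)) (g t *\<^sub>R B i)
               (- (g t *\<^sub>R cadjoint (B i))) (fm t *\<^sub>R \<sigma> (so3_basis i))"

definition reduced_solution ::
  "nat \<Rightarrow> real set \<Rightarrow> (real \<Rightarrow> real) \<Rightarrow> (real \<Rightarrow> real) \<Rightarrow> (real \<Rightarrow> real) \<Rightarrow> bool" where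
  "reduced_solution n I fp fm g \<longleftrightarrow>
     (\<forall>t\<in>I.
        (fp has_real_derivative (fp t)\<^sup>2 + 2 / (real n + 1) * (g t)\<^sup>2) (at t) \<and>
        (g has_real_derivative ((real n + 3) / 2 * fp t - (real n - 1) / 2 * fm t) * g t) (at t) \<and>
        (fm has_real_derivative
           (fm t)\<^sup>2 - 2 * (real n + 2) / (real n * (real n + 1)) * (g t)\<^sup>2) (at t))"

definition maximal_reduced_solution ::
  "nat \<Rightarrow> real set \<Rightarrow> (real \<Rightarrow> real) \<Rightarrow> (real \<Rightarrow> real) \<Rightarrow> (real \<Rightarrow> real) \<Rightarrow> bool" where
  "maximal_reduced_solution n I fp fm g \<longleftrightarrow>
     reduced_solution n I fp fm g \<and>
     \<not> (\<exists>J fp' fm' g'. open J \<and> is_interval J \<and> I \<subset> J \<and> reduced_solution n J fp' fm' g' \<and>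
          (\<forall>t\<in>I. fp' t = fp t \<and> fm' t = fm t \<and> g' t = g t))"

definition fp_sol :: "nat \<Rightarrow> real \<Rightarrow> real" where
  "fp_sol n t = - (((real n + 1) * t + (real n - 1)) / ((real n + 1) * (t\<^sup>2 - 1)))"

definition fm_sol :: "nat \<Rightarrow> real \<Rightarrow> real" where
  "fm_sol n t = - (((real n + 1) * t + (real n + 3)) / ((real n + 1) * (t\<^sup>2 - 1)))"

definition g_sol :: "nat \<Rightarrow> real \<Rightarrow> real" where
  "g_sol n t = sqrt (2 * real n / (real n + 1)) * (1 / (t\<^sup>2 - 1))"

end

theory Submission
  imports Defs
begin

text \<open>
  Spherical symmetry means that the \<open>T\<^sub>i\<close> form a vector operator for the generators, and
  a vector operator between irreducible representations is unique up to a scalar whenever it exists;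
  all structure constants follow from evaluating the Casimir operator on it. This gives the block form
  and the reduced system. The phase of the off-diagonal coefficient is constant in time, since its
  logarithmic derivative is real, and is removed by a gauge transformation; analyticity holds because
  the system is quadratic.

  The explicit solution has the form \<open>T\<^sub>i = - S\<^sub>i / (t + 1) - L\<^sub>i / (t - 1)\<close>,
  where \<open>S\<close> and \<open>L\<close> are commuting representations whose sum is the given one
  (the Clebsch-Gordan decomposition of \<open>V\<^sub>2 \<otimes> V\<^bsub>n+1\<^esub>\<close>). Their Casimir
  operators are scalars, which identifies them as multiples of one irreducible representation. A group
  element implementing a rotation is obtained from the equivalence of an irreducible representation
  with its rotated copy, without exponentiating.
\<close>

section \<open>Complex matrices\<close>

text \<open>One number governs the reduced system: the difference \<open>-(n+1)\<close> of the
  Casimir scalars of the two summands. Commuting a Casimir operator past a vector operator becomes a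
  curl identity, whose factors \<open>(n+3)/2\<close> and \<open>(n-1)/2\<close> are the
  coefficients in the equation for \<open>g\<close>. Pairing the cross products of \<open>B\<close>
  and its adjoint with the generators then yields \<open>2/(n+1)\<close> and
  \<open>2(n+2)/(n(n+1))\<close>.

  The obstacle is uniqueness without bases or coupling tables. Two vector operators are compared
  through their products with an adjoint, and irreducibles are identified by one closed formula,
  \<open>hw_map\<close>, which builds an intertwiner from highest weight vectors; its trace even
  yields the dimension.

  A sum of two commuting triples with poles as displayed solves Nahm's equations because the mixed
  brackets vanish and the bracket of each pole term is its own derivative. Spin 1/2 and spin n/2 are
  the pair with total spins (n+1)/2 and (n-1)/2, which are \<open>V_(n+2)\<close> and
  \<open>V_n\<close>.\<close>

definition cscale :: "complex \<Rightarrow> complex^'b^'a \<Rightarrow> complex^'b^'a" (infixr "*\<^sub>C" 75) where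
  "c *\<^sub>C A = (\<chi> i j. c * A $ i $ j)"

lemma cscale_nth [simp]: "(c *\<^sub>C A) $ i $ j = c * A $ i $ j"
  by (simp add: cscale_def)

lemma cadjoint_nth [simp]: "cadjoint A $ i $ j = cnj (A $ j $ i)"
  by (simp add: cadjoint_def)

lemma matrix_mult_nth: "(A ** B) $ i $ j = (\<Sum>k\<in>UNIV. A $ i $ k * B $ k $ j)"
  by (simp add: matrix_matrix_mult_def)

lemma matrix_minus_left [simp]: "(- A) ** B = - (A ** B)"
  for A :: "'a::ring_1^'n^'m"
  by (simp add: vec_eq_iff matrix_mult_nth sum_negf)

lemma matrix_minus_right [simp]: "A ** (- B) = - (A ** B)"
  for A :: "'a::ring_1^'n^'m"
  by (simp add: vec_eq_iff matrix_mult_nth sum_negf)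

lemma matrix_diff_ldistrib: "A ** (B - C) = A ** B - A ** C"
  for A :: "'a::ring_1^'n^'m"
  by (simp add: vec_eq_iff matrix_mult_nth sum_subtractf algebra_simps)

lemma matrix_diff_rdistrib: "(A - B) ** C = A ** C - B ** C"
  for A :: "'a::ring_1^'n^'m"
  by (simp add: vec_eq_iff matrix_mult_nth sum_subtractf algebra_simps)

lemma matrix_add_rdistrib: "(A + B) ** C = A ** C + B ** C"
  for A :: "'a::ring_1^'n^'m"
  by (simp add: vec_eq_iff matrix_mult_nth sum.distrib algebra_simps)

lemma matrix_zero_left [simp]: "0 ** A = (0 :: 'a::ring_1^'n^'m)"
  by (simp add: vec_eq_iff matrix_mult_nth)

lemma matrix_zero_right [simp]: "A ** 0 = (0 :: 'a::ring_1^'n^'m)"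
  by (simp add: vec_eq_iff matrix_mult_nth)

lemma matrix_sum_right: "A ** (\<Sum>i\<in>I. f i) = (\<Sum>i\<in>I. A ** f i)"
  for A :: "'a::ring_1^'n^'m"
  by (induction I rule: infinite_finite_induct) (auto simp: matrix_add_ldistrib)

lemma matrix_sum_left: "(\<Sum>i\<in>I. f i) ** A = (\<Sum>i\<in>I. f i ** A)"
  for A :: "'a::ring_1^'n^'m"
  by (induction I rule: infinite_finite_induct) (auto simp: matrix_add_rdistrib)

lemma cscale_mult_left [simp]: "(c *\<^sub>C A) ** B = c *\<^sub>C (A ** B)"
  by (simp add: vec_eq_iff matrix_mult_nth sum_distrib_left mult.assoc)

lemma cscale_mult_right [simp]: "A ** (c *\<^sub>C B) = c *\<^sub>C (A ** B)"
  by (simp add: vec_eq_iff matrix_mult_nth sum_distrib_left mult_ac)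

lemma cscale_cscale [simp]: "a *\<^sub>C b *\<^sub>C A = (a * b) *\<^sub>C A"
  by (simp add: vec_eq_iff mult.assoc)

lemma cscale_add_right: "a *\<^sub>C (A + B) = a *\<^sub>C A + a *\<^sub>C B"
  by (simp add: vec_eq_iff algebra_simps)

lemma cscale_diff_right: "a *\<^sub>C (A - B) = a *\<^sub>C A - a *\<^sub>C B"
  by (simp add: vec_eq_iff algebra_simps)

lemma cscale_minus_right [simp]: "a *\<^sub>C (- A) = - (a *\<^sub>C A)"
  by (simp add: vec_eq_iff)

lemma cscale_zero_right [simp]: "a *\<^sub>C 0 = 0"
  by (simp add: vec_eq_iff)

lemma cscale_zero_left [simp]: "0 *\<^sub>C A = 0"
  by (simp add: vec_eq_iff)

lemma cscale_one [simp]: "1 *\<^sub>C A = A"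
  by (simp add: vec_eq_iff)

lemma cscale_add_left: "(a + b) *\<^sub>C A = a *\<^sub>C A + b *\<^sub>C A"
  by (simp add: vec_eq_iff algebra_simps)

lemma cscale_diff_left: "(a - b) *\<^sub>C A = a *\<^sub>C A - b *\<^sub>C A"
  by (simp add: vec_eq_iff algebra_simps)

lemma cscale_minus_left [simp]: "(- a) *\<^sub>C A = - (a *\<^sub>C A)"
  by (simp add: vec_eq_iff)

lemma cscale_sum_right: "a *\<^sub>C (\<Sum>i\<in>I. f i) = (\<Sum>i\<in>I. a *\<^sub>C f i)"
  by (induction I rule: infinite_finite_induct) (auto simp: cscale_add_right)

lemma cscale_eq_0_iff [simp]: "a *\<^sub>C A = 0 \<longleftrightarrow> a = 0 \<or> A = 0"
  by (auto simp: vec_eq_iff)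

lemma cscale_cancel: "a *\<^sub>C A = a *\<^sub>C B \<Longrightarrow> a \<noteq> 0 \<Longrightarrow> A = B"
  by (auto simp: vec_eq_iff)

lemma scaleR_cscale: "r *\<^sub>R A = complex_of_real r *\<^sub>C A"
  for A :: "complex^'b^'a"
  by (simp add: vec_eq_iff scaleR_conv_of_real[where 'a=complex])

lemma cadjoint_cadjoint [simp]: "cadjoint (cadjoint A) = A"
  by (simp add: vec_eq_iff)

lemma cadjoint_mult [simp]: "cadjoint (A ** B) = cadjoint B ** cadjoint A"
  by (simp add: vec_eq_iff matrix_mult_nth mult.commute)

lemma cadjoint_add [simp]: "cadjoint (A + B) = cadjoint A + cadjoint B"
  by (simp add: vec_eq_iff)

lemma cadjoint_diff [simp]: "cadjoint (A - B) = cadjoint A - cadjoint B"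
  by (simp add: vec_eq_iff)

lemma cadjoint_minus [simp]: "cadjoint (- A) = - cadjoint A"
  by (simp add: vec_eq_iff)

lemma cadjoint_zero [simp]: "cadjoint 0 = 0"
  by (simp add: vec_eq_iff)

lemma cadjoint_one [simp]: "cadjoint (mat 1) = mat 1"
  by (simp add: vec_eq_iff mat_def)

lemma cadjoint_cscale [simp]: "cadjoint (c *\<^sub>C A) = cnj c *\<^sub>C cadjoint A"
  by (simp add: vec_eq_iff)

lemma cadjoint_sum: "cadjoint (\<Sum>i\<in>I. f i) = (\<Sum>i\<in>I. cadjoint (f i))"
  by (induction I rule: infinite_finite_induct) auto

lemma cadjoint_eq_0_iff [simp]: "cadjoint A = 0 \<longleftrightarrow> A = 0"
  by (metis cadjoint_cadjoint cadjoint_zero)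

lemma trace_cscale [simp]: "trace (c *\<^sub>C A) = c * trace A"
  by (simp add: trace_def sum_distrib_left)

lemma trace_sum: "trace (\<Sum>i\<in>I. f i) = (\<Sum>i\<in>I. trace (f i :: complex^'n^'n))"
  by (induction I rule: infinite_finite_induct) (auto simp: trace_def sum.distrib)

definition frobenius_sq :: "complex^'n^'m \<Rightarrow> real" where
  "frobenius_sq A = (\<Sum>j\<in>UNIV. \<Sum>i\<in>UNIV. (cmod (A $ i $ j))\<^sup>2)"

lemma trace_adjoint_mult: "trace (cadjoint A ** A) = of_real (frobenius_sq A)"
  by (simp add: frobenius_sq_def trace_def matrix_mult_nth complex_norm_square mult.commute del: of_real_power)

lemma frobenius_sq_nonneg: "frobenius_sq A \<ge> 0"
  by (simp add: frobenius_sq_def sum_nonneg)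

lemma frobenius_sq_eq_0: "frobenius_sq A = 0 \<Longrightarrow> A = 0"
proof -
  assume "frobenius_sq A = 0"
  then have "\<forall>j. (\<Sum>i\<in>UNIV. (cmod (A $ i $ j))\<^sup>2) = 0"
    unfolding frobenius_sq_def by (subst (asm) sum_nonneg_eq_0_iff) (auto intro: sum_nonneg)
  then have "\<forall>j i. A $ i $ j = 0"
    by (subst (asm) sum_nonneg_eq_0_iff) auto
  then show "A = 0" by (simp add: vec_eq_iff)
qed

lemma adjoint_mult_eq_0: "cadjoint A ** A = 0 \<Longrightarrow> A = 0"
  using trace_adjoint_mult[of A] frobenius_sq_eq_0[of A] by (simp add: trace_def)

lemma mat_cscale: "mat c = c *\<^sub>C mat 1"
  by (simp add: vec_eq_iff mat_def)

lemma mat_one_neq_zero [simp]: "(mat 1 :: complex^'n^'n) \<noteq> 0"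
  by (auto simp: vec_eq_iff mat_def)

lemma cscale_vector: "(c *\<^sub>C A) *v v = c *s (A *v v)"
  by (simp add: vec_eq_iff matrix_vector_mult_def sum_distrib_left mult.assoc)

lemma matrix_vector_smult: "A *v (c *s v) = c *s (A *v (v :: complex^'n))"
  by (simp add: vec_eq_iff matrix_vector_mult_def sum_distrib_left mult_ac)

lemmas mat_distribs = matrix_add_ldistrib matrix_add_rdistrib matrix_diff_ldistrib
  matrix_diff_rdistrib cscale_add_right cscale_diff_right

lemma inner_adjoint: "inner (A *v v) w = inner v (cadjoint A *v w)"
proof -
  have e: "inner x y = (\<Sum>i\<in>UNIV. Re (cnj (x $ i) * y $ i))" for x y :: "complex^'z"
    by (simp add: inner_vec_def inner_complex_def)
  have "inner (A *v v) w = Re (\<Sum>i\<in>UNIV. \<Sum>j\<in>UNIV. cnj (A $ i $ j * v $ j) * w $ i)"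
    by (simp add: e matrix_vector_mult_def cnj_sum sum_distrib_right)
  also have "\<dots> = Re (\<Sum>j\<in>UNIV. \<Sum>i\<in>UNIV. cnj (A $ i $ j * v $ j) * w $ i)"
    by (subst sum.swap) rule
  also have "\<dots> = inner v (cadjoint A *v w)"
    by (simp add: e matrix_vector_mult_def sum_distrib_left mult_ac)
  finally show ?thesis .
qed

lemma subspace_kernel: "vec.subspace {v. K *v v = (0 :: complex^'m)}"
  by (auto simp: vec.subspace_def matrix_vector_right_distrib matrix_vector_smult)

text \<open>Rayleigh's principle: the quadratic form of \<open>M\<close> attains its maximum on the
  compact unit sphere of the kernel, and a maximiser is an eigenvector. Invariant subspaces are
  encoded as kernels of matrices, with \<open>K = 0\<close> for the whole space. The final bound
  says that the eigenvalue is the largest one, on which \<open>exists_highest\<close>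
  relies.\<close>

lemma hermitian_kernel_eigenvector:
  fixes M :: "complex^'n^'n" and K :: "complex^'n^'m"
  assumes herm: "cadjoint M = M"
    and inv: "\<And>v. K *v v = 0 \<Longrightarrow> K *v (M *v v) = 0"
    and ne: "\<exists>v. v \<noteq> 0 \<and> K *v v = 0"
  obtains v r where "v \<noteq> 0" "K *v v = 0" "M *v v = of_real r *s v"
    "\<And>u. K *v u = 0 \<Longrightarrow> inner u (M *v u) \<le> r * inner u u"
proof -
  have sc: "of_real r *s v = r *\<^sub>R v" for r and v :: "complex^'n"
    by (simp add: vec_eq_iff scaleR_conv_of_real[where 'a=complex])
  have blK: "linear ((*v) K)" and blM: "linear ((*v) M)" by auto
  let ?S = "{v. K *v v = 0} \<inter> sphere 0 1"
  have cont: "continuous_on UNIV (\<lambda>v. K *v v)" "continuous_on UNIV (\<lambda>v. M *v v)"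
    using blK blM linear_continuous_on linear_conv_bounded_linear by blast+
  have "closed {v. K *v v = 0}"
    using continuous_closed_preimage_constant[OF cont(1), of 0] by simp
  then have "compact ?S" by (intro closed_Int_compact) auto
  moreover have "?S \<noteq> {}"
  proof -
    obtain v where v: "v \<noteq> 0" "K *v v = 0" using ne by blast
    have "K *v ((1 / norm v) *\<^sub>R v) = 0"
      using v linear_cmul[OF blK] by simp
    then have "(1 / norm v) *\<^sub>R v \<in> ?S" using v by simp
    then show ?thesis by blast
  qed
  moreover have "continuous_on ?S (\<lambda>v. inner v (M *v v))"
    using continuous_on_subset[OF cont(2), of ?S] by (intro continuous_on_inner continuous_on_id) auto
  ultimately have "\<exists>v\<in>?S. \<forall>u\<in>?S. inner u (M *v u) \<le> inner v (M *v v)"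
    by (rule continuous_attains_sup)
  then obtain v where v: "v \<in> ?S" and max: "\<And>u. u \<in> ?S \<Longrightarrow> inner u (M *v u) \<le> inner v (M *v v)"
    by blast
  define r where "r = inner v (M *v v)"
  have vv: "inner v v = 1" using v by (simp add: dot_square_norm)
  have bound: "inner u (M *v u) \<le> r * inner u u" if "K *v u = 0" for u
  proof (cases "u = 0")
    case False
    have "K *v ((1 / norm u) *\<^sub>R u) = 0"
      using that linear_cmul[OF blK] by simp
    then have "(1 / norm u) *\<^sub>R u \<in> ?S" using False by simp
    from max[OF this] have "inner u (M *v u) / (norm u * norm u) \<le> r"
      by (simp add: r_def linear_cmul[OF blM])
    moreover have "inner u u = norm u * norm u" by (simp add: dot_square_norm power2_eq_square)
    ultimately show ?thesis using False by (simp add: field_simps)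
  qed simp
  define A where "A u = r *\<^sub>R u - M *v u" for u
  have Alin: "A (x + c *\<^sub>R y) = A x + c *\<^sub>R A y" for x y c
    by (simp add: A_def linear_add[OF blM] linear_cmul[OF blM] algebra_simps)
  have Asym: "inner (A x) y = inner x (A y)" for x y
    using inner_adjoint[of M x y] herm by (simp add: A_def inner_diff_left inner_diff_right)
  have Apos: "inner u (A u) \<ge> 0" if "K *v u = 0" for u
    using bound[OF that] by (simp add: A_def inner_diff_right)
  have Av0: "inner v (A v) = 0" using vv by (simp add: A_def inner_diff_right r_def)
  have KAv: "K *v A v = 0"
    using v inv[of v] by (simp add: A_def linear_diff[OF blK] linear_cmul[OF blK])
  define p where "p = inner (A v) (A v)"
  define q where "q = inner (A v) (A (A v))"
  \<comment> \<open>The nonnegative form \<open>A\<close> vanishes at \<open>v\<close>; a nonzero \<open>A v\<close> would make it negative at \<open>v - e A v\<close> for small \<open>e > 0\<close>.\<close>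
  have ineq: "0 \<le> 2 * e * p + e\<^sup>2 * q" for e
  proof -
    have "K *v (v + e *\<^sub>R A v) = 0"
      using v KAv by (simp add: linear_add[OF blK] linear_cmul[OF blK])
    from Apos[OF this] show ?thesis
      using Asym[of v "A v"]
      by (simp add: Alin inner_add_left inner_add_right Av0 p_def q_def power2_eq_square algebra_simps)
  qed
  have "p = 0"
  proof (rule ccontr)
    assume "p \<noteq> 0"
    then have pp: "p > 0" by (simp add: p_def)
    \<comment> \<open>Negative, and small enough that the quadratic term is at most half the linear
      one in size.\<close>
    define e where "e = - (p / (\<bar>q\<bar> + 1))"
    have e: "e < 0" using pp by (simp add: e_def divide_neg_pos field_simps)
    have "0 \<le> e * (2 * p + e * q)" using ineq[of e] by (simp add: power2_eq_square algebra_simps)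
    then have "2 * p + e * q \<le> 0" using e by (simp add: zero_le_mult_iff)
    moreover have "\<bar>e * q\<bar> \<le> p"
    proof -
      have "\<bar>e * q\<bar> = p * (\<bar>q\<bar> / (\<bar>q\<bar> + 1))" using pp by (simp add: e_def abs_mult)
      also have "\<dots> \<le> p * 1" using pp by (intro mult_left_mono) auto
      finally show ?thesis by simp
    qed
    ultimately show False using pp by linarith
  qed
  then have "A v = 0" by (simp add: p_def)
  then have "M *v v = of_real r *s v" by (simp add: A_def sc)
  moreover have "v \<noteq> 0" using vv by auto
  ultimately show thesis using that bound v by blast
qed

section \<open>Triples of generators\<close>

text \<open>Keeping only the even arrangements replaces Levi-Civita sums by a single identity up to
  rotation of the indices.\<close>

definition cyc :: "3 \<Rightarrow> 3 \<Rightarrow> 3 \<Rightarrow> bool" where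
  "cyc i j k \<longleftrightarrow> (i, j, k) \<in> {(1, 2, 3), (2, 3, 1), (3, 1, 2)}"

lemma cyc_rotate: "cyc i j k \<Longrightarrow> cyc j k i"
  by (auto simp: cyc_def)

lemma cyc_rotate2: "cyc i j k \<Longrightarrow> cyc k i j"
  by (auto simp: cyc_def)

lemma cyc_cases:
  assumes "cyc i j k"
  obtains "i = 1" "j = 2" "k = 3" | "i = 2" "j = 3" "k = 1" | "i = 3" "j = 1" "k = 2"
  using assms by (auto simp: cyc_def)

lemma cyc_ex: "\<exists>j k. cyc i j k"
  using exhaust_3[of i] by (auto simp: cyc_def)

lemma cyc_123: "cyc 1 2 3" "cyc 2 3 1" "cyc 3 1 2"
  by (auto simp: cyc_def)

lemma sum_cyc: "cyc i j k \<Longrightarrow> sum f UNIV = f i + f j + (f k :: 'a::comm_monoid_add)"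
  by (auto simp: cyc_def sum_3 ac_simps)

lemma levi_civita_cyc:
  assumes "cyc i j k"
  shows "(\<Sum>l\<in>UNIV. levi_civita i j l *\<^sub>R (C l :: 'a::real_vector)) = C k"
    and "(\<Sum>l\<in>UNIV. levi_civita j i l *\<^sub>R C l) = - C k"
    and "(\<Sum>l\<in>UNIV. levi_civita i i l *\<^sub>R C l) = 0"
    and "(\<Sum>l\<in>UNIV. levi_civita l i j *\<^sub>R C l) = C k"
    and "(\<Sum>l\<in>UNIV. levi_civita l j i *\<^sub>R C l) = - C k"
    and "(\<Sum>l\<in>UNIV. levi_civita l i i *\<^sub>R C l) = 0"
  by (cases rule: cyc_cases[OF assms]; simp add: sum_3 levi_civita_def)+

lemma all_pairs_cyc:
  assumes "\<And>i. P i i" "\<And>i j k. cyc i j k \<Longrightarrow> P i j \<and> P j i"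
  shows "P i j"
proof -
  have "i = j \<or> (\<exists>k. cyc i j k) \<or> (\<exists>k. cyc j i k)"
    using exhaust_3[of i] exhaust_3[of j] by (auto simp: cyc_def)
  then show ?thesis using assms by blast
qed

definition so3_triple :: "(3 \<Rightarrow> complex^'n^'n) \<Rightarrow> bool" where
  "so3_triple Y \<longleftrightarrow>
     (\<forall>i j k. cyc i j k \<longrightarrow> mcomm (Y i) (Y j) = Y k) \<and> (\<forall>i. cadjoint (Y i) = - Y i)"

text \<open>The vector operator relation \<open>[Y_i, C_j] = eps_ijk C_k\<close>, solved for the
  product with the generator on the left, so that it acts as a set of rewrite rules moving
  generators to the right.\<close>

definition tensor_op ::
  "(3 \<Rightarrow> complex^'p^'p) \<Rightarrow> (3 \<Rightarrow> complex^'m^'m) \<Rightarrow> (3 \<Rightarrow> complex^'m^'p) \<Rightarrow> bool" where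
  "tensor_op Y Z C \<longleftrightarrow>
     (\<forall>i. Y i ** C i = C i ** Z i) \<and>
     (\<forall>i j k. cyc i j k \<longrightarrow> Y i ** C j = C j ** Z i + C k \<and> Y j ** C i = C i ** Z j - C k)"

text \<open>As the generators are anti-Hermitian, this is minus the usual total angular momentum
  squared: \<open>-j(j+1)\<close> on spin \<open>j\<close>.\<close>

definition casimir :: "(3 \<Rightarrow> complex^'n^'n) \<Rightarrow> complex^'n^'n" where
  "casimir Y = (\<Sum>i\<in>UNIV. Y i ** Y i)"

definition irreducible_triple :: "(3 \<Rightarrow> complex^'n^'n) \<Rightarrow> bool" where
  "irreducible_triple Y \<longleftrightarrow>
     (\<forall>S. vec.subspace S \<and> (\<forall>i. \<forall>v\<in>S. Y i *v v \<in> S) \<longrightarrow> S = {0} \<or> S = UNIV)"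

lemma so3_tripleD:
  assumes "so3_triple Y"
  shows "cadjoint (Y i) = - Y i"
    and "cyc i j k \<Longrightarrow> Y i ** Y j = Y j ** Y i + Y k"
  using assms by (auto simp: so3_triple_def mcomm_def diff_eq_eq add.commute)

lemma so3_triple_tensor_op: "so3_triple Y \<Longrightarrow> tensor_op Y Y Y"
  by (auto simp: tensor_op_def so3_tripleD)

lemma tensor_op_iff:
  "tensor_op Y Z C \<longleftrightarrow>
     (\<forall>i j. Y i ** C j - C j ** Z i = (\<Sum>k\<in>UNIV. levi_civita i j k *\<^sub>R C k))" (is "_ \<longleftrightarrow> ?R")
proof
  assume t: "tensor_op Y Z C"
  have "Y i ** C j - C j ** Z i = (\<Sum>k\<in>UNIV. levi_civita i j k *\<^sub>R C k)" for i j
  proof (rule all_pairs_cyc)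
    show "Y i ** C i - C i ** Z i = (\<Sum>k\<in>UNIV. levi_civita i i k *\<^sub>R C k)" for i
      using cyc_ex[of i] levi_civita_cyc(3)[where i = i and C = C] t by (auto simp: tensor_op_def)
  next
    fix i j k assume c: "cyc i j k"
    then have "Y i ** C j = C j ** Z i + C k" "Y j ** C i = C i ** Z j - C k"
      using t unfolding tensor_op_def by blast+
    then show "Y i ** C j - C j ** Z i = (\<Sum>k\<in>UNIV. levi_civita i j k *\<^sub>R C k) \<and>
       Y j ** C i - C i ** Z j = (\<Sum>k\<in>UNIV. levi_civita j i k *\<^sub>R C k)"
      by (simp only: levi_civita_cyc(1,2)[OF c]) simp
  qed
  then show ?R by blast
next
  assume r: ?R
  have "Y i ** C i = C i ** Z i" for i
  proof -
    obtain j k where "cyc i j k" using cyc_ex by blast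
    then show ?thesis
      using r[rule_format, of i i] by (simp add: levi_civita_cyc(3)[where C = C])
  qed
  moreover have "Y i ** C j = C j ** Z i + C k \<and> Y j ** C i = C i ** Z j - C k" if c: "cyc i j k" for i j k
    using r[rule_format, of i j] r[rule_format, of j i]
    by (simp add: levi_civita_cyc[OF c] diff_eq_eq)
  ultimately show "tensor_op Y Z C" by (simp add: tensor_op_def)
qed

lemma levi_civita_rotate: "levi_civita i j k = levi_civita j k i"
  using exhaust_3[of i] exhaust_3[of j] exhaust_3[of k] by (auto simp: levi_civita_def)

text \<open>A real eigenvalue \<open>r\<close> exists by maximisation, and the kernel of
  \<open>M - r\<close> is a nonzero invariant subspace, hence everything.\<close>

lemma schur_hermitian:
  fixes Y :: "3 \<Rightarrow> complex^'n^'n"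
  assumes irr: "irreducible_triple Y" and comm: "\<And>i. M ** Y i = Y i ** M" and "cadjoint M = M"
  shows "\<exists>r::real. M = of_real r *\<^sub>C mat 1"
proof -
  have "\<exists>v::complex^'n. v \<noteq> 0 \<and> (0 :: complex^'n^'n) *v v = 0"
    by (intro exI[of _ "1"]) simp
  then obtain v r where v: "v \<noteq> 0" "M *v v = complex_of_real r *s v"
    by (rule hermitian_kernel_eigenvector[of M "0 :: complex^'n^'n", OF assms(3), rotated]) auto
  let ?N = "M - of_real r *\<^sub>C mat 1"
  let ?S = "{u. ?N *v u = 0}"
  have "?N ** Y i = Y i ** ?N" for i
    by (simp add: mat_distribs comm)
  then have "?N *v (Y i *v u) = 0" if "?N *v u = 0" for i u
  proof -
    have "?N *v (Y i *v u) = Y i *v (?N *v u)"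
      by (simp only: matrix_vector_mul_assoc \<open>?N ** Y i = Y i ** ?N\<close>)
    then show ?thesis using that by simp
  qed
  then have "?S = {0} \<or> ?S = UNIV"
    using irr subspace_kernel[of ?N] unfolding irreducible_triple_def by blast
  moreover have "v \<in> ?S"
    using v by (simp add: matrix_vector_mult_diff_rdistrib cscale_vector)
  ultimately have "?S = UNIV" using v by auto
  then have "\<forall>u. ?N *v u = 0" by blast
  then have "?N = 0" by (simp add: matrix_eq del: right_minus_eq)
  then show ?thesis by auto
qed

text \<open>Anti-Hermitian generators also commute with the adjoint of \<open>M\<close>, so the
  Hermitian and anti-Hermitian parts of \<open>M\<close> can be treated separately.\<close>

lemma schur:
  fixes Y :: "3 \<Rightarrow> complex^'n^'n"
  assumes irr: "irreducible_triple Y" and comm: "\<And>i. M ** Y i = Y i ** M"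
    and adj: "\<And>i. cadjoint (Y i) = - Y i"
  shows "\<exists>c. M = c *\<^sub>C mat 1"
proof -
  have comm': "cadjoint M ** Y i = Y i ** cadjoint M" for i
  proof -
    have "cadjoint (M ** Y i) = cadjoint (Y i ** M)" using comm by simp
    then show ?thesis by (simp add: adj)
  qed
  let ?P = "M + cadjoint M" and ?Q = "\<i> *\<^sub>C (M - cadjoint M)"
  obtain a where a: "?P = of_real a *\<^sub>C mat 1"
    using schur_hermitian[OF irr, of ?P] by (auto simp: mat_distribs comm comm' add.commute)
  obtain b where b: "?Q = of_real b *\<^sub>C mat 1"
    using schur_hermitian[OF irr, of ?Q] by (auto simp: mat_distribs comm comm')
  have "M = (1/2) *\<^sub>C (?P - \<i> *\<^sub>C ?Q)"
    by (simp add: vec_eq_iff algebra_simps)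
  also have "\<dots> = ((a - \<i> * b) / 2) *\<^sub>C mat 1"
    unfolding a b by (simp add: vec_eq_iff algebra_simps diff_divide_distrib)
  finally show ?thesis by blast
qed

section \<open>Highest weights\<close>

text \<open>With the Hermitian operators \<open>J_k = \<i> Y_k\<close>, the three operators
  \<open>raise\<close>, \<open>lower\<close>, \<open>weight\<close> are the standard
  \<open>J_1 + \<i> J_2\<close>, \<open>J_1 - \<i> J_2\<close> and \<open>J_3\<close>.\<close>

definition raise :: "(3 \<Rightarrow> complex^'n^'n) \<Rightarrow> complex^'n^'n" where
  "raise Y = \<i> *\<^sub>C Y 1 - Y 2"

definition lower :: "(3 \<Rightarrow> complex^'n^'n) \<Rightarrow> complex^'n^'n" where
  "lower Y = \<i> *\<^sub>C Y 1 + Y 2"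

definition weight :: "(3 \<Rightarrow> complex^'n^'n) \<Rightarrow> complex^'n^'n" where
  "weight Y = \<i> *\<^sub>C Y 3"

lemma
  assumes "so3_triple Y"
  shows cadjoint_raise: "cadjoint (raise Y) = lower Y"
    and cadjoint_lower: "cadjoint (lower Y) = raise Y"
    and cadjoint_weight: "cadjoint (weight Y) = weight Y"
  by (simp_all add: raise_def lower_def weight_def so3_tripleD(1)[OF assms])

lemma
  assumes "so3_triple Y"
  shows weight_raise: "weight Y ** raise Y = raise Y ** weight Y + raise Y"
    and weight_lower: "weight Y ** lower Y = lower Y ** weight Y - lower Y"
    and raise_lower: "raise Y ** lower Y = lower Y ** raise Y + 2 *\<^sub>C weight Y"
    and casimir_lower_raise:
      "casimir Y = - (lower Y ** raise Y + weight Y ** weight Y + weight Y)"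
  using so3_tripleD(2)[OF assms cyc_123(1)] so3_tripleD(2)[OF assms cyc_123(2)]
    so3_tripleD(2)[OF assms cyc_123(3)]
  by (simp_all add: raise_def lower_def weight_def mat_distribs casimir_def sum_3)
     (simp_all add: vec_eq_iff algebra_simps)

primrec mpow :: "complex^'n^'n \<Rightarrow> nat \<Rightarrow> complex^'n^'n" where
  "mpow A 0 = mat 1"
| "mpow A (Suc l) = A ** mpow A l"

lemma mpow_commute: "mpow A l ** A = A ** mpow A l"
  by (induction l) (simp_all add: matrix_mul_assoc[symmetric])

lemma cadjoint_mpow: "cadjoint (mpow A l) = mpow (cadjoint A) l"
  by (induction l) (simp_all add: mpow_commute)

text \<open>The number of columns of \<open>W\<close> is left open: one column is a highest weight
  vector, while a matrix all of whose columns are such vectors can seed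
  \<open>hw_map\<close>.\<close>

definition highest :: "(3 \<Rightarrow> complex^'n^'n) \<Rightarrow> real \<Rightarrow> complex^'a^'n \<Rightarrow> bool" where
  "highest Y j W \<longleftrightarrow> raise Y ** W = 0 \<and> weight Y ** W = of_real j *\<^sub>C W"

lemma weight_mpow_lower:
  assumes "so3_triple Y" "highest Y j W"
  shows "weight Y ** (mpow (lower Y) l ** W) = of_real (j - real l) *\<^sub>C (mpow (lower Y) l ** W)"
proof (induction l)
  case 0
  then show ?case using assms(2) by (simp add: highest_def)
next
  case (Suc l)
  have "weight Y ** (mpow (lower Y) (Suc l) ** W)
      = (weight Y ** lower Y) ** (mpow (lower Y) l ** W)"
    by (simp add: matrix_mul_assoc)
  also have "\<dots> = lower Y ** (weight Y ** (mpow (lower Y) l ** W)) - lower Y ** (mpow (lower Y) l ** W)"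
    by (simp only: weight_lower[OF assms(1)] matrix_diff_rdistrib matrix_mul_assoc)
  finally show ?case
    unfolding Suc.IH by (simp add: matrix_mul_assoc vec_eq_iff algebra_simps)
qed

lemma raise_mpow_lower:
  assumes "so3_triple Y" "highest Y j W"
  shows "raise Y ** (mpow (lower Y) (Suc l) ** W)
    = of_real ((real l + 1) * (2 * j - real l)) *\<^sub>C (mpow (lower Y) l ** W)"
proof (induction l)
  case 0
  have "raise Y ** (lower Y ** W) = (lower Y ** raise Y + 2 *\<^sub>C weight Y) ** W"
    by (simp only: matrix_mul_assoc raise_lower[OF assms(1)])
  also have "\<dots> = lower Y ** (raise Y ** W) + 2 *\<^sub>C (weight Y ** W)"
    by (simp add: matrix_add_rdistrib matrix_mul_assoc)
  finally show ?case using assms(2) by (simp add: highest_def)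
next
  case (Suc l)
  let ?V = "mpow (lower Y) (Suc l) ** W"
  have "raise Y ** (mpow (lower Y) (Suc (Suc l)) ** W) = (raise Y ** lower Y) ** ?V"
    by (simp add: matrix_mul_assoc)
  also have "\<dots> = lower Y ** (raise Y ** ?V) + 2 *\<^sub>C (weight Y ** ?V)"
    by (simp add: raise_lower[OF assms(1)] matrix_add_rdistrib matrix_mul_assoc[symmetric])
  finally show ?case
    unfolding Suc.IH weight_mpow_lower[OF assms]
    by (simp add: matrix_mul_assoc vec_eq_iff algebra_simps)
qed

text \<open>Each step moves one \<open>lower\<close> across the adjoint as a \<open>raise\<close>
  and applies \<open>raise_mpow_lower\<close>. These are the squared norms of the ladder: their sign
  forces integrality of the weight, and their vanishing ends the ladder.\<close>

lemma adjoint_mult_mpow_lower: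
  assumes "so3_triple Y" "highest Y j W"
  shows "cadjoint (mpow (lower Y) l ** W) ** (mpow (lower Y) l ** W)
    = of_real (\<Prod>i<l. (real i + 1) * (2 * j - real i)) *\<^sub>C (cadjoint W ** W)"
proof (induction l)
  case (Suc l)
  have "cadjoint (mpow (lower Y) (Suc l) ** W) ** (mpow (lower Y) (Suc l) ** W)
      = cadjoint (mpow (lower Y) l ** W) ** (raise Y ** (mpow (lower Y) (Suc l) ** W))"
    by (simp add: matrix_mul_assoc cadjoint_lower[OF assms(1)])
  then show ?case
    unfolding raise_mpow_lower[OF assms] using Suc.IH
    by (simp add: vec_eq_iff algebra_simps)
qed simp

text \<open>If \<open>2 * j\<close> were not a natural number, no factor would vanish and all
  products, being nonnegative, would be positive; but a factor with \<open>l > 2 * j\<close> is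
  negative and flips the sign.\<close>

lemma highest_weight_dim:
  assumes "so3_triple Y" "highest Y j W" "W \<noteq> 0"
  shows "\<exists>d>0. 2 * j + 1 = real d"
proof -
  let ?p = "\<lambda>l. \<Prod>i<l. (real i + 1) * (2 * j - real i)"
  have tp: "frobenius_sq W > 0"
    using assms(3) frobenius_sq_nonneg[of W] frobenius_sq_eq_0[of W] by force
  have nn: "?p l \<ge> 0" for l
  proof -
    let ?V = "mpow (lower Y) l ** W"
    have "complex_of_real (?p l * frobenius_sq W) = trace (cadjoint ?V ** ?V)"
      unfolding adjoint_mult_mpow_lower[OF assms(1,2)] by (simp add: trace_adjoint_mult)
    then have "?p l * frobenius_sq W = frobenius_sq ?V"
      unfolding trace_adjoint_mult using of_real_eq_iff by blast
    then have "?p l * frobenius_sq W \<ge> 0" by (simp only: frobenius_sq_nonneg)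
    then show ?thesis using tp by (simp add: zero_le_mult_iff)
  qed
  have "\<exists>l. 2 * j = real l"
  proof (rule ccontr)
    assume no: "\<nexists>l. 2 * j = real l"
    have pos: "?p l > 0" for l
    proof -
      have "(real i + 1) * (2 * j - real i) \<noteq> 0" for i
        using no by (auto simp: add_eq_0_iff_both_eq_0)
      then have "?p l \<noteq> 0" by (metis (no_types, lifting) finite_lessThan prod_zero_iff)
      then show ?thesis using nn[of l] by linarith
    qed
    obtain l where l: "2 * j < real l" using reals_Archimedean2 by blast
    have "?p (Suc l) = ?p l * ((real l + 1) * (2 * j - real l))" by simp
    also have "\<dots> < 0" using l pos[of l] by (intro mult_pos_neg mult_pos_neg) auto
    finally show False using nn[of "Suc l"] by simp
  qed
  then obtain l where "2 * j = real l" by blast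
  then show ?thesis by (intro exI[of _ "Suc l"]) auto
qed

lemma mpow_lower_vanish:
  assumes "so3_triple Y" "highest Y j W" "2 * j + 1 = real d" "d > 0"
  shows "mpow (lower Y) d ** W = 0"
proof -
  obtain l where l: "d = Suc l" using assms(4) gr0_implies_Suc by blast
  have "2 * j = real l" using assms(3) l by simp
  then have "cadjoint (mpow (lower Y) d ** W) ** (mpow (lower Y) d ** W) = 0"
    unfolding adjoint_mult_mpow_lower[OF assms(1,2)] l by simp
  then show ?thesis by (rule adjoint_mult_eq_0)
qed

lemma casimir_highest:
  assumes "so3_triple Y" "highest Y j W"
  shows "casimir Y ** W = of_real (- (j * (j + 1))) *\<^sub>C W"
proof -
  have "casimir Y ** W = - (lower Y ** (raise Y ** W) + weight Y ** (weight Y ** W) + weight Y ** W)"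
    by (simp add: casimir_lower_raise[OF assms(1)] matrix_add_rdistrib matrix_mul_assoc matrix_diff_rdistrib)
  moreover have "raise Y ** W = 0" "weight Y ** W = of_real j *\<^sub>C W"
    using assms(2) by (auto simp: highest_def)
  ultimately show ?thesis
    by (simp add: vec_eq_iff algebra_simps)
qed

text \<open>Take an eigenvector of \<open>weight Y\<close> for the largest eigenvalue
  \<open>j\<close> on the kernel. Raising it would produce weight \<open>j + 1\<close>, so the
  raised vector is zero.\<close>

lemma exists_highest:
  fixes Y :: "3 \<Rightarrow> complex^'n^'n" and K :: "complex^'n^'m"
  assumes Y: "so3_triple Y"
    and inv: "\<And>i v. K *v v = 0 \<Longrightarrow> K *v (Y i *v v) = 0"
    and ne: "\<exists>v. v \<noteq> 0 \<and> K *v v = 0"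
  shows "\<exists>(W :: complex^1^'n) j. W \<noteq> 0 \<and> highest Y j W \<and> K ** W = 0"
proof -
  have Kw: "K *v (weight Y *v v) = 0" if "K *v v = 0" for v
    using inv[OF that, of 3] by (simp add: weight_def cscale_vector matrix_vector_smult)
  have Kr: "K *v (raise Y *v v) = 0" if "K *v v = 0" for v
    using inv[OF that, of 1] inv[OF that, of 2]
    by (simp add: raise_def cscale_vector matrix_vector_smult matrix_vector_mult_diff_rdistrib
        matrix_vector_mult_diff_distrib)
  obtain v j where v: "v \<noteq> 0" "K *v v = 0" "weight Y *v v = of_real j *s v"
    and max: "\<And>u. K *v u = 0 \<Longrightarrow> inner u (weight Y *v u) \<le> j * inner u u"
    using hermitian_kernel_eigenvector[OF cadjoint_weight[OF Y] Kw ne] by blast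
  let ?u = "raise Y *v v"
  have "weight Y *v ?u = raise Y *v (weight Y *v v) + ?u"
    by (simp add: matrix_vector_mul_assoc weight_raise[OF Y] matrix_vector_mult_add_rdistrib)
  also have "\<dots> = (j + 1) *\<^sub>R ?u"
    by (simp add: v(3) matrix_vector_smult vec_eq_iff scaleR_conv_of_real[where 'a=complex] algebra_simps)
  finally have "inner ?u ((j + 1) *\<^sub>R ?u) \<le> j * inner ?u ?u"
    using max[OF Kr[OF v(2)]] by simp
  then have "inner ?u ?u \<le> 0" by (simp add: algebra_simps)
  then have u0: "?u = 0" using inner_ge_zero[of ?u] by (metis inner_eq_zero_iff order_antisym)
  define W :: "complex^1^'n" where "W = (\<chi> i k. v $ i)"
  have col: "(A ** W) $ i $ k = (A *v v) $ i" for A :: "complex^'n^'z" and i k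
    by (simp add: matrix_mult_nth matrix_vector_mult_def W_def)
  have "W \<noteq> 0" using v(1) by (auto simp: W_def vec_eq_iff)
  moreover have "highest Y j W"
    unfolding highest_def vec_eq_iff col u0 v(3) by (simp add: W_def)
  moreover have "K ** W = 0"
    unfolding vec_eq_iff col v(2) by simp
  ultimately show ?thesis by blast
qed

section \<open>Intertwiners\<close>

definition hw_coeff :: "real \<Rightarrow> nat \<Rightarrow> real" where
  "hw_coeff j l = (\<Prod>i<l. (real i + 1) * (2 * j - real i))"

text \<open>
  If \<open>X\<close> maps a highest weight vector of \<open>Z\<close> to one of \<open>Y\<close> with the same weight, this is
  the intertwiner extending it: since \<open>raise Z\<close> is the adjoint of \<open>lower Z\<close>, the \<open>l\<close>-th term
  sends the \<open>l\<close>-th lowered vector of \<open>Z\<close> to that of \<open>Y\<close> and kills the others, up to the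
  squared norm, which is \<open>hw_coeff j l\<close>.
\<close>

definition hw_map ::
  "(3 \<Rightarrow> complex^'n^'n) \<Rightarrow> (3 \<Rightarrow> complex^'m^'m) \<Rightarrow> nat \<Rightarrow> complex^'m^'n \<Rightarrow> complex^'m^'n" where
  "hw_map Y Z d X = (\<Sum>l<d. of_real (1 / hw_coeff ((real d - 1) / 2) l) *\<^sub>C
     (mpow (lower Y) l ** X ** mpow (raise Z) l))"

lemma cadjoint_hw_map:
  assumes "so3_triple Y" "so3_triple Z"
  shows "cadjoint (hw_map Y Z d X) = hw_map Z Y d (cadjoint X)"
  by (simp add: hw_map_def cadjoint_sum cadjoint_mpow cadjoint_raise[OF assms(1)]
      cadjoint_raise[OF assms(2)] cadjoint_lower[OF assms(1)] cadjoint_lower[OF assms(2)]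
      matrix_mul_assoc)

text \<open>Multiplying by \<open>lower Z\<close> on the right or by \<open>lower Y\<close> on the
  left gives the same sum with the index shifted by one. The boundary terms vanish: at
  \<open>l = 0\<close> because \<open>X ** lower Z = 0\<close>, at \<open>l = d - 1\<close> because
  the ladder of \<open>Y\<close> ends after \<open>d\<close> steps.\<close>

lemma lower_hw_map:
  assumes Y: "so3_triple Y" and Z: "so3_triple Z"
    and hY: "highest Y j X" and hZ: "highest Z j (cadjoint X)"
    and d: "2 * j + 1 = real d" "d > 0"
  shows "lower Y ** hw_map Y Z d X = hw_map Y Z d X ** lower Z"
proof -
  obtain m where m: "d = Suc m" using d(2) gr0_implies_Suc by blast
  have j: "j = real m / 2" "(real d - 1) / 2 = real m / 2" using d(1) m by simp_all
  define c where "c l = complex_of_real (1 / hw_coeff j l)" for l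
  define t where "t l = mpow (lower Y) l ** X ** mpow (raise Z) l" for l
  have map: "hw_map Y Z d X = (\<Sum>l<Suc m. c l *\<^sub>C t l)"
    unfolding hw_map_def m[symmetric] c_def t_def j(2) by (simp add: j(1))
  have X0: "X ** lower Z = 0"
  proof -
    have "cadjoint (raise Z ** cadjoint X) = 0" using hZ by (simp add: highest_def)
    then show ?thesis by (simp add: cadjoint_raise[OF Z])
  qed
  have XS: "X ** mpow (raise Z) (Suc l) ** lower Z
      = of_real ((real l + 1) * (2 * j - real l)) *\<^sub>C (X ** mpow (raise Z) l)" for l
  proof -
    have "cadjoint (raise Z ** (mpow (lower Z) (Suc l) ** cadjoint X))
        = of_real ((real l + 1) * (2 * j - real l)) *\<^sub>C (X ** mpow (raise Z) l)"
      unfolding raise_mpow_lower[OF Z hZ]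
      by (simp only: cadjoint_cscale cadjoint_mult cadjoint_cadjoint cadjoint_mpow cadjoint_lower[OF Z]
          complex_cnj_complex_of_real)
    moreover have "cadjoint (raise Z ** (mpow (lower Z) (Suc l) ** cadjoint X))
        = X ** mpow (raise Z) (Suc l) ** lower Z"
      by (simp only: cadjoint_mult cadjoint_cadjoint cadjoint_mpow cadjoint_lower[OF Z] cadjoint_raise[OF Z])
    ultimately show ?thesis by simp
  qed
  have top: "lower Y ** t m = 0"
  proof -
    have "lower Y ** t m = (mpow (lower Y) d ** X) ** mpow (raise Z) m"
      by (simp add: t_def m matrix_mul_assoc)
    then show ?thesis by (simp add: mpow_lower_vanish[OF Y hY d])
  qed
  have step: "c (Suc l) *\<^sub>C (t (Suc l) ** lower Z) = c l *\<^sub>C (lower Y ** t l)" if "l < m" for l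
  proof -
    have "t (Suc l) ** lower Z = mpow (lower Y) (Suc l) ** (X ** mpow (raise Z) (Suc l) ** lower Z)"
      by (simp only: t_def matrix_mul_assoc)
    also have "\<dots> = of_real ((real l + 1) * (2 * j - real l)) *\<^sub>C (lower Y ** t l)"
      unfolding XS by (simp add: t_def matrix_mul_assoc)
    finally have e: "t (Suc l) ** lower Z = of_real ((real l + 1) * (2 * j - real l)) *\<^sub>C (lower Y ** t l)" .
    have "(real l + 1) * (2 * j - real l) \<noteq> 0" using that by (simp add: j)
    then have "1 / hw_coeff j (Suc l) * ((real l + 1) * (2 * j - real l)) = 1 / hw_coeff j l"
      by (simp add: hw_coeff_def)
    then have "c (Suc l) * of_real ((real l + 1) * (2 * j - real l)) = c l"
      unfolding c_def by (metis of_real_mult)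
    then show ?thesis unfolding e cscale_cscale by simp
  qed
  have "hw_map Y Z d X ** lower Z = (\<Sum>l<Suc m. c l *\<^sub>C (t l ** lower Z))"
    by (simp only: map matrix_sum_left cscale_mult_left)
  also have "\<dots> = c 0 *\<^sub>C (t 0 ** lower Z) + (\<Sum>l<m. c (Suc l) *\<^sub>C (t (Suc l) ** lower Z))"
    by (rule sum.lessThan_Suc_shift)
  also have "\<dots> = (\<Sum>l<m. c l *\<^sub>C (lower Y ** t l))"
    using step by (simp add: t_def X0)
  also have "\<dots> = (\<Sum>l<Suc m. c l *\<^sub>C (lower Y ** t l))"
    by (simp add: top)
  also have "\<dots> = lower Y ** hw_map Y Z d X"
    by (simp only: map matrix_sum_right cscale_mult_right)
  finally show ?thesis by simp
qed

text \<open>Adjoints exchange \<open>Y\<close> with \<open>Z\<close> and turn lowering into raising;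
  the weight is half the commutator of the two, and the three generators are combinations of these
  operators.\<close>

lemma hw_map_intertwines:
  assumes Y: "so3_triple Y" and Z: "so3_triple Z"
    and hY: "highest Y j X" and hZ: "highest Z j (cadjoint X)"
    and d: "2 * j + 1 = real d" "d > 0"
  shows "Y i ** hw_map Y Z d X = hw_map Y Z d X ** Z i"
proof -
  let ?P = "hw_map Y Z d X"
  have l: "lower Y ** ?P = ?P ** lower Z" by (rule lower_hw_map[OF assms])
  have "lower Z ** hw_map Z Y d (cadjoint X) = hw_map Z Y d (cadjoint X) ** lower Y"
    by (rule lower_hw_map[OF Z Y hZ _ d]) (use hY in simp)
  from arg_cong[where f = cadjoint, OF this]
  have r: "raise Y ** ?P = ?P ** raise Z"
    by (simp add: cadjoint_hw_map[OF Z Y] cadjoint_lower[OF Y] cadjoint_lower[OF Z])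
  have "2 *\<^sub>C (weight Y ** ?P) = (raise Y ** lower Y - lower Y ** raise Y) ** ?P"
    by (simp add: raise_lower[OF Y])
  also have "\<dots> = raise Y ** (lower Y ** ?P) - lower Y ** (raise Y ** ?P)"
    by (simp add: matrix_diff_rdistrib matrix_mul_assoc)
  also have "\<dots> = (?P ** raise Z) ** lower Z - (?P ** lower Z) ** raise Z"
    by (simp only: l r matrix_mul_assoc[symmetric]) (simp only: l r matrix_mul_assoc)
  also have "\<dots> = ?P ** (raise Z ** lower Z - lower Z ** raise Z)"
    by (simp add: matrix_diff_ldistrib matrix_mul_assoc)
  also have "\<dots> = 2 *\<^sub>C (?P ** weight Z)"
    by (simp add: raise_lower[OF Z])
  finally have w: "weight Y ** ?P = ?P ** weight Z"
    by (rule cscale_cancel) simp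
  have e: "T 1 = (-(\<i> / 2)) *\<^sub>C (raise T + lower T)" "T 2 = (1 / 2) *\<^sub>C (lower T - raise T)"
    "T 3 = (- \<i>) *\<^sub>C weight T" for T :: "3 \<Rightarrow> complex^'z^'z"
    by (simp_all add: vec_eq_iff raise_def lower_def weight_def field_simps)
  have "Y 1 ** ?P = ?P ** Z 1"
    unfolding e(1)[of Y] e(1)[of Z] by (simp only: mat_distribs cscale_mult_left cscale_mult_right l r)
  moreover have "Y 2 ** ?P = ?P ** Z 2"
    unfolding e(2)[of Y] e(2)[of Z] by (simp only: mat_distribs cscale_mult_left cscale_mult_right l r)
  moreover have "Y 3 ** ?P = ?P ** Z 3"
    unfolding e(3)[of Y] e(3)[of Z] by (simp only: cscale_mult_left cscale_mult_right w)
  ultimately show ?thesis using exhaust_3[of i] by auto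
qed

text \<open>Only the term \<open>l = 0\<close> survives, since \<open>raise Z\<close> kills
  \<open>cadjoint X\<close>. This shows that the intertwiner is nonzero when \<open>X\<close>
  is.\<close>

lemma hw_map_mult_adjoint:
  assumes "highest Z j (cadjoint X)" "d > 0"
  shows "hw_map Y Z d X ** cadjoint X = X ** cadjoint X"
proof -
  have z: "raise Z ** cadjoint X = 0" using assms(1) by (simp add: highest_def)
  have "mpow (raise Z) l ** cadjoint X = (if l = 0 then cadjoint X else 0)" for l
  proof (cases l)
    case (Suc k)
    have "mpow (raise Z) l ** cadjoint X = mpow (raise Z) k ** (raise Z ** cadjoint X)"
      by (simp only: Suc mpow.simps mpow_commute[symmetric] matrix_mul_assoc)
    then show ?thesis by (simp add: z Suc)
  qed simp
  then have "hw_map Y Z d X ** cadjoint X = (\<Sum>l<d. if l = 0 then X ** cadjoint X else 0)"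
    unfolding hw_map_def matrix_sum_left cscale_mult_left
    by (intro sum.cong) (auto simp: matrix_mul_assoc[symmetric] hw_coeff_def)
  then show ?thesis using assms(2) by simp
qed

text \<open>The intertwiner seeded by \<open>W ** cadjoint W\<close> is a scalar by Schur, and its
  action on the seed shows that the scalar is the squared norm \<open>q\<close> of \<open>W\<close>.
  Each of its \<open>d\<close> terms has trace \<open>q\<close>, so comparing traces gives the
  dimension without showing that the ladder is a basis.\<close>

lemma irreducible_dim:
  fixes Y :: "3 \<Rightarrow> complex^'m^'m" and W :: "complex^1^'m"
  assumes Y: "so3_triple Y" and irr: "irreducible_triple Y"
    and W: "W \<noteq> 0" "highest Y j W"
  shows "2 * j + 1 = real CARD('m)"
proof -
  obtain d where d: "2 * j + 1 = real d" "d > 0"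
    using highest_weight_dim[OF Y W(2,1)] by blast
  define X where "X = W ** cadjoint W"
  have hX: "highest Y j X" using W(2) by (simp add: highest_def X_def matrix_mul_assoc)
  have X': "cadjoint X = X" by (simp add: X_def)
  define q where "q = (cadjoint W ** W) $ 1 $ 1"
  have q: "cadjoint W ** W = q *\<^sub>C mat 1" by (simp add: q_def vec_eq_iff mat_def)
  have q0: "q \<noteq> 0" using W(1) adjoint_mult_eq_0[of W] q by auto
  have trq: "trace (cadjoint W ** W) = q" by (simp add: trace_def q_def)
  let ?P = "hw_map Y Y d X"
  have "?P ** Y i = Y i ** ?P" for i
    using hw_map_intertwines[OF Y Y hX _ d] hX X' by simp
  then obtain c where c: "?P = c *\<^sub>C mat 1"
    using schur[OF irr _ so3_tripleD(1)[OF Y]] by blast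
  have "?P ** X = X ** X" using hw_map_mult_adjoint[of Y j X d Y] hX X' d(2) by simp
  moreover have "X ** X = q *\<^sub>C X"
  proof -
    have "X ** X = W ** (cadjoint W ** W) ** cadjoint W" by (simp add: X_def matrix_mul_assoc)
    then show ?thesis unfolding q by (simp add: X_def)
  qed
  ultimately have "(c - q) *\<^sub>C X = 0" by (simp add: c cscale_diff_left)
  moreover have "X \<noteq> 0"
    unfolding X_def using adjoint_mult_eq_0[of "cadjoint W"] W(1) by auto
  ultimately have cq: "c = q" by simp
  have "trace (mpow (lower Y) l ** X ** mpow (raise Y) l) = of_real (hw_coeff j l) * q" for l
  proof -
    have "trace (mpow (lower Y) l ** X ** mpow (raise Y) l)
        = trace ((mpow (lower Y) l ** W) ** (cadjoint W ** mpow (raise Y) l))"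
      by (simp add: X_def matrix_mul_assoc)
    also have "\<dots> = trace ((cadjoint W ** mpow (raise Y) l) ** (mpow (lower Y) l ** W))"
      by (rule trace_mul_sym)
    also have "cadjoint W ** mpow (raise Y) l = cadjoint (mpow (lower Y) l ** W)"
      by (simp add: cadjoint_mpow cadjoint_lower[OF Y])
    finally show ?thesis
      unfolding adjoint_mult_mpow_lower[OF Y W(2)] by (simp add: trq hw_coeff_def)
  qed
  moreover have "hw_coeff j l \<noteq> 0" if "l < d" for l
    using that d(1) by (auto simp: hw_coeff_def)
  moreover have "(real d - 1) / 2 = j" using d(1) by simp
  ultimately have "trace ?P = (\<Sum>l<d. q)"
    unfolding hw_map_def trace_sum trace_cscale by (intro sum.cong) auto
  moreover have "trace ?P = q * of_nat CARD('m)"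
    by (simp add: c cq trace_I)
  ultimately have "of_nat d = (of_nat CARD('m) :: complex)" using q0 by simp
  then show ?thesis using d(1) of_nat_eq_iff by metis
qed

lemma irreducible_highest:
  fixes Y :: "3 \<Rightarrow> complex^'m^'m"
  assumes "so3_triple Y" "irreducible_triple Y"
  obtains W :: "complex^1^'m" where "W \<noteq> 0" "highest Y ((real CARD('m) - 1) / 2) W"
proof -
  have "\<exists>v. v \<noteq> 0 \<and> (0 :: complex^'m^'m) *v v = 0"
    by (intro exI[of _ "1"]) simp
  then obtain W :: "complex^1^'m" and j where W: "W \<noteq> 0" "highest Y j W"
    using exists_highest[OF assms(1), of "0 :: complex^'m^'m"] by auto
  have "j = (real CARD('m) - 1) / 2" using irreducible_dim[OF assms W] by simp
  then show thesis using W that by blast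
qed

lemma casimir_commute:
  assumes "so3_triple Y"
  shows "casimir Y ** Y i = Y i ** casimir Y"
proof -
  obtain j k where c: "cyc i j k" using cyc_ex by blast
  have r: "Y i ** (Y j ** V) = Y j ** (Y i ** V) + Y k ** V"
    "Y i ** (Y k ** V) = Y k ** (Y i ** V) - Y j ** V" for V
    using so3_tripleD(2)[OF assms c] so3_tripleD(2)[OF assms cyc_rotate2[OF c]]
    by (simp_all add: matrix_mul_assoc mat_distribs)
  have r': "Y i ** Y j = Y j ** Y i + Y k" "Y i ** Y k = Y k ** Y i - Y j"
    using so3_tripleD(2)[OF assms c] so3_tripleD(2)[OF assms cyc_rotate2[OF c]] by simp_all
  show ?thesis
    by (simp add: casimir_def sum_cyc[OF c] mat_distribs matrix_mul_assoc[symmetric] r r')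
qed

lemma casimir_irreducible:
  fixes Y :: "3 \<Rightarrow> complex^'m^'m"
  assumes "so3_triple Y" "irreducible_triple Y"
  shows "casimir Y = of_real (- (((real CARD('m))\<^sup>2 - 1) / 4)) *\<^sub>C mat 1"
proof -
  obtain c where c: "casimir Y = c *\<^sub>C mat 1"
    using schur[OF assms(2) casimir_commute[OF assms(1)] so3_tripleD(1)[OF assms(1)]] by blast
  obtain W :: "complex^1^'m" where W: "W \<noteq> 0" "highest Y ((real CARD('m) - 1) / 2) W"
    using irreducible_highest[OF assms] by blast
  have "c *\<^sub>C W = of_real (- (((real CARD('m))\<^sup>2 - 1) / 4)) *\<^sub>C W"
    using casimir_highest[OF assms(1) W(2)] by (simp add: c power2_eq_square field_simps)
  then have "(c - of_real (- (((real CARD('m))\<^sup>2 - 1) / 4))) *\<^sub>C W = 0"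
    by (simp only: cscale_diff_left) simp
  then have "c - of_real (- (((real CARD('m))\<^sup>2 - 1) / 4)) = 0"
    using W(1) unfolding cscale_eq_0_iff by blast
  then have "c = of_real (- (((real CARD('m))\<^sup>2 - 1) / 4))"
    by (rule eq_iff_diff_eq_0[THEN iffD2])
  then show ?thesis by (simp only: c)
qed

text \<open>The scalar Casimir forces a highest weight found in the kernel of \<open>K\<close> to be
  that of \<open>Y\<close>, which makes \<open>hw_map\<close> available. By Schur
  \<open>cadjoint P ** P\<close> is a positive scalar, so rescaling gives an isometry; its range
  stays in the kernel because the whole ladder does.\<close>

lemma isometric_intertwiner:
  fixes Z :: "3 \<Rightarrow> complex^'n^'n" and Y :: "3 \<Rightarrow> complex^'m^'m" and K :: "complex^'n^'k"
  assumes Z: "so3_triple Z" and cas: "casimir Z = of_real (- (((real CARD('m))\<^sup>2 - 1) / 4)) *\<^sub>C mat 1"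
    and Y: "so3_triple Y" "irreducible_triple Y"
    and inv: "\<And>i v. K *v v = 0 \<Longrightarrow> K *v (Z i *v v) = 0"
    and ne: "\<exists>v. v \<noteq> 0 \<and> K *v v = 0"
  obtains P where "\<And>i. Z i ** P = P ** Y i" "cadjoint P ** P = mat 1" "K ** P = 0"
proof -
  let ?m = "real CARD('m)"
  obtain W :: "complex^1^'n" and j where W: "W \<noteq> 0" "highest Z j W" "K ** W = 0"
    using exists_highest[OF Z inv ne] by blast
  obtain d where d: "2 * j + 1 = real d" "d > 0"
    using highest_weight_dim[OF Z W(2,1)] by blast
  have "of_real (- ((?m\<^sup>2 - 1) / 4)) *\<^sub>C W = of_real (- (j * (j + 1))) *\<^sub>C W"
    using casimir_highest[OF Z W(2)] by (simp add: cas)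
  then have "(of_real (- ((?m\<^sup>2 - 1) / 4)) - of_real (- (j * (j + 1)))) *\<^sub>C W = 0"
    by (simp only: cscale_diff_left) simp
  then have "complex_of_real (- ((?m\<^sup>2 - 1) / 4)) = of_real (- (j * (j + 1)))"
    using W(1) by simp
  then have "- ((?m\<^sup>2 - 1) / 4) = - (j * (j + 1))" using of_real_eq_iff by blast
  then have "?m\<^sup>2 = (2 * j + 1)\<^sup>2" by (simp add: power2_eq_square field_simps)
  then have "?m = real d" using d by simp
  then have dm: "d = CARD('m)" and j: "j = (?m - 1) / 2" using d(1) by simp_all
  obtain V :: "complex^1^'m" where V: "V \<noteq> 0" "highest Y ((?m - 1) / 2) V"
    using irreducible_highest[OF Y] by blast
  define X where "X = W ** cadjoint V"
  have hX: "highest Z j X" using W(2) by (simp add: highest_def X_def matrix_mul_assoc)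
  have "highest Y j V" using V(2) unfolding j .
  then have hX': "highest Y j (cadjoint X)" by (simp add: highest_def X_def matrix_mul_assoc)
  have X0: "X \<noteq> 0"
  proof
    assume "X = 0"
    then have "W ** (cadjoint V ** V) = 0" by (simp add: X_def matrix_mul_assoc)
    moreover have "cadjoint V ** V = ((cadjoint V ** V) $ 1 $ 1) *\<^sub>C mat 1"
      by (simp add: vec_eq_iff mat_def)
    ultimately have "((cadjoint V ** V) $ 1 $ 1) *\<^sub>C W = 0"
      by (metis cscale_mult_right matrix_mul_rid)
    then show False
      using W(1) V(1) adjoint_mult_eq_0[of V] \<open>cadjoint V ** V = _\<close> by auto
  qed
  let ?P = "hw_map Z Y d X"
  have int: "Z i ** ?P = ?P ** Y i" for i
    by (rule hw_map_intertwines[OF Z Y(1) hX hX' d])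
  have P0: "?P \<noteq> 0"
    using hw_map_mult_adjoint[OF hX' d(2), of Z] adjoint_mult_eq_0[of "cadjoint X"] X0 by auto
  have int': "cadjoint ?P ** Z i = Y i ** cadjoint ?P" for i
    using arg_cong[where f = cadjoint, OF int[of i]]
    by (simp add: so3_tripleD(1)[OF Z] so3_tripleD(1)[OF Y(1)])
  have "(cadjoint ?P ** ?P) ** Y i = Y i ** (cadjoint ?P ** ?P)" for i
    by (simp only: matrix_mul_assoc[symmetric] int[symmetric]) (simp only: matrix_mul_assoc int')
  then obtain r where r: "cadjoint ?P ** ?P = of_real r *\<^sub>C mat 1"
    using schur_hermitian[OF Y(2), of "cadjoint ?P ** ?P"] by auto
  have "r > 0"
  proof -
    have "of_real (r * ?m) = trace (cadjoint ?P ** ?P)" by (simp add: r trace_I)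
    then have "r * ?m = frobenius_sq ?P" unfolding trace_adjoint_mult using of_real_eq_iff by blast
    also have "\<dots> \<ge> 0" by (rule frobenius_sq_nonneg)
    finally have "r \<ge> 0" by (simp add: zero_le_mult_iff)
    moreover have "r \<noteq> 0" using P0 adjoint_mult_eq_0[of ?P] r by auto
    ultimately show ?thesis by simp
  qed
  define Q where "Q = of_real (1 / sqrt r) *\<^sub>C ?P"
  have e: "1 / sqrt r * (1 / sqrt r * r) = 1" using \<open>r > 0\<close> by (simp add: field_simps)
  have "cadjoint Q ** Q = of_real (1 / sqrt r * (1 / sqrt r * r)) *\<^sub>C mat 1"
    unfolding Q_def by (simp only: cadjoint_cscale complex_cnj_complex_of_real cscale_mult_left
        cscale_mult_right r cscale_cscale of_real_mult)
  then have "cadjoint Q ** Q = mat 1" unfolding e by simp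
  moreover have "Z i ** Q = Q ** Y i" for i by (simp add: Q_def int)
  moreover have "K ** Q = 0"
  proof -
    have comm: "K ** (Z i ** U) = 0" if "K ** U = 0" for U :: "complex^'b^'n" and i
    proof -
      have col: "(A ** B) $ a $ b = (A *v (\<chi> c. B $ c $ b)) $ a" for A :: "complex^'x^'y" and B :: "complex^'w^'x" and a b
        by (simp add: matrix_mult_nth matrix_vector_mult_def)
      have "K *v (\<chi> c. U $ c $ b) = 0" for b
        using that by (simp add: vec_eq_iff[of "K *v _"] col[symmetric])
      then have "K *v (Z i *v (\<chi> c. U $ c $ b)) = 0" for b using inv by blast
      moreover have "(\<chi> c. (Z i ** U) $ c $ b) = Z i *v (\<chi> c. U $ c $ b)" for b
        by (simp add: vec_eq_iff col)
      ultimately show ?thesis by (simp add: vec_eq_iff[of "K ** _"] vec_eq_iff[of "(K ** _) $ _"] col)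
    qed
    have "K ** (lower Z ** U) = 0" if "K ** U = 0" for U :: "complex^1^'n"
      using comm[OF that, of 1] comm[OF that, of 2] by (simp add: lower_def mat_distribs)
    then have "K ** (mpow (lower Z) l ** W) = 0" for l
      by (induction l) (simp_all add: W(3) matrix_mul_assoc[symmetric])
    then have "K ** (mpow (lower Z) l ** X ** mpow (raise Y) l) = 0" for l
      by (simp add: X_def matrix_mul_assoc)
    then show ?thesis by (simp add: Q_def hw_map_def matrix_sum_right)
  qed
  ultimately show thesis using that by blast
qed

definition triple_copies :: "(3 \<Rightarrow> complex^'m^'m) \<Rightarrow> 3 \<Rightarrow> complex^('k::finite \<times> 'm)^('k \<times> 'm)" where
  "triple_copies Y i = (\<chi> a b. if fst a = fst b then Y i $ snd a $ snd b else 0)"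

text \<open>Take a largest family of isometric copies of \<open>Y\<close> with pairwise orthogonal
  ranges. If the sum \<open>pr\<close> of the range projections were not the identity, its invariant
  kernel would contain a further copy. The trace then counts the copies.\<close>

lemma isotypic:
  fixes Z :: "3 \<Rightarrow> complex^'n^'n" and Y :: "3 \<Rightarrow> complex^'m^'m"
  assumes Z: "so3_triple Z" and cas: "casimir Z = of_real (- (((real CARD('m))\<^sup>2 - 1) / 4)) *\<^sub>C mat 1"
    and Y: "so3_triple Y" "irreducible_triple Y"
    and card: "CARD('n) = CARD('k::finite) * CARD('m)"
  obtains P :: "complex^'n^('k::finite \<times> 'm)"
  where "invertible P" "\<And>i. P ** Z i = triple_copies Y i ** P"
proof -
  define fam :: "nat \<Rightarrow> (nat \<Rightarrow> complex^'m^'n) \<Rightarrow> bool" where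
    "fam r F \<longleftrightarrow> (\<forall>a<r. \<forall>i. Z i ** F a = F a ** Y i) \<and>
       (\<forall>a<r. \<forall>b<r. cadjoint (F a) ** F b = (if a = b then mat 1 else 0))" for r F
  define pr where "pr r F = (\<Sum>a<r. F a ** cadjoint (F a))" for r and F :: "nat \<Rightarrow> complex^'m^'n"
  have pr_adj: "cadjoint (pr r F) = pr r F" for r F by (simp add: pr_def cadjoint_sum)
  have F_pr: "cadjoint (F a) ** pr r F = cadjoint (F a)" if "fam r F" "a < r" for r F a
  proof -
    have "cadjoint (F a) ** pr r F = (\<Sum>b<r. (cadjoint (F a) ** F b) ** cadjoint (F b))"
      by (simp add: pr_def matrix_sum_right matrix_mul_assoc)
    also have "\<dots> = (\<Sum>b<r. if b = a then cadjoint (F b) else 0)"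
      using that by (intro sum.cong) (auto simp: fam_def)
    finally show ?thesis using that(2) by simp
  qed
  have pr_idem: "pr r F ** pr r F = pr r F" if "fam r F" for r F
  proof -
    have "pr r F ** pr r F = (\<Sum>a<r. F a ** (cadjoint (F a) ** pr r F))"
      by (subst (1) pr_def) (simp add: matrix_sum_left matrix_mul_assoc)
    also have "\<dots> = pr r F"
      unfolding pr_def[of r F] using F_pr[OF that] by (intro sum.cong) (auto simp: pr_def)
    finally show ?thesis .
  qed
  have pr_tr: "trace (pr r F) = of_nat (r * CARD('m))" if "fam r F" for r F
  proof -
    have "trace (pr r F) = (\<Sum>a<r. trace (cadjoint (F a) ** F a))"
      unfolding pr_def trace_sum by (intro sum.cong refl trace_mul_sym)
    also have "\<dots> = (\<Sum>a<r. of_nat CARD('m))"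
      using that by (intro sum.cong) (auto simp: fam_def trace_I)
    finally show ?thesis by simp
  qed
  \<comment> \<open>The projection \<open>mat 1 - pr r F\<close> has nonnegative trace; this bounds
    the size of families, so a largest one exists.\<close>
  have bound: "r \<le> CARD('n)" if "fam r F" for r F
  proof -
    let ?Q = "mat 1 - pr r F"
    have "cadjoint ?Q ** ?Q = ?Q"
      by (simp add: mat_distribs pr_adj pr_idem[OF that])
    then have "complex_of_real (frobenius_sq ?Q) = of_nat CARD('n) - of_nat (r * CARD('m))"
      using trace_adjoint_mult[of ?Q] by (simp add: trace_sub trace_I pr_tr[OF that])
    also have "\<dots> = complex_of_real (real CARD('n) - real (r * CARD('m)))" by simp
    finally have "frobenius_sq ?Q = real CARD('n) - real (r * CARD('m))"
      using of_real_eq_iff by blast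
    moreover have "frobenius_sq ?Q \<ge> 0" by (rule frobenius_sq_nonneg)
    ultimately have "r * CARD('m) \<le> CARD('n)" by linarith
    moreover have "r \<le> r * CARD('m)" using mult_le_mono2[of 1 "CARD('m)" r] by (simp add: Suc_leI)
    ultimately show ?thesis by linarith
  qed
  have "\<exists>F. fam 0 F" by (simp add: fam_def)
  then obtain r where r: "\<exists>F. fam r F" and max: "\<And>s. \<exists>F. fam s F \<Longrightarrow> s \<le> r"
    using bound Nat.ex_has_greatest_nat[of "\<lambda>r. \<exists>F. fam r F" 0 "CARD('n)"] by blast
  obtain F where F: "fam r F" using r by blast
  have Fint: "Z i ** F a = F a ** Y i" if "a < r" for a i using F that by (simp add: fam_def)
  have Fint': "cadjoint (F a) ** Z i = Y i ** cadjoint (F a)" if "a < r" for a i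
    using arg_cong[where f = cadjoint, OF Fint[OF that, of i]]
    by (simp add: so3_tripleD(1)[OF Z] so3_tripleD(1)[OF Y(1)])
  have pr_comm: "pr r F ** Z i = Z i ** pr r F" for i
  proof -
    have "F a ** cadjoint (F a) ** Z i = Z i ** (F a ** cadjoint (F a))" if "a < r" for a
      by (simp only: matrix_mul_assoc[symmetric] Fint'[OF that])
        (simp only: matrix_mul_assoc Fint[OF that])
    then show ?thesis
      unfolding pr_def matrix_sum_left matrix_sum_right by (intro sum.cong) auto
  qed
  have pr1: "pr r F = mat 1"
  proof (rule ccontr)
    assume "pr r F \<noteq> mat 1"
    then obtain v where v: "pr r F *v v \<noteq> v"
      using matrix_eq[of "pr r F" "mat 1"] by auto
    have "pr r F *v (v - pr r F *v v) = 0"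
      by (simp add: matrix_vector_mult_diff_distrib matrix_vector_mul_assoc pr_idem[OF F])
    then have "\<exists>v. v \<noteq> 0 \<and> pr r F *v v = 0" using v by (intro exI[of _ "v - pr r F *v v"]) auto
    moreover have "pr r F *v (Z i *v v) = 0" if "pr r F *v v = 0" for i v
    proof -
      have "pr r F *v (Z i *v v) = Z i *v (pr r F *v v)"
        by (simp only: matrix_vector_mul_assoc pr_comm)
      then show ?thesis by (simp add: that)
    qed
    ultimately obtain P where P: "\<And>i. Z i ** P = P ** Y i" "cadjoint P ** P = mat 1" "pr r F ** P = 0"
      using isometric_intertwiner[OF Z cas Y, of "pr r F"] by blast
    have z1: "cadjoint (F a) ** P = 0" if "a < r" for a
    proof -
      have "cadjoint (F a) ** P = cadjoint (F a) ** (pr r F ** P)"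
        using F_pr[OF F that] by (simp add: matrix_mul_assoc)
      then show ?thesis by (simp add: P(3))
    qed
    have z2: "cadjoint P ** F a = 0" if "a < r" for a
      using arg_cong[where f = cadjoint, OF z1[OF that]] by simp
    have "fam (Suc r) (F(r := P))"
      using F P z1 z2 unfolding fam_def by (auto simp: less_Suc_eq)
    then show False using max[of "Suc r"] by auto
  qed
  have "complex_of_nat CARD('n) = of_nat (r * CARD('m))"
    using pr_tr[OF F] by (simp add: pr1 trace_I)
  then have "CARD('n) = r * CARD('m)" using of_nat_eq_iff by blast
  then have rk: "r = CARD('k)" using card by simp
  obtain h :: "'k \<Rightarrow> nat" where h: "bij_betw h UNIV {..<r}"
    using ex_bij_betw_finite_nat[of "UNIV :: 'k set"] rk by (auto simp: atLeast0LessThan)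
  have hr: "h a < r" for a using h by (auto simp: bij_betw_def)
  have hinj: "h a = h b \<longleftrightarrow> a = b" for a b using h by (auto simp: bij_betw_def inj_on_def)
  \<comment> \<open>The adjoints of the embeddings, stacked as block rows.\<close>
  define P :: "complex^'n^('k \<times> 'm)" where
    "P = (\<chi> x i. cadjoint (F (h (fst x))) $ snd x $ i)"
  have "P ** cadjoint P = mat 1"
  proof -
    have "(P ** cadjoint P) $ x $ y = (cadjoint (F (h (fst x))) ** F (h (fst y))) $ snd x $ snd y" for x y
      by (simp add: P_def matrix_mult_nth)
    moreover have "cadjoint (F (h (fst x))) ** F (h (fst y)) = (if fst x = fst y then mat 1 else 0)"
      for x y :: "'k \<times> 'm"
      using F hr by (auto simp: fam_def hinj)
    ultimately show ?thesis by (simp add: vec_eq_iff mat_def prod_eq_iff)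
  qed
  moreover have "cadjoint P ** P = mat 1"
  proof -
    have "(cadjoint P ** P) $ i $ j = pr r F $ i $ j" for i j
    proof -
      have "(cadjoint P ** P) $ i $ j = (\<Sum>a\<in>UNIV. \<Sum>b\<in>UNIV. F (h a) $ i $ b * cadjoint (F (h a)) $ b $ j)"
        unfolding sum.cartesian_product by (simp add: P_def matrix_mult_nth case_prod_unfold)
      also have "\<dots> = (\<Sum>a\<in>UNIV. (F (h a) ** cadjoint (F (h a))) $ i $ j)"
        by (simp add: matrix_mult_nth)
      also have "\<dots> = (\<Sum>a<r. (F a ** cadjoint (F a)) $ i $ j)"
        by (rule sum.reindex_bij_betw[OF h])
      finally show ?thesis by (simp add: pr_def)
    qed
    then show ?thesis by (simp add: pr1[symmetric] vec_eq_iff)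
  qed
  ultimately have "invertible P" unfolding invertible_def by blast
  moreover have "P ** Z i = triple_copies Y i ** P" for i
  proof -
    have "(P ** Z i) $ x $ j = (triple_copies Y i ** P) $ x $ j" for x j
    proof -
      have "(P ** Z i) $ x $ j = (cadjoint (F (h (fst x))) ** Z i) $ snd x $ j"
        by (simp add: P_def matrix_mult_nth)
      also have "\<dots> = (Y i ** cadjoint (F (h (fst x)))) $ snd x $ j"
        by (simp only: Fint'[OF hr])
      also have "\<dots> = (\<Sum>b\<in>UNIV. Y i $ snd x $ b * P $ (fst x, b) $ j)"
        by (simp add: P_def matrix_mult_nth)
      also have "\<dots> = (\<Sum>a\<in>UNIV. if a = fst x then (\<Sum>b\<in>UNIV. Y i $ snd x $ b * P $ (a, b) $ j) else 0)"
        by simp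
      also have "\<dots> = (\<Sum>a\<in>UNIV. \<Sum>b\<in>UNIV. triple_copies Y i $ x $ (a, b) * P $ (a, b) $ j)"
        by (intro sum.cong) (auto simp: triple_copies_def)
      also have "\<dots> = (triple_copies Y i ** P) $ x $ j"
        unfolding sum.cartesian_product by (simp add: matrix_mult_nth case_prod_unfold)
      finally show ?thesis .
    qed
    then show ?thesis by (simp add: vec_eq_iff)
  qed
  ultimately show thesis using that by blast
qed

section \<open>Vector operators between two representations\<close>

lemma tensor_opD:
  assumes "tensor_op Y Z C" "cyc i j k"
  shows "Y i ** C i = C i ** Z i" "Y j ** C j = C j ** Z j" "Y k ** C k = C k ** Z k"
    and "Y i ** C j = C j ** Z i + C k" "Y j ** C k = C k ** Z j + C i" "Y k ** C i = C i ** Z k + C j"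
    and "Y j ** C i = C i ** Z j - C k" "Y k ** C j = C j ** Z k - C i" "Y i ** C k = C k ** Z i - C j"
  using assms(1) cyc_rotate[OF assms(2)] cyc_rotate2[OF assms(2)] assms(2)
  unfolding tensor_op_def by blast+

lemma tensor_opD_assoc:
  assumes "tensor_op Y Z C" "cyc i j k"
  shows "Y i ** (C i ** V) = C i ** (Z i ** V)" "Y j ** (C j ** V) = C j ** (Z j ** V)"
    "Y k ** (C k ** V) = C k ** (Z k ** V)"
    and "Y i ** (C j ** V) = C j ** (Z i ** V) + C k ** V"
    "Y j ** (C k ** V) = C k ** (Z j ** V) + C i ** V"
    "Y k ** (C i ** V) = C i ** (Z k ** V) + C j ** V"
    and "Y j ** (C i ** V) = C i ** (Z j ** V) - C k ** V"
    "Y k ** (C j ** V) = C j ** (Z k ** V) - C i ** V"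
    "Y i ** (C k ** V) = C k ** (Z i ** V) - C j ** V"
  by (simp_all only: matrix_mul_assoc tensor_opD[OF assms] matrix_add_rdistrib matrix_diff_rdistrib)

lemma tensor_op_adjoint:
  assumes "so3_triple Y" "so3_triple Z" "tensor_op Y Z C"
  shows "tensor_op Z Y (\<lambda>i. cadjoint (C i))"
proof -
  have a: "cadjoint (Y i ** C j) = - (cadjoint (C j) ** Y i)"
    "cadjoint (C j ** Z i) = - (Z i ** cadjoint (C j))" for i j
    by (simp_all add: so3_tripleD(1)[OF assms(1)] so3_tripleD(1)[OF assms(2)])
  have "Z i ** cadjoint (C i) = cadjoint (C i) ** Y i" for i
  proof -
    have "Y i ** C i = C i ** Z i" using assms(3) by (simp add: tensor_op_def)
    then show ?thesis using a[of i i] by simp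
  qed
  moreover have "Z i ** cadjoint (C j) = cadjoint (C j) ** Y i + cadjoint (C k) \<and>
      Z j ** cadjoint (C i) = cadjoint (C i) ** Y j - cadjoint (C k)" if c: "cyc i j k" for i j k
  proof -
    have g: "z = x + w" if "- x = - z + w" for x z w :: "complex^'z^'y"
    proof -
      have "x + w = x + (- z + w) + z" by simp
      also have "\<dots> = z" by (simp only: that[symmetric]) simp
      finally show ?thesis by simp
    qed
    have "- (cadjoint (C j) ** Y i) = - (Z i ** cadjoint (C j)) + cadjoint (C k)"
      using arg_cong[where f = cadjoint, OF tensor_opD(4)[OF assms(3) c]]
      by (simp only: a cadjoint_add)
    moreover have "- (cadjoint (C i) ** Y j) = - (Z j ** cadjoint (C i)) + (- cadjoint (C k))"
      using arg_cong[where f = cadjoint, OF tensor_opD(7)[OF assms(3) c]]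
      by (simp only: a cadjoint_diff) simp
    ultimately show ?thesis using g by fastforce
  qed
  ultimately show ?thesis by (simp add: tensor_op_def)
qed

lemma tensor_op_diff_cscale:
  assumes "tensor_op Y Z C" "tensor_op Y Z D"
  shows "tensor_op Y Z (\<lambda>i. C i - s *\<^sub>C D i)"
proof -
  have "Y i ** (C i - s *\<^sub>C D i) = (C i - s *\<^sub>C D i) ** Z i" for i
    using assms by (simp add: mat_distribs tensor_op_def)
  moreover have "Y i ** (C j - s *\<^sub>C D j) = (C j - s *\<^sub>C D j) ** Z i + (C k - s *\<^sub>C D k) \<and>
      Y j ** (C i - s *\<^sub>C D i) = (C i - s *\<^sub>C D i) ** Z j - (C k - s *\<^sub>C D k)" if c: "cyc i j k" for i j k
    by (simp add: mat_distribs tensor_opD[OF assms(1) c] tensor_opD[OF assms(2) c])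
  ultimately show ?thesis by (simp add: tensor_op_def)
qed

text \<open>The Levi-Civita terms cancel in pairs: a scalar product of vector operators is an
  intertwiner, to which Schur's lemma or the Casimir argument applies.\<close>

lemma tensor_op_dot:
  assumes "tensor_op Y Z C" "tensor_op Z W D"
  shows "Y i ** (\<Sum>l\<in>UNIV. C l ** D l) = (\<Sum>l\<in>UNIV. C l ** D l) ** W i"
proof -
  obtain j k where c: "cyc i j k" using cyc_ex by blast
  show ?thesis
    by (simp add: sum_cyc[OF c] mat_distribs matrix_mul_assoc[symmetric]
        tensor_opD_assoc[OF assms(1) c] tensor_opD[OF assms(2) c])
qed

definition cross_op :: "(3 \<Rightarrow> complex^'m^'p) \<Rightarrow> (3 \<Rightarrow> complex^'q^'m) \<Rightarrow> 3 \<Rightarrow> complex^'q^'p" where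
  "cross_op C D i = (\<Sum>j\<in>UNIV. \<Sum>k\<in>UNIV. levi_civita i j k *\<^sub>R (C j ** D k))"

lemma cross_op_cyc:
  assumes "cyc i j k"
  shows "cross_op C D i = C j ** D k - C k ** D j"
  by (cases rule: cyc_cases[OF assms]) (simp_all add: cross_op_def sum_3 levi_civita_def)

lemma tensor_op_cross:
  assumes "tensor_op Y Z C" "tensor_op Z W D"
  shows "tensor_op Y W (cross_op C D)"
proof -
  have "Y i ** cross_op C D i = cross_op C D i ** W i" for i
  proof -
    obtain j k where c: "cyc i j k" using cyc_ex by blast
    show ?thesis
      by (simp add: cross_op_cyc[OF c] mat_distribs matrix_mul_assoc[symmetric]
          tensor_opD_assoc[OF assms(1) c] tensor_opD[OF assms(2) c])
  qed
  moreover have "Y i ** cross_op C D j = cross_op C D j ** W i + cross_op C D k \<and>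
      Y j ** cross_op C D i = cross_op C D i ** W j - cross_op C D k" if c: "cyc i j k" for i j k
    by (simp add: cross_op_cyc[OF c] cross_op_cyc[OF cyc_rotate[OF c]] cross_op_cyc[OF cyc_rotate2[OF c]]
        mat_distribs matrix_mul_assoc[symmetric]
        tensor_opD_assoc[OF assms(1) c] tensor_opD[OF assms(2) c])
  ultimately show ?thesis by (simp add: tensor_op_def)
qed

lemma tensor_op_casimir:
  assumes "tensor_op Y Z C" "cyc i j k"
  shows "casimir Y ** C i - C i ** casimir Z = 2 *\<^sub>C (Y k ** C j - Y j ** C k) + 2 *\<^sub>C C i"
  by (simp add: casimir_def sum_cyc[OF assms(2)] mat_distribs matrix_mul_assoc[symmetric]
      tensor_opD_assoc[OF assms] tensor_opD[OF assms])
    (simp add: vec_eq_iff algebra_simps)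

text \<open>When both Casimir operators are scalars, the left side of
  \<open>tensor_op_casimir\<close> is just \<open>a - b\<close> times \<open>C i\<close>, so the
  curl of \<open>C\<close> is a multiple of \<open>C\<close>. The curl taken with \<open>Z\<close>
  on the right differs from it by \<open>2 *\<^sub>C C i\<close>.\<close>

lemma tensor_op_curl:
  assumes t: "tensor_op Y Z C" and "casimir Y = a *\<^sub>C mat 1" "casimir Z = b *\<^sub>C mat 1" and c: "cyc i j k"
  shows "Y j ** C k - Y k ** C j = (1 - (a - b) / 2) *\<^sub>C C i"
    and "C k ** Z j - C j ** Z k = (- 1 - (a - b) / 2) *\<^sub>C C i"
proof -
  have e: "a *\<^sub>C C i - b *\<^sub>C C i = 2 *\<^sub>C (Y k ** C j - Y j ** C k) + 2 *\<^sub>C C i"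
    using tensor_op_casimir[OF t c] by (simp add: assms(2,3))
  show curl: "Y j ** C k - Y k ** C j = (1 - (a - b) / 2) *\<^sub>C C i"
  proof -
    have "(a - b) * C i $ x $ y = 2 * ((Y k ** C j) $ x $ y - (Y j ** C k) $ x $ y) + 2 * C i $ x $ y" for x y
      using arg_cong[where f = "\<lambda>M. M $ x $ y", OF e] by (simp add: algebra_simps)
    then have "(Y j ** C k) $ x $ y - (Y k ** C j) $ x $ y = (1 - (a - b) / 2) * C i $ x $ y" for x y
      by (simp add: field_simps)
    then show ?thesis by (simp add: vec_eq_iff)
  qed
  have "C k ** Z j - C j ** Z k = (Y j ** C k - Y k ** C j) - 2 *\<^sub>C C i"
    unfolding tensor_opD(5,8)[OF t c] by (simp add: vec_eq_iff)
  then show "C k ** Z j - C j ** Z k = (- 1 - (a - b) / 2) *\<^sub>C C i"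
    unfolding curl by (simp add: vec_eq_iff algebra_simps)
qed

lemma casimir_irreducible_nonzero:
  fixes Y :: "3 \<Rightarrow> complex^'n^'n"
  assumes Y: "so3_triple Y" "irreducible_triple Y" and card: "CARD('n) \<ge> 2" and c: "casimir Y = c *\<^sub>C mat 1"
  shows "c \<noteq> 0"
proof -
  have "real CARD('n) * real CARD('n) \<ge> 2 * 2" using card by (intro mult_mono) auto
  then have "- (((real CARD('n))\<^sup>2 - 1) / 4) \<noteq> 0" by (simp add: power2_eq_square)
  then have "casimir Y \<noteq> 0"
    unfolding casimir_irreducible[OF Y] cscale_eq_0_iff of_real_eq_0_iff by simp
  then show ?thesis using c by auto
qed

text \<open>The projection theorem inside one irreducible representation. With equal Casimirs the
  curl factor is 1, and therefore \<open>Y_i (Y . C) = (Y . Y) C_i\<close>; here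
  \<open>Y . C\<close> is a scalar by Schur and \<open>Y . Y\<close> is a scalar that is nonzero in
  dimension at least 2.\<close>

lemma tensor_op_self:
  fixes Y :: "3 \<Rightarrow> complex^'n^'n"
  assumes Y: "so3_triple Y" "irreducible_triple Y" and t: "tensor_op Y Y C" and card: "CARD('n) \<ge> 2"
  obtains s where "\<And>i. C i = s *\<^sub>C Y i"
proof -
  obtain c where cas: "casimir Y = c *\<^sub>C mat 1" using casimir_irreducible[OF Y] by blast
  have c0: "c \<noteq> 0" by (rule casimir_irreducible_nonzero[OF Y card cas])
  let ?S = "\<Sum>l\<in>UNIV. Y l ** C l"
  obtain s where s: "?S = s *\<^sub>C mat 1"
    using schur[OF Y(2) _ so3_tripleD(1)[OF Y(1)], of ?S]
      tensor_op_dot[OF so3_triple_tensor_op[OF Y(1)] t] by metis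
  have "c *\<^sub>C C i = s *\<^sub>C Y i" for i
  proof -
    obtain j k where cy: "cyc i j k" using cyc_ex by blast
    have "Y i ** ?S = casimir Y ** C i"
    proof -
      have cj: "Y i ** C j = Y j ** C i + C k"
        using tensor_op_curl(1)[OF t cas cas cyc_rotate2[OF cy]] by (simp add: algebra_simps)
      have ck: "Y i ** C k = Y k ** C i - C j"
        using tensor_op_curl(1)[OF t cas cas cyc_rotate[OF cy]] by (simp add: algebra_simps)
      have "Y i ** (Y j ** C j) = Y j ** (Y i ** C j) + Y k ** C j"
        by (rule tensor_opD_assoc(4)[OF so3_triple_tensor_op[OF Y(1)] cy])
      also have "\<dots> = Y j ** (Y j ** C i) + Y j ** C k + Y k ** C j"
        by (simp only: cj matrix_add_ldistrib)
      finally have 1: "Y i ** (Y j ** C j) = Y j ** (Y j ** C i) + Y j ** C k + Y k ** C j" .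
      have "Y i ** (Y k ** C k) = Y k ** (Y i ** C k) - Y j ** C k"
        by (rule tensor_opD_assoc(9)[OF so3_triple_tensor_op[OF Y(1)] cy])
      also have "\<dots> = Y k ** (Y k ** C i) - Y k ** C j - Y j ** C k"
        by (simp only: ck matrix_diff_ldistrib)
      finally have 2: "Y i ** (Y k ** C k) = Y k ** (Y k ** C i) - Y k ** C j - Y j ** C k" .
      show ?thesis
        by (simp only: casimir_def sum_cyc[OF cy] matrix_add_ldistrib matrix_add_rdistrib
            matrix_mul_assoc[symmetric] 1 2) (simp add: vec_eq_iff)
    qed
    then show ?thesis by (simp only: s cas cscale_mult_left cscale_mult_right matrix_mul_lid matrix_mul_rid)
  qed
  then have "c *\<^sub>C C i = c *\<^sub>C (s / c) *\<^sub>C Y i" for i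
    by (simp add: c0)
  then have "C i = (s / c) *\<^sub>C Y i" for i
    by (rule cscale_cancel[OF _ c0])
  then show thesis using that by blast
qed

text \<open>The products \<open>C i ** D j\<close> split into trace, antisymmetric and symmetric
  traceless part. The trace vanishes by assumption. The cross product is \<open>\<mu>\<close> times
  \<open>Y\<close>, and pairing it with \<open>Y\<close> gives \<open>(Y x C) . D\<close>, a
  multiple of the trace. For the rest the curl identities yield the factor
  \<open>2 * \<kappa> - 3\<close>, which equals \<open>- 1 - (a - b)\<close>.\<close>

lemma tensor_op_unique_of_dot_zero:
  fixes Y :: "3 \<Rightarrow> complex^'p^'p" and Z :: "3 \<Rightarrow> complex^'m^'m"
  assumes Y: "so3_triple Y" "irreducible_triple Y" and card: "CARD('p) \<ge> 2"
    and C: "tensor_op Y Z C" and D: "tensor_op Z Y D"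
    and cas: "casimir Y = a *\<^sub>C mat 1" "casimir Z = b *\<^sub>C mat 1" and ab: "a - b \<noteq> - 1"
    and dot: "(\<Sum>l\<in>UNIV. C l ** D l) = 0"
  shows "C i ** D j = 0"
proof -
  define \<kappa> where "\<kappa> = 1 - (a - b) / 2"
  have a0: "a \<noteq> 0" by (rule casimir_irreducible_nonzero[OF Y card cas(1)])
  have \<kappa>3: "2 * \<kappa> - 3 \<noteq> 0"
  proof
    assume "2 * \<kappa> - 3 = 0"
    moreover have "a - b = - 1 - (2 * \<kappa> - 3)" by (simp add: \<kappa>_def field_simps)
    ultimately show False using ab by simp
  qed
  have curlC: "\<kappa> *\<^sub>C C i = Y j ** C k - Y k ** C j" if "cyc i j k" for i j k
    using tensor_op_curl(1)[OF C cas that] by (simp add: \<kappa>_def)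
  have curlD: "\<kappa> *\<^sub>C D i = D j ** Y k - D k ** Y j" if "cyc i j k" for i j k
    using tensor_op_curl(2)[OF D cas(2,1) that] by (simp add: \<kappa>_def vec_eq_iff field_simps)
  obtain \<mu> where \<mu>: "\<And>i. cross_op C D i = \<mu> *\<^sub>C Y i"
    using tensor_op_self[OF Y tensor_op_cross[OF C D] card] by blast
  have "\<mu> = 0"
  proof -
    have c: "cyc 1 2 3" "cyc 2 3 1" "cyc 3 1 2" by (rule cyc_123)+
    have "(\<Sum>l\<in>UNIV. Y l ** cross_op C D l) = \<kappa> *\<^sub>C (\<Sum>l\<in>UNIV. C l ** D l)"
      by (simp add: sum_3 cross_op_cyc[OF c(1)] cross_op_cyc[OF c(2)] cross_op_cyc[OF c(3)] cscale_add_right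
          cscale_mult_left[symmetric] curlC[OF c(1)] curlC[OF c(2)] curlC[OF c(3)] matrix_add_ldistrib
          matrix_diff_ldistrib matrix_diff_rdistrib
          matrix_mul_assoc del: cscale_mult_left)
    then have "\<mu> *\<^sub>C casimir Y = 0"
      by (simp add: \<mu> dot casimir_def cscale_sum_right)
    then show ?thesis using a0 by (simp add: cas)
  qed
  then have sym: "C i ** D j = C j ** D i" if "cyc i j k" for i j k
    using cross_op_cyc[OF cyc_rotate2[OF that], of C D] \<mu>[of k] by simp
  have comm: "Y r ** (C s ** D t) - (C s ** D t) ** Y r
      = (Y r ** C s - C s ** Z r) ** D t + C s ** (Z r ** D t - D t ** Y r)" for r s t
    by (simp add: mat_distribs matrix_mul_assoc)
  note DC = tensor_opD[OF C] and DD = tensor_opD[OF D]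
  have diag: "C i ** D i = 0" if c: "cyc i j k" for i j k
  proof -
    \<comment> \<open>One \<open>\<kappa>\<close> is expanded by the curl of \<open>C\<close>, the
      other by the curl of \<open>D\<close>. Together they form commutators of \<open>Y\<close> with
      products \<open>C ** D\<close>, which are again such products.\<close>
    have "(2 * \<kappa>) *\<^sub>C (C i ** D i) = (\<kappa> *\<^sub>C C i) ** D i + C i ** (\<kappa> *\<^sub>C D i)"
      by (simp add: vec_eq_iff)
    also have "\<dots> = (Y j ** (C k ** D i) - (C i ** D k) ** Y j) - (Y k ** (C j ** D i) - (C i ** D j) ** Y k)"
      unfolding curlC[OF c] curlD[OF c] by (simp add: mat_distribs matrix_mul_assoc)
    also have "\<dots> = (Y j ** (C k ** D i) - (C k ** D i) ** Y j) - (Y k ** (C i ** D j) - (C i ** D j) ** Y k)"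
      by (simp only: sym[OF c] sym[OF cyc_rotate2[OF c]])
    also have "\<dots> = 2 *\<^sub>C (C i ** D i) - C j ** D j - C k ** D k"
      unfolding comm by (simp add: DC[OF c] DD[OF c] vec_eq_iff)
    also have "\<dots> = 3 *\<^sub>C (C i ** D i) - (\<Sum>l\<in>UNIV. C l ** D l)"
      by (simp add: sum_cyc[OF c] vec_eq_iff)
    finally have "(2 * \<kappa> - 3) *\<^sub>C (C i ** D i) = 0"
      by (simp add: dot cscale_diff_left)
    moreover have "2 * \<kappa> - 3 \<noteq> 0" by (rule \<kappa>3)
    ultimately show ?thesis by simp
  qed
  have off: "C i ** D j = 0" if c: "cyc i j k" for i j k
  proof -
    have "(2 * \<kappa>) *\<^sub>C (C i ** D j) = (\<kappa> *\<^sub>C C i) ** D j + C j ** (\<kappa> *\<^sub>C D i)"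
      using sym[OF c] by (simp add: vec_eq_iff)
    also have "\<dots> = (Y j ** (C k ** D j) - (C j ** D k) ** Y j) - (Y k ** (C j ** D j) - (C j ** D j) ** Y k)"
      unfolding curlC[OF c] curlD[OF c] by (simp add: mat_distribs matrix_mul_assoc)
    also have "\<dots> = (Y j ** (C k ** D j) - (C k ** D j) ** Y j) - (Y k ** (C j ** D j) - (C j ** D j) ** Y k)"
      by (simp only: sym[OF cyc_rotate[OF c]])
    also have "\<dots> = 2 *\<^sub>C (C i ** D j) + C j ** D i"
      unfolding comm by (simp add: DC[OF c] DD[OF c] vec_eq_iff)
    finally have "(2 * \<kappa> - 3) *\<^sub>C (C i ** D j) = 0"
      unfolding sym[OF c, symmetric] by (simp add: vec_eq_iff algebra_simps)
    moreover have "2 * \<kappa> - 3 \<noteq> 0" by (rule \<kappa>3)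
    ultimately show ?thesis by simp
  qed
  show ?thesis
  proof (rule all_pairs_cyc)
    show "C i ** D i = 0" for i using diag cyc_ex[of i] by blast
  qed (use off sym in metis)
qed

section \<open>Block matrices\<close>

lemma sum_UNIV_Plus: "(\<Sum>i\<in>UNIV. f i) = (\<Sum>a\<in>UNIV. f (Inl a)) + (\<Sum>b\<in>UNIV. f (Inr b))"
  for f :: "'p::finite + 'm::finite \<Rightarrow> 'a::comm_monoid_add"
  unfolding UNIV_Plus_UNIV[symmetric] by (subst sum.Plus) auto

lemma block_mat_nth [simp]:
  "block_mat A B C D $ Inl a $ Inl b = A $ a $ b"
  "block_mat A B C D $ Inl a $ Inr d = B $ a $ d"
  "block_mat A B C D $ Inr c $ Inl b = C $ c $ b"
  "block_mat A B C D $ Inr c $ Inr d = D $ c $ d"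
  by (simp_all add: block_mat_def)

lemma block_mat_eqI:
  fixes M M' :: "complex^('p::finite + 'm::finite)^('p + 'm)"
  assumes "\<And>a b. M $ Inl a $ Inl b = M' $ Inl a $ Inl b" "\<And>a b. M $ Inl a $ Inr b = M' $ Inl a $ Inr b"
    "\<And>a b. M $ Inr a $ Inl b = M' $ Inr a $ Inl b" "\<And>a b. M $ Inr a $ Inr b = M' $ Inr a $ Inr b"
  shows "M = M'"
  unfolding vec_eq_iff
proof (intro allI)
  fix i j show "M $ i $ j = M' $ i $ j" using assms by (cases i; cases j) auto
qed

lemma block_mat_eq_iff: "block_mat A B C D = block_mat A' B' C' D' \<longleftrightarrow> A = A' \<and> B = B' \<and> C = C' \<and> D = D'"
proof
  assume e: "block_mat A B C D = block_mat A' B' C' D'"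
  have "block_mat A B C D $ i $ j = block_mat A' B' C' D' $ i $ j" for i j by (simp add: e)
  from this[of "Inl _" "Inl _"] this[of "Inl _" "Inr _"] this[of "Inr _" "Inl _"] this[of "Inr _" "Inr _"]
  show "A = A' \<and> B = B' \<and> C = C' \<and> D = D'"
    by (simp add: vec_eq_iff)
qed auto

lemma block_mat_cases:
  obtains A B C D where "M = block_mat A B C D"
proof
  show "M = block_mat (\<chi> a b. M $ Inl a $ Inl b) (\<chi> a b. M $ Inl a $ Inr b)
      (\<chi> a b. M $ Inr a $ Inl b) (\<chi> a b. M $ Inr a $ Inr b)"
    by (rule block_mat_eqI) simp_all
qed

lemma block_mat_mult:
  "block_mat A B C D ** block_mat A' B' C' D'
    = block_mat (A ** A' + B ** C') (A ** B' + B ** D') (C ** A' + D ** C') (C ** B' + D ** D')"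
  by (rule block_mat_eqI) (simp_all add: matrix_mult_nth sum_UNIV_Plus)

lemma block_mat_linear:
  "block_mat A B C D + block_mat A' B' C' D' = block_mat (A + A') (B + B') (C + C') (D + D')"
  "block_mat A B C D - block_mat A' B' C' D' = block_mat (A - A') (B - B') (C - C') (D - D')"
  "- block_mat A B C D = block_mat (- A) (- B) (- C) (- D)"
  "c *\<^sub>C block_mat A B C D = block_mat (c *\<^sub>C A) (c *\<^sub>C B) (c *\<^sub>C C) (c *\<^sub>C D)"
  "(0 :: complex^('p::finite + 'm::finite)^('p + 'm)) = block_mat 0 0 0 0"
  by (rule block_mat_eqI; simp)+

lemma block_mat_one: "mat 1 = block_mat (mat 1) 0 0 (mat 1)"
  by (rule block_mat_eqI) (simp_all add: mat_def)

lemma cadjoint_block_mat: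
  "cadjoint (block_mat A B C D) = block_mat (cadjoint A) (cadjoint C) (cadjoint B) (cadjoint D)"
  by (rule block_mat_eqI) simp_all

lemma trace_block_mat: "trace (block_mat A B C D) = trace A + trace D"
  by (simp add: trace_def sum_UNIV_Plus)

lemma block_mat_diag_tensor_op:
  assumes "\<And>i. T i = block_mat (A i) (B i) (C i) (D i)"
  shows "tensor_op (\<lambda>i. block_mat (Y i) 0 0 (Z i)) (\<lambda>i. block_mat (Y i) 0 0 (Z i)) T \<longleftrightarrow>
    tensor_op Y Y A \<and> tensor_op Y Z B \<and> tensor_op Z Y C \<and> tensor_op Z Z D"
  by (auto simp: tensor_op_def assms block_mat_mult block_mat_linear block_mat_eq_iff)

section \<open>The reduced datum\<close>

lemma cscale_eq_iff_of_nonzero: "A \<noteq> 0 \<Longrightarrow> a *\<^sub>C A = b *\<^sub>C A \<longleftrightarrow> a = b"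
  by (metis cscale_diff_left cscale_eq_0_iff right_minus_eq)

lemma so3_triple_trace:
  assumes "so3_triple T" shows "trace (T i) = 0"
proof -
  obtain j k where "cyc i j k" using cyc_ex by blast
  then have "mcomm (T j) (T k) = T i"
    using assms cyc_rotate by (simp add: so3_triple_def)
  moreover have "trace (mcomm (T j) (T k)) = 0"
    by (simp add: mcomm_def trace_sub trace_mul_sym[of "T j" "T k"])
  ultimately show ?thesis by simp
qed

section \<open>Structure constants for the irreducible representations of dimensions n+2 and
  n\<close>

locale nahm_pair =
  fixes n :: nat
    and Y :: "3 \<Rightarrow> complex^'p^'p" and Z :: "3 \<Rightarrow> complex^'m^'m" and B :: "3 \<Rightarrow> complex^'m^'p"
  assumes n2: "n \<ge> 2" and cardp: "CARD('p) = n + 2" and cardm: "CARD('m) = n"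
    and Y: "so3_triple Y" "irreducible_triple Y" and Z: "so3_triple Z" "irreducible_triple Z"
    and B: "tensor_op Y Z B" and norm: "(\<Sum>i\<in>UNIV. B i ** cadjoint (B i)) = mat 1"
begin

abbreviation D :: "3 \<Rightarrow> complex^'p^'m" where "D i \<equiv> cadjoint (B i)"
abbreviation N :: complex where "N \<equiv> of_nat n"

lemma N_nz: "N \<noteq> 0" "N + 1 \<noteq> 0" "1 + N \<noteq> 0" "N + 2 \<noteq> 0" "N + 3 \<noteq> 0" "N - 1 \<noteq> 0"
proof -
  have "of_nat n \<noteq> (0::complex)" "of_nat (n + 1) \<noteq> (0::complex)" "of_nat (n + 2) \<noteq> (0::complex)"
    "of_nat (n + 3) \<noteq> (0::complex)" "of_nat n \<noteq> (of_nat 1 :: complex)"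
    using n2 unfolding of_nat_eq_0_iff of_nat_eq_iff by auto
  then show "N \<noteq> 0" "N + 1 \<noteq> 0" "1 + N \<noteq> 0" "N + 2 \<noteq> 0" "N + 3 \<noteq> 0" "N - 1 \<noteq> 0"
    by (simp_all add: add.commute)
qed

lemma D: "tensor_op Z Y D"
  by (rule tensor_op_adjoint[OF Y(1) Z(1) B])

lemma casY: "casimir Y = (- ((N + 1) * (N + 3) / 4)) *\<^sub>C mat 1"
  using casimir_irreducible[OF Y] by (simp add: cardp power2_eq_square algebra_simps)

lemma casZ: "casimir Z = (- ((N - 1) * (N + 1) / 4)) *\<^sub>C mat 1"
  using casimir_irreducible[OF Z] by (simp add: cardm power2_eq_square algebra_simps)

lemma cas_diff: "- ((N + 1) * (N + 3) / 4) - (- ((N - 1) * (N + 1) / 4)) = - (N + 1)"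
  by (simp add: field_simps)

text \<open>An intertwiner would carry one Casimir scalar to the other, but they differ by
  \<open>-(N + 1)\<close>.\<close>

lemma intertwiner_zero:
  assumes "\<And>i. Y i ** M = M ** Z i" shows "M = 0"
proof -
  have "casimir Y ** M = M ** casimir Z"
    by (simp add: casimir_def sum_3 mat_distribs matrix_mul_assoc[symmetric] assms)
      (simp add: matrix_mul_assoc assms)
  then have "(- ((N + 1) * (N + 3) / 4) - (- ((N - 1) * (N + 1) / 4))) *\<^sub>C M = 0"
    unfolding casY casZ cscale_diff_left by simp
  then show ?thesis
    unfolding cas_diff using N_nz(2) by (simp only: cscale_eq_0_iff neg_equal_0_iff_equal) simp
qed

lemma intertwiner_zero':
  assumes "\<And>i. Z i ** M = M ** Y i" shows "M = 0"
proof -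
  have "Y i ** cadjoint M = cadjoint M ** Z i" for i
    using arg_cong[where f = cadjoint, OF assms[of i]]
    by (simp add: so3_tripleD(1)[OF Y(1)] so3_tripleD(1)[OF Z(1)])
  then have "cadjoint M = 0" by (rule intertwiner_zero)
  then show ?thesis by simp
qed

lemma dot_YB: "(\<Sum>i\<in>UNIV. Y i ** B i) = 0"
  by (rule intertwiner_zero) (rule tensor_op_dot[OF so3_triple_tensor_op[OF Y(1)] B])

lemma dot_BZ: "(\<Sum>i\<in>UNIV. B i ** Z i) = 0"
  by (rule intertwiner_zero) (rule tensor_op_dot[OF B so3_triple_tensor_op[OF Z(1)]])

lemma dot_ZD: "(\<Sum>i\<in>UNIV. Z i ** D i) = 0"
  by (rule intertwiner_zero') (rule tensor_op_dot[OF so3_triple_tensor_op[OF Z(1)] D])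

lemma dot_DY: "(\<Sum>i\<in>UNIV. D i ** Y i) = 0"
  by (rule intertwiner_zero') (rule tensor_op_dot[OF D so3_triple_tensor_op[OF Y(1)]])

text \<open>A scalar by Schur. Its trace is that of the normalisation of \<open>B\<close> on the
  larger space, so the scalar is the ratio of the dimensions.\<close>

lemma dot_DB: "(\<Sum>i\<in>UNIV. D i ** B i) = ((N + 2) / N) *\<^sub>C mat 1"
proof -
  let ?S = "\<Sum>i\<in>UNIV. D i ** B i"
  obtain s where s: "?S = s *\<^sub>C mat 1"
    using schur[OF Z(2) _ so3_tripleD(1)[OF Z(1)], of ?S] tensor_op_dot[OF D B] by metis
  have "trace ?S = (\<Sum>i\<in>UNIV. trace (B i ** D i))"
    unfolding trace_sum by (intro sum.cong refl trace_mul_sym)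
  also have "\<dots> = trace (\<Sum>i\<in>UNIV. B i ** D i)"
    by (simp add: trace_sum)
  finally have "s * N = N + 2" by (simp add: s norm trace_I cardp cardm)
  then have "s = (N + 2) / N" using N_nz(1) by (simp add: field_simps)
  then show ?thesis by (simp add: s)
qed

lemma curl_YB: "cyc i j k \<Longrightarrow> Y j ** B k - Y k ** B j = ((N + 3) / 2) *\<^sub>C B i"
  using tensor_op_curl(1)[OF B casY casZ, of i j k] unfolding cas_diff
  by (simp add: vec_eq_iff field_simps)

lemma curl_BZ: "cyc i j k \<Longrightarrow> B k ** Z j - B j ** Z k = ((N - 1) / 2) *\<^sub>C B i"
  using tensor_op_curl(2)[OF B casY casZ, of i j k] unfolding cas_diff
  by (simp add: vec_eq_iff field_simps)

lemma curl_ZD: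
  assumes "cyc i j k" shows "Z j ** D k - Z k ** D j = (- ((N - 1) / 2)) *\<^sub>C D i"
proof -
  have "cadjoint (B k ** Z j - B j ** Z k) = - (Z j ** D k - Z k ** D j)"
    by (simp add: so3_tripleD(1)[OF Z(1)])
  then have "- (Z j ** D k - Z k ** D j) = ((N - 1) / 2) *\<^sub>C D i"
    unfolding curl_BZ[OF assms] by simp
  then have "- (- (Z j ** D k - Z k ** D j)) = - (((N - 1) / 2) *\<^sub>C D i)" by simp
  then show ?thesis by simp
qed

lemma curl_DY:
  assumes "cyc i j k" shows "D k ** Y j - D j ** Y k = (- ((N + 3) / 2)) *\<^sub>C D i"
proof -
  have "cadjoint (Y j ** B k - Y k ** B j) = - (D k ** Y j - D j ** Y k)"
    by (simp add: so3_tripleD(1)[OF Y(1)])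
  then have "- (D k ** Y j - D j ** Y k) = ((N + 3) / 2) *\<^sub>C D i"
    unfolding curl_YB[OF assms] by simp
  then have "- (- (D k ** Y j - D j ** Y k)) = - (((N + 3) / 2) *\<^sub>C D i)" by simp
  then show ?thesis by simp
qed

text \<open>The cross product is \<open>s\<close> times \<open>Y\<close>. Pairing with
  \<open>Y\<close> turns it into \<open>(Y x B) . D\<close>, evaluated by \<open>curl_YB\<close> and
  the normalisation, and the Casimir of \<open>Y\<close> on the other side determines
  \<open>s\<close>. This is the origin of \<open>2/(n+1)\<close> in the equation for
  \<open>f^+\<close>.\<close>

lemma cross_BD:
  assumes "cyc i j k" shows "B j ** D k - B k ** D j = (- 2 / (N + 1)) *\<^sub>C Y i"
proof -
  obtain s where s: "\<And>i. cross_op B D i = s *\<^sub>C Y i"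
    using tensor_op_self[OF Y tensor_op_cross[OF B D]] cardp by auto
  have c: "cyc 1 2 3" "cyc 2 3 1" "cyc 3 1 2" by (rule cyc_123)+
  have "s *\<^sub>C casimir Y = (\<Sum>l\<in>UNIV. Y l ** cross_op B D l)"
    by (simp add: s casimir_def cscale_sum_right)
  also have "\<dots> = (Y 2 ** B 3 - Y 3 ** B 2) ** D 1 + (Y 3 ** B 1 - Y 1 ** B 3) ** D 2
      + (Y 1 ** B 2 - Y 2 ** B 1) ** D 3"
    by (simp add: sum_3 cross_op_cyc[OF c(1)] cross_op_cyc[OF c(2)] cross_op_cyc[OF c(3)]
        matrix_diff_ldistrib matrix_diff_rdistrib matrix_mul_assoc)
  also have "\<dots> = ((N + 3) / 2) *\<^sub>C (\<Sum>l\<in>UNIV. B l ** D l)"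
    unfolding curl_YB[OF c(1)] curl_YB[OF c(2)] curl_YB[OF c(3)]
    by (simp add: sum_3 cscale_add_right)
  finally have "(s * (- ((N + 1) * (N + 3) / 4))) *\<^sub>C (mat 1 :: complex^'p^'p) = ((N + 3) / 2) *\<^sub>C mat 1"
    unfolding casY norm by simp
  then have "s * (- ((N + 1) * (N + 3) / 4)) = (N + 3) / 2"
    using cscale_eq_iff_of_nonzero[OF mat_one_neq_zero] by blast
  moreover have "(N + 3) * (s * (N + 1)) = - 4 * (s * (- ((N + 1) * (N + 3) / 4)))" by simp
  moreover have "- 4 * ((N + 3) / 2) = (N + 3) * (- 2)" by (simp add: field_simps)
  ultimately have "(N + 3) * (s * (N + 1)) = (N + 3) * (- 2)" by (simp only:)
  then have "s * (N + 1) = - 2" using N_nz(5) mult_left_cancel by blast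
  then have "s = - 2 / (N + 1)" using N_nz(2) by (simp add: field_simps)
  then show ?thesis using s[of i] cross_op_cyc[OF assms, of B D] by simp
qed

text \<open>The same pairing on the smaller space, where \<open>dot_DB\<close> contributes the
  factor \<open>(N + 2) / N\<close>.\<close>

lemma cross_DB:
  assumes "cyc i j k" shows "D j ** B k - D k ** B j = (2 * (N + 2) / (N * (N + 1))) *\<^sub>C Z i"
proof -
  obtain s where s: "\<And>i. cross_op D B i = s *\<^sub>C Z i"
    using tensor_op_self[OF Z tensor_op_cross[OF D B]] cardm n2 by auto
  have c: "cyc 1 2 3" "cyc 2 3 1" "cyc 3 1 2" by (rule cyc_123)+
  have "s *\<^sub>C casimir Z = (\<Sum>l\<in>UNIV. Z l ** cross_op D B l)"
    by (simp add: s casimir_def cscale_sum_right)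
  also have "\<dots> = (Z 2 ** D 3 - Z 3 ** D 2) ** B 1 + (Z 3 ** D 1 - Z 1 ** D 3) ** B 2
      + (Z 1 ** D 2 - Z 2 ** D 1) ** B 3"
    by (simp add: sum_3 cross_op_cyc[OF c(1)] cross_op_cyc[OF c(2)] cross_op_cyc[OF c(3)]
        matrix_diff_ldistrib matrix_diff_rdistrib matrix_mul_assoc)
  also have "\<dots> = (- ((N - 1) / 2)) *\<^sub>C (\<Sum>l\<in>UNIV. D l ** B l)"
    unfolding curl_ZD[OF c(1)] curl_ZD[OF c(2)] curl_ZD[OF c(3)]
    by (simp add: sum_3 cscale_add_right)
  finally have "(s * (- ((N - 1) * (N + 1) / 4))) *\<^sub>C (mat 1 :: complex^'m^'m)
      = (- ((N - 1) / 2) * ((N + 2) / N)) *\<^sub>C mat 1"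
    unfolding casZ dot_DB by simp
  then have "s * (- ((N - 1) * (N + 1) / 4)) = - ((N - 1) / 2) * ((N + 2) / N)"
    using cscale_eq_iff_of_nonzero[OF mat_one_neq_zero] by blast
  moreover have "(N - 1) * (s * (N * (N + 1))) = - 4 * N * (s * (- ((N - 1) * (N + 1) / 4)))" by simp
  moreover have "- 4 * N * (- ((N - 1) / 2) * ((N + 2) / N)) = (N - 1) * (2 * (N + 2))"
    using N_nz(1) by simp
  ultimately have "(N - 1) * (s * (N * (N + 1))) = (N - 1) * (2 * (N + 2))" by (simp only:)
  then have "s * (N * (N + 1)) = 2 * (N + 2)" using N_nz(6) mult_left_cancel by blast
  then have "s = 2 * (N + 2) / (N * (N + 1))"
    using N_nz(1,2) by (metis mult_eq_0_iff nonzero_mult_div_cancel_right)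
  then show ?thesis using s[of i] cross_op_cyc[OF assms, of D B] by simp
qed

text \<open>Subtract the multiple of \<open>B\<close> that makes the pairing with \<open>D\<close>
  zero. All products of the difference with the \<open>D j\<close> then vanish; multiplying by
  \<open>B j\<close> and summing gives a nonzero multiple of the difference itself.\<close>

lemma B_unique:
  assumes C: "tensor_op Y Z C"
  obtains s where "\<And>i. C i = s *\<^sub>C B i"
proof -
  let ?S = "\<Sum>l\<in>UNIV. C l ** D l"
  obtain s where s: "?S = s *\<^sub>C mat 1"
    using schur[OF Y(2) _ so3_tripleD(1)[OF Y(1)], of ?S] tensor_op_dot[OF C D] by metis
  let ?C = "\<lambda>i. C i - s *\<^sub>C B i"
  have "(\<Sum>l\<in>UNIV. ?C l ** D l) = ?S - s *\<^sub>C (\<Sum>l\<in>UNIV. B l ** D l)"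
    by (simp add: matrix_diff_rdistrib sum_subtractf cscale_sum_right)
  then have dot: "(\<Sum>l\<in>UNIV. ?C l ** D l) = 0" by (simp add: s norm)
  have "- ((N + 1) * (N + 3) / 4) - (- ((N - 1) * (N + 1) / 4)) \<noteq> - 1"
    unfolding cas_diff using N_nz(1) by simp
  then have z: "?C i ** D j = 0" for i j
    using tensor_op_unique_of_dot_zero[OF Y _ tensor_op_diff_cscale[OF C B] D casY casZ _ dot] cardp by simp
  have "?C i = 0" for i
  proof -
    have "((N + 2) / N) *\<^sub>C ?C i = ?C i ** (\<Sum>l\<in>UNIV. D l ** B l)"
      by (simp add: dot_DB)
    also have "\<dots> = (\<Sum>l\<in>UNIV. (?C i ** D l) ** B l)"
      by (simp only: matrix_sum_right matrix_mul_assoc)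
    also have "\<dots> = 0" by (simp only: z matrix_zero_left) simp
    finally show ?thesis using N_nz(1,4) by (simp only: cscale_eq_0_iff divide_eq_0_iff) simp
  qed
  then show thesis using that[of s] by simp
qed

lemma Y_nz: "\<exists>i. Y i \<noteq> 0"
  using casY N_nz(2,5) by (cases "\<exists>i. Y i \<noteq> 0") (auto simp: casimir_def)

lemma Z_nz: "\<exists>i. Z i \<noteq> 0"
  using casZ N_nz(2,6) by (cases "\<exists>i. Z i \<noteq> 0") (auto simp: casimir_def)

lemma B_nz: "\<exists>i. B i \<noteq> 0"
  using norm by (cases "\<exists>i. B i \<noteq> 0") auto

text \<open>The block form at a fixed time. \<open>R 1 1 0\<close> is the triple of symmetry
  generators, and the sign in the lower left block makes the matrices anti-Hermitian.\<close>

definition R :: "real \<Rightarrow> real \<Rightarrow> real \<Rightarrow> 3 \<Rightarrow> complex^('p + 'm)^('p + 'm)" where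
  "R a b g i = block_mat (of_real a *\<^sub>C Y i) (of_real g *\<^sub>C B i) (- (of_real g *\<^sub>C D i)) (of_real b *\<^sub>C Z i)"

lemma R_add: "R a b g i + R a' b' g' i = R (a + a') (b + b') (g + g') i"
  by (simp add: R_def block_mat_linear cscale_add_left)

lemma R_cscale: "of_real c *\<^sub>C R a b g i = R (c * a) (c * b) (c * g) i"
  by (simp add: R_def block_mat_linear)

lemma R_scaleR: "c *\<^sub>R R a b g i = R (c * a) (c * b) (c * g) i"
  by (simp add: scaleR_cscale R_cscale)

lemma R_adjoint: "cadjoint (R a b g i) = - R a b g i"
  by (simp add: R_def cadjoint_block_mat block_mat_linear so3_tripleD(1)[OF Y(1)] so3_tripleD(1)[OF Z(1)])

lemma R_trace: "trace (R a b g i) = 0"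
  using so3_triple_trace[OF Y(1)] so3_triple_trace[OF Z(1)] by (simp add: R_def trace_block_mat)

text \<open>\<open>Ra\<close>, \<open>Rb\<close> and \<open>Rg\<close> are the right-hand sides of
  the reduced system. So \<open>R_mcomm\<close> serves twice: it turns Nahm's equations into that
  system, and it shows that a common fixed point of the three gives a representation.\<close>

definition Ra :: "real \<Rightarrow> real \<Rightarrow> real" where "Ra a g = a\<^sup>2 + 2 / (real n + 1) * g\<^sup>2"
definition Rb :: "real \<Rightarrow> real \<Rightarrow> real" where
  "Rb b g = b\<^sup>2 - 2 * (real n + 2) / (real n * (real n + 1)) * g\<^sup>2"
definition Rg :: "real \<Rightarrow> real \<Rightarrow> real \<Rightarrow> real" where
  "Rg a b g = ((real n + 3) / 2 * a - (real n - 1) / 2 * b) * g"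

lemma R_mcomm:
  assumes c: "cyc i j k"
  shows "mcomm (R a b g j) (R a b g k) = R (Ra a g) (Rb b g) (Rg a b g) i"
proof -
  let ?a = "complex_of_real a" and ?b = "complex_of_real b" and ?g = "complex_of_real g"
  have 1: "?a *\<^sub>C ?a *\<^sub>C (Y j ** Y k - Y k ** Y j) - ?g *\<^sub>C ?g *\<^sub>C (B j ** D k - B k ** D j)
      = of_real (Ra a g) *\<^sub>C Y i"
    unfolding cross_BD[OF c] using so3_tripleD(2)[OF Y(1) cyc_rotate[OF c]] N_nz
    by (simp add: vec_eq_iff Ra_def power2_eq_square field_simps)
  have 2: "?b *\<^sub>C ?b *\<^sub>C (Z j ** Z k - Z k ** Z j) - ?g *\<^sub>C ?g *\<^sub>C (D j ** B k - D k ** B j)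
      = of_real (Rb b g) *\<^sub>C Z i"
    unfolding cross_DB[OF c] using so3_tripleD(2)[OF Z(1) cyc_rotate[OF c]] N_nz
    by (simp add: vec_eq_iff Rb_def power2_eq_square field_simps)
  have 3: "?a *\<^sub>C ?g *\<^sub>C (Y j ** B k - Y k ** B j) - ?b *\<^sub>C ?g *\<^sub>C (B k ** Z j - B j ** Z k)
      = of_real (Rg a b g) *\<^sub>C B i"
    unfolding curl_YB[OF c] curl_BZ[OF c]
    by (simp add: vec_eq_iff Rg_def field_simps)
  have 4: "?a *\<^sub>C ?g *\<^sub>C (D k ** Y j - D j ** Y k) - ?b *\<^sub>C ?g *\<^sub>C (Z j ** D k - Z k ** D j)
      = - (of_real (Rg a b g) *\<^sub>C D i)"
    unfolding curl_ZD[OF c] curl_DY[OF c]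
    by (simp add: vec_eq_iff Rg_def field_simps)
  show ?thesis
    unfolding R_def 1[symmetric] 2[symmetric] 3[symmetric] 4[symmetric]
    by (simp add: mcomm_def block_mat_mult block_mat_linear block_mat_eq_iff)
      (simp add: vec_eq_iff algebra_simps)
qed

lemma R_so3_triple:
  assumes "Ra a g = a" "Rb b g = b" "Rg a b g = g"
  shows "so3_triple (R a b g)"
  unfolding so3_triple_def
proof (intro conjI allI impI)
  show "mcomm (R a b g i) (R a b g j) = R a b g k" if "cyc i j k" for i j k
    using R_mcomm[OF cyc_rotate2[OF that], of a b g] by (simp add: assms)
qed (rule R_adjoint)

text \<open>The off-diagonal blocks consist of the vanishing dot products; scalars remain on the two
  diagonal blocks, and the hypotheses make them agree.\<close>

lemma R_casimir:
  assumes "- (a\<^sup>2 * ((real n + 1) * (real n + 3) / 4)) - g\<^sup>2 = c"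
    and "- (b\<^sup>2 * ((real n - 1) * (real n + 1) / 4)) - g\<^sup>2 * ((real n + 2) / real n) = c"
  shows "casimir (R a b g) = of_real c *\<^sub>C mat 1"
proof -
  let ?a = "complex_of_real a" and ?b = "complex_of_real b" and ?g = "complex_of_real g"
  have "casimir (R a b g) = block_mat
      ((?a * ?a) *\<^sub>C casimir Y - (?g * ?g) *\<^sub>C (\<Sum>i\<in>UNIV. B i ** D i))
      ((?a * ?g) *\<^sub>C (\<Sum>i\<in>UNIV. Y i ** B i) + (?g * ?b) *\<^sub>C (\<Sum>i\<in>UNIV. B i ** Z i))
      (- ((?a * ?g) *\<^sub>C (\<Sum>i\<in>UNIV. D i ** Y i) + (?g * ?b) *\<^sub>C (\<Sum>i\<in>UNIV. Z i ** D i)))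
      ((?b * ?b) *\<^sub>C casimir Z - (?g * ?g) *\<^sub>C (\<Sum>i\<in>UNIV. D i ** B i))"
    by (simp add: casimir_def sum_3 R_def block_mat_mult block_mat_linear block_mat_eq_iff)
      (simp add: vec_eq_iff algebra_simps)
  also have "\<dots> = block_mat (of_real (- (a\<^sup>2 * ((real n + 1) * (real n + 3) / 4)) - g\<^sup>2) *\<^sub>C mat 1) 0 0
      (of_real (- (b\<^sup>2 * ((real n - 1) * (real n + 1) / 4)) - g\<^sup>2 * ((real n + 2) / real n)) *\<^sub>C mat 1)"
    unfolding dot_YB dot_BZ dot_ZD dot_DY norm dot_DB casY casZ
    by (simp add: block_mat_eq_iff power2_eq_square) (simp add: vec_eq_iff algebra_simps)
  finally show ?thesis unfolding assms by (simp add: block_mat_one block_mat_linear)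
qed

end

section \<open>Representations and triples\<close>

definition so3_coord :: "real^3^3 \<Rightarrow> 3 \<Rightarrow> real" where
  "so3_coord A i = (if i = 1 then A $ 3 $ 2 else if i = 2 then A $ 1 $ 3 else A $ 2 $ 1)"

lemma so3_basis_nth:
  "so3_basis 1 = (\<chi> j k. if j = 3 \<and> k = 2 then 1 else if j = 2 \<and> k = 3 then -1 else 0)"
  "so3_basis 2 = (\<chi> j k. if j = 1 \<and> k = 3 then 1 else if j = 3 \<and> k = 1 then -1 else 0)"
  "so3_basis 3 = (\<chi> j k. if j = 2 \<and> k = 1 then 1 else if j = 1 \<and> k = 2 then -1 else 0)"
  by (auto simp: so3_basis_def vec_eq_iff levi_civita_def forall_3)

lemma so3_basis_mem: "so3_basis i \<in> so3"
  using exhaust_3[of i]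
  by (elim disjE) (simp_all add: so3_def so3_basis_nth transpose_def vec_eq_iff forall_3)

lemma so3_memD: "A \<in> so3 \<Longrightarrow> A $ j $ i = - A $ i $ j"
proof -
  assume "A \<in> so3"
  then have "transpose A $ i $ j = (- A) $ i $ j" by (simp add: so3_def)
  then show ?thesis by (simp add: transpose_def)
qed

lemma so3_decomp:
  assumes "A \<in> so3" shows "A = (\<Sum>i\<in>UNIV. so3_coord A i *\<^sub>R so3_basis i)"
proof -
  have "A $ i $ i = 0" for i using so3_memD[OF assms, of i i] by simp
  moreover have "A $ 2 $ 3 = - A $ 3 $ 2" "A $ 3 $ 1 = - A $ 1 $ 3" "A $ 1 $ 2 = - A $ 2 $ 1"
    by (rule so3_memD[OF assms])+
  ultimately have "A $ i $ j = (\<Sum>l\<in>UNIV. so3_coord A l *\<^sub>R so3_basis l) $ i $ j" for i j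
    using exhaust_3[of i] exhaust_3[of j]
    by (elim disjE) (simp_all add: sum_3 so3_coord_def so3_basis_nth)
  then show ?thesis unfolding vec_eq_iff by blast
qed

lemma so3_memI: "(\<And>i j. A $ j $ i = - A $ i $ j) \<Longrightarrow> A \<in> so3"
proof -
  assume a: "\<And>i j. A $ j $ i = - A $ i $ j"
  have "transpose A $ i $ j = (- A) $ i $ j" for i j
    unfolding transpose_def vec_lambda_beta using a[of j i] by simp
  then show "A \<in> so3" unfolding so3_def vec_eq_iff by blast
qed

lemma so3_closed:
  assumes "A \<in> so3"
  shows "B \<in> so3 \<Longrightarrow> A + B \<in> so3" "c *\<^sub>R A \<in> so3"
proof -
  show "A + B \<in> so3" if B: "B \<in> so3"
  proof (rule so3_memI)
    fix i j show "(A + B) $ j $ i = - (A + B) $ i $ j"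
      using so3_memD[OF assms, of j i] so3_memD[OF B, of j i] by simp
  qed
  show "c *\<^sub>R A \<in> so3"
  proof (rule so3_memI)
    fix i j show "(c *\<^sub>R A) $ j $ i = - (c *\<^sub>R A) $ i $ j"
      using so3_memD[OF assms, of j i] by simp
  qed
qed

lemma mcomm_so3_basis: "cyc i j k \<Longrightarrow> mcomm (so3_basis i) (so3_basis j) = so3_basis k"
  by (erule cyc_cases; simp add: mcomm_def so3_basis_nth vec_eq_iff forall_3 matrix_mult_nth sum_3)

lemma so3_coord_sum: "so3_coord (\<Sum>i\<in>UNIV. a i *\<^sub>R so3_basis i) l = a l"
  using exhaust_3[of l] by (elim disjE) (simp_all add: so3_coord_def sum_3 so3_basis_nth)

lemma so3_coord_mcomm:
  assumes "A \<in> so3" "B \<in> so3" "cyc i j k"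
  shows "so3_coord (mcomm A B) k = so3_coord A i * so3_coord B j - so3_coord A j * so3_coord B i"
proof -
  have "A $ i $ i = 0" "B $ i $ i = 0" for i
    using so3_memD[OF assms(1), of i i] so3_memD[OF assms(2), of i i] by simp_all
  moreover have "A $ 2 $ 3 = - A $ 3 $ 2" "A $ 3 $ 1 = - A $ 1 $ 3" "A $ 1 $ 2 = - A $ 2 $ 1"
    "B $ 2 $ 3 = - B $ 3 $ 2" "B $ 3 $ 1 = - B $ 1 $ 3" "B $ 1 $ 2 = - B $ 2 $ 1"
    by (rule so3_memD[OF assms(1)] so3_memD[OF assms(2)])+
  ultimately show ?thesis
    by (cases rule: cyc_cases[OF assms(3)]) (simp_all add: so3_coord_def mcomm_def matrix_mult_nth sum_3)
qed

lemma mcomm_so3: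
  assumes "A \<in> so3" "B \<in> so3" shows "mcomm A B \<in> so3"
proof (rule so3_memI)
  fix i j
  have "A $ j $ k * B $ k $ i = B $ i $ k * A $ k $ j" "B $ j $ k * A $ k $ i = A $ i $ k * B $ k $ j" for k
    using so3_memD[OF assms(1), of j k] so3_memD[OF assms(1), of k i]
      so3_memD[OF assms(2), of j k] so3_memD[OF assms(2), of k i] by simp_all
  then show "mcomm A B $ j $ i = - mcomm A B $ i $ j"
    by (simp add: mcomm_def matrix_mult_nth)
qed

lemma so3_rep_sum:
  assumes "so3_rep \<rho>" "A \<in> so3"
  shows "\<rho> A = (\<Sum>i\<in>UNIV. so3_coord A i *\<^sub>R \<rho> (so3_basis i))"
proof -
  have "\<rho> A = \<rho> (so3_coord A 1 *\<^sub>R so3_basis 1 + so3_coord A 2 *\<^sub>R so3_basis 2 + so3_coord A 3 *\<^sub>R so3_basis 3)"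
    using so3_decomp[OF assms(2)] by (simp add: sum_3)
  then show ?thesis
    using assms(1) by (simp add: so3_rep_def so3_closed so3_basis_mem sum_3)
qed

lemma so3_unitary_irrep_triple:
  assumes "so3_unitary_irrep \<rho>"
  shows "so3_triple (\<lambda>i. \<rho> (so3_basis i))" "irreducible_triple (\<lambda>i. \<rho> (so3_basis i))"
proof -
  have r: "so3_rep \<rho>" using assms by (simp add: so3_unitary_irrep_def)
  have "mcomm (\<rho> (so3_basis i)) (\<rho> (so3_basis j)) = \<rho> (so3_basis k)" if "cyc i j k" for i j k
    using r mcomm_so3_basis[OF that] so3_basis_mem unfolding so3_rep_def by metis
  then show "so3_triple (\<lambda>i. \<rho> (so3_basis i))"
    using assms so3_basis_mem by (auto simp: so3_triple_def so3_unitary_irrep_def)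
  show "irreducible_triple (\<lambda>i. \<rho> (so3_basis i))"
    unfolding irreducible_triple_def
  proof (intro allI impI)
    fix S :: "(complex^'a) set"
    assume S: "vec.subspace S \<and> (\<forall>i. \<forall>v\<in>S. \<rho> (so3_basis i) *v v \<in> S)"
    have "\<rho> A *v v \<in> S" if "A \<in> so3" "v \<in> S" for A v
    proof -
      have "\<rho> A *v v = (\<Sum>i\<in>UNIV. complex_of_real (so3_coord A i) *s (\<rho> (so3_basis i) *v v))"
        unfolding so3_rep_sum[OF r that(1)]
        by (simp add: sum_3 matrix_vector_mult_add_rdistrib scaleR_cscale cscale_vector)
      then show ?thesis using S that(2) by (simp add: vec.subspace_sum vec.subspace_scale)
    qed
    then show "S = {0} \<or> S = UNIV"
      using assms S unfolding so3_unitary_irrep_def by blast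
  qed
qed

lemma intertwining_triple_tensor_op:
  assumes "intertwining_triple \<rho> \<sigma> B"
  shows "tensor_op (\<lambda>i. \<rho> (so3_basis i)) (\<lambda>i. \<sigma> (so3_basis i)) B"
  unfolding tensor_op_iff
proof (intro allI)
  fix i j
  have "\<rho> (so3_basis i) ** B j - B j ** \<sigma> (so3_basis i) = (\<Sum>k\<in>UNIV. levi_civita k i j *\<^sub>R B k)"
    using assms by (simp add: intertwining_triple_def)
  then show "\<rho> (so3_basis i) ** B j - B j ** \<sigma> (so3_basis i) = (\<Sum>k\<in>UNIV. levi_civita i j k *\<^sub>R B k)"
    by (simp only: levi_civita_rotate[of _ i j])
qed

definition triple_rep :: "(3 \<Rightarrow> complex^'n^'n) \<Rightarrow> real^3^3 \<Rightarrow> complex^'n^'n" where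
  "triple_rep Z A = (\<Sum>i\<in>UNIV. so3_coord A i *\<^sub>R Z i)"

lemma triple_rep_so3_rep:
  assumes "so3_triple Z" shows "so3_rep (triple_rep Z)"
proof -
  have add: "so3_coord (A + B) i = so3_coord A i + so3_coord B i"
    and sc: "so3_coord (c *\<^sub>R A) i = c * so3_coord A i" for A B c i
    by (simp_all add: so3_coord_def)
  have "triple_rep Z (mcomm A B) = mcomm (triple_rep Z A) (triple_rep Z B)"
    if "A \<in> so3" "B \<in> so3" for A B
    using so3_tripleD(2)[OF assms cyc_123(1)] so3_tripleD(2)[OF assms cyc_123(2)]
      so3_tripleD(2)[OF assms cyc_123(3)]
    unfolding triple_rep_def sum_3 so3_coord_mcomm[OF that cyc_123(1)]
      so3_coord_mcomm[OF that cyc_123(2)] so3_coord_mcomm[OF that cyc_123(3)]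
    by (simp add: mcomm_def scaleR_cscale mat_distribs)
      (simp add: vec_eq_iff algebra_simps)
  then show ?thesis
    by (simp add: so3_rep_def triple_rep_def add sc scaleR_add_left sum.distrib scaleR_sum_right)
qed

lemma triple_rep_basis_sum: "triple_rep Z (\<Sum>i\<in>UNIV. a i *\<^sub>R so3_basis i) = (\<Sum>i\<in>UNIV. a i *\<^sub>R Z i)"
  by (simp only: triple_rep_def so3_coord_sum)

text \<open>The intertwiner of generators extends linearly. That \<open>rep_copies \<rho>\<close> is
  a representation follows by conjugation with the invertible \<open>P\<close> instead of an
  entrywise check.\<close>

lemma triple_rep_iso_copies:
  fixes Z :: "3 \<Rightarrow> complex^'n^'n" and \<rho> :: "real^3^3 \<Rightarrow> complex^'m^'m"
  assumes Z: "so3_triple Z" and cas: "casimir Z = of_real (- (((real CARD('m))\<^sup>2 - 1) / 4)) *\<^sub>C mat 1"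
    and \<rho>: "so3_unitary_irrep \<rho>"
    and card: "CARD('n) = CARD('k::finite) * CARD('m)"
  shows "so3_rep_iso (triple_rep Z) (rep_copies \<rho> :: real^3^3 \<Rightarrow> complex^('k \<times> 'm)^('k \<times> 'm))"
proof -
  let ?Y = "\<lambda>i. \<rho> (so3_basis i)" and ?c = "rep_copies \<rho> :: real^3^3 \<Rightarrow> complex^('k \<times> 'm)^('k \<times> 'm)"
  have r: "so3_rep \<rho>" using \<rho> by (simp add: so3_unitary_irrep_def)
  obtain P :: "complex^'n^('k \<times> 'm)" where P: "invertible P" "\<And>i. P ** Z i = triple_copies ?Y i ** P"
    using isotypic[OF Z cas so3_unitary_irrep_triple[OF \<rho>] card] by blast
  have copies: "?c A = (\<Sum>i\<in>UNIV. so3_coord A i *\<^sub>R triple_copies ?Y i)" if "A \<in> so3" for A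
    unfolding rep_copies_def so3_rep_sum[OF r that] by (simp add: vec_eq_iff triple_copies_def sum_3)
  have int: "P ** triple_rep Z A = ?c A ** P" if "A \<in> so3" for A
    unfolding copies[OF that] triple_rep_def
    by (simp add: scaleR_cscale matrix_sum_left matrix_sum_right P(2))
  obtain Q where Q: "P ** Q = mat 1" "Q ** P = mat 1" using P(1) unfolding invertible_def by blast
  have conj: "?c A = P ** triple_rep Z A ** Q" if "A \<in> so3" for A
  proof -
    have "P ** triple_rep Z A ** Q = ?c A ** (P ** Q)"
      by (simp only: int[OF that] matrix_mul_assoc)
    then show ?thesis by (simp add: Q(1))
  qed
  have tr: "so3_rep (triple_rep Z)" by (rule triple_rep_so3_rep[OF Z])
  have "so3_rep ?c"
    unfolding so3_rep_def
  proof (intro conjI ballI allI)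
    fix A B :: "real^3^3" and c assume AB: "A \<in> so3"
    show "?c (c *\<^sub>R A) = c *\<^sub>R ?c A"
      using tr AB by (simp add: conj so3_closed so3_rep_def scaleR_cscale)
    assume B: "B \<in> so3"
    show "?c (A + B) = ?c A + ?c B"
      using tr AB B by (simp add: conj so3_closed so3_rep_def mat_distribs)
    have PQ: "(P ** M ** Q) ** (P ** M' ** Q) = P ** (M ** M') ** Q" for M M'
    proof -
      have "(P ** M ** Q) ** (P ** M' ** Q) = P ** M ** (Q ** P) ** M' ** Q"
        by (simp only: matrix_mul_assoc)
      then show ?thesis by (simp add: Q(2) matrix_mul_assoc)
    qed
    show "?c (mcomm A B) = mcomm (?c A) (?c B)"
      using tr AB B by (simp add: conj mcomm_so3 so3_rep_def)
        (simp only: mcomm_def PQ matrix_diff_ldistrib matrix_diff_rdistrib)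
  qed
  then show ?thesis
    unfolding so3_rep_iso_def using tr P(1) int by blast
qed

section \<open>Unitary matrices\<close>

lemma matrix_inv_eq:
  fixes A :: "complex^'n^'n"
  assumes "A ** B = mat 1" shows "matrix_inv A = B"
proof -
  have BA: "B ** A = mat 1" using assms matrix_left_right_inverse by blast
  have "A ** matrix_inv A = mat 1 \<and> matrix_inv A ** A = mat 1"
    unfolding matrix_inv_def by (rule someI_ex) (use assms BA in blast)
  then have "A ** matrix_inv A = mat 1" by blast
  have "matrix_inv A = (B ** A) ** matrix_inv A" by (simp add: BA)
  also have "\<dots> = B ** (A ** matrix_inv A)" by (simp only: matrix_mul_assoc)
  also have "\<dots> = B" by (simp add: \<open>A ** matrix_inv A = mat 1\<close>)
  finally show ?thesis .
qed

lemma unitary_swap: "cadjoint U ** U = mat 1 \<longleftrightarrow> U ** cadjoint U = mat 1"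
  for U :: "complex^'n^'n"
  using matrix_left_right_inverse[of U "cadjoint U"] by auto

lemma gauge_act_unitary: "cadjoint U ** U = mat 1 \<Longrightarrow> gauge_act U M = U ** M ** cadjoint U"
  unfolding gauge_act_def by (simp add: matrix_inv_eq unitary_swap)

lemma gauge_act_unitary_inv:
  assumes "cadjoint U ** U = mat 1" shows "gauge_act (matrix_inv U) M = cadjoint U ** M ** U"
proof -
  have "matrix_inv U = cadjoint U" using assms by (simp add: matrix_inv_eq unitary_swap)
  then show ?thesis using gauge_act_unitary[of "cadjoint U" M] assms by (simp add: unitary_swap)
qed

lemma det_cadjoint: "det (cadjoint U) = cnj (det U)"
proof -
  have "det (cadjoint U) = det (transpose (\<chi> i j. cnj (U $ i $ j)))"
    by (simp add: transpose_def cadjoint_def)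
  also have "\<dots> = det (\<chi> i j. cnj (U $ i $ j))" by (rule det_transpose)
  also have "\<dots> = cnj (det U)" by (simp add: det_def)
  finally show ?thesis .
qed

text \<open>Divide by a \<open>CARD('n)\<close>-th root of the determinant; a phase cancels in every
  conjugation, so unitary gauge transformations can always be moved into \<open>SU\<close>.\<close>

lemma unitary_rescale_SU:
  fixes U :: "complex^'n^'n"
  assumes "cadjoint U ** U = mat 1"
  obtains c where "cnj c * c = 1" "c *\<^sub>C U \<in> SU"
proof -
  have "cnj (det U) * det U = 1"
    using arg_cong[where f = det, OF assms] by (simp add: det_mul det_cadjoint)
  then have "complex_of_real ((cmod (det U))\<^sup>2) = 1"
    by (simp only: complex_norm_square mult.commute)
  then have "(cmod (det U))\<^sup>2 = 1" using of_real_eq_1_iff by blast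
  then have "cmod (det U) = 1" by (simp add: abs_square_eq_1)
  define c where "c = cis (- Arg (det U) / real CARD('n))"
  have "real CARD('n) * (- Arg (det U) / real CARD('n)) = - Arg (det U)" by simp
  then have "c ^ CARD('n) = cis (- Arg (det U))"
    unfolding c_def Complex.DeMoivre by (simp only:)
  moreover have "det U = cis (Arg (det U))"
    using \<open>cmod (det U) = 1\<close> by (metis rcis_cmod_Arg rcis_def mult_1 of_real_1)
  ultimately have cd: "c ^ CARD('n) * det U = 1" by (metis cis_mult add.left_inverse cis_zero)
  have cc: "cnj c * c = 1" by (simp add: c_def cis_cnj cis_mult)
  have "c *\<^sub>C U = mat c ** U" by (simp add: mat_cscale[of c])
  moreover have "det (mat c :: complex^'n^'n) = c ^ CARD('n)"
    by (subst det_diagonal) (auto simp: mat_def)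
  ultimately have "det (c *\<^sub>C U) = 1" using cd by (simp add: det_mul)
  moreover have "cadjoint (c *\<^sub>C U) ** (c *\<^sub>C U) = mat 1"
    using assms cc by (simp add: mult.commute)
  ultimately have "c *\<^sub>C U \<in> SU" by (simp add: SU_def)
  then show thesis using that cc by blast
qed

section \<open>Rotated triples\<close>

definition twist :: "real^3^3 \<Rightarrow> (3 \<Rightarrow> complex^'b^'a) \<Rightarrow> 3 \<Rightarrow> complex^'b^'a" where
  "twist A C i = (\<Sum>j\<in>UNIV. A $ i $ j *\<^sub>R C j)"

lemma SO3_transpose: "A \<in> SO3 \<Longrightarrow> transpose A \<in> SO3"
  by (simp add: SO3_def)

lemma SO3_columns:
  assumes "A \<in> SO3" shows "(\<Sum>l\<in>UNIV. A $ l $ j * A $ l $ k) = (if j = k then 1 else 0)"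
proof -
  have "transpose A ** A = mat 1" using assms by (simp add: SO3_def orthogonal_matrix_def)
  then have "(transpose A ** A) $ j $ k = mat 1 $ j $ k" by simp
  then show ?thesis by (simp add: matrix_mult_nth transpose_def mat_def)
qed

text \<open>A rotation respects cross products and so equals its own cofactor matrix. This is what
  makes rotated triples satisfy the same commutation relations.\<close>

lemma SO3_minor:
  assumes "A \<in> SO3" "cyc i j l" "cyc a b c"
  shows "A $ i $ a * A $ j $ b - A $ i $ b * A $ j $ a = A $ l $ c"
proof -
  have O: "orthogonal_matrix (transpose A)" "det (transpose A) = 1"
    using SO3_transpose[OF assms(1)] by (simp_all add: SO3_def)
  have row: "transpose A *v axis i 1 = A $ i" for i
    by (simp add: matrix_vector_mult_basis column_def transpose_def vec_eq_iff)
  have "cross3 (axis i 1) (axis j 1) = (axis l 1 :: real^3)"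
    by (cases rule: cyc_cases[OF assms(2)]) (simp_all add: cross_basis)
  then have "cross3 (A $ i) (A $ j) = A $ l"
    using cross_orthogonal_matrix[OF O(1), of "axis i 1" "axis j 1"]
    unfolding row O(2) by (simp only: row scaleR_one)
  then have "cross3 (A $ i) (A $ j) $ c = A $ l $ c" by simp
  moreover have "cross3 (A $ i) (A $ j) $ c = A $ i $ a * A $ j $ b - A $ i $ b * A $ j $ a"
    by (cases rule: cyc_cases[OF assms(3)]) (simp_all add: cross3_def)
  ultimately show ?thesis by simp
qed

lemma twist_transpose: "A \<in> SO3 \<Longrightarrow> twist (transpose A) (twist A C) = C"
proof (rule ext)
  fix i assume A: "A \<in> SO3"
  have "twist (transpose A) (twist A C) i = (\<Sum>l\<in>UNIV. \<Sum>k\<in>UNIV. (A $ l $ i * A $ l $ k) *\<^sub>R C k)"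
    by (simp add: twist_def transpose_def scaleR_sum_right)
  also have "\<dots> = (\<Sum>k\<in>UNIV. (\<Sum>l\<in>UNIV. A $ l $ i * A $ l $ k) *\<^sub>R C k)"
    by (subst sum.swap) (simp add: scaleR_sum_left)
  also have "\<dots> = C i" by (simp add: SO3_columns[OF A] if_distrib[of "\<lambda>x. x *\<^sub>R _"] cong: if_cong)
  finally show "twist (transpose A) (twist A C) i = C i" .
qed

lemma twist_transpose': "A \<in> SO3 \<Longrightarrow> twist A (twist (transpose A) C) = C"
  using twist_transpose[OF SO3_transpose] by simp

lemma twist_adjoint: "twist A (\<lambda>i. cadjoint (C i)) i = cadjoint (twist A C i)"
  by (simp add: twist_def scaleR_cscale cadjoint_sum)

lemma twist_tensor_op:
  assumes A: "A \<in> SO3" and t: "tensor_op Y Z C"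
  shows "tensor_op (twist A Y) (twist A Z) (twist A C)"
proof -
  have m: "complex_of_real (A $ l $ c) = of_real (A $ i $ a) * of_real (A $ j $ b) - of_real (A $ i $ b) * of_real (A $ j $ a)"
    if "cyc i j l" "cyc a b c" for i j l a b c
    using SO3_minor[OF A that] by (metis of_real_diff of_real_mult)
  have "twist A Y i ** twist A C i = twist A C i ** twist A Z i" for i
    by (simp add: twist_def sum_3 scaleR_cscale mat_distribs tensor_opD[OF t cyc_123(1)])
      (simp add: vec_eq_iff algebra_simps)
  moreover have "twist A Y i ** twist A C j = twist A C j ** twist A Z i + twist A C l \<and>
      twist A Y j ** twist A C i = twist A C i ** twist A Z j - twist A C l" if c: "cyc i j l" for i j l
    by (simp add: twist_def sum_3 scaleR_cscale mat_distribs tensor_opD[OF t cyc_123(1)]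
        m[OF c cyc_123(1)] m[OF c cyc_123(2)] m[OF c cyc_123(3)])
      (simp add: vec_eq_iff algebra_simps)
  ultimately show ?thesis by (simp add: tensor_op_def)
qed

lemma so3_triple_iff_tensor_op: "so3_triple Y \<longleftrightarrow> tensor_op Y Y Y \<and> (\<forall>i. cadjoint (Y i) = - Y i)"
proof
  assume "tensor_op Y Y Y \<and> (\<forall>i. cadjoint (Y i) = - Y i)"
  then show "so3_triple Y" using tensor_opD(4)[of Y Y Y] by (auto simp: so3_triple_def mcomm_def)
qed (auto simp: so3_triple_tensor_op so3_tripleD(1))

lemma twist_so3_triple:
  assumes "A \<in> SO3" "so3_triple Y" shows "so3_triple (twist A Y)"
proof -
  have "cadjoint (twist A Y i) = - twist A Y i" for i
    unfolding twist_adjoint[symmetric] by (simp add: so3_tripleD(1)[OF assms(2)] twist_def sum_negf)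
  then show ?thesis
    using twist_tensor_op[OF assms(1) so3_triple_tensor_op[OF assms(2)]]
    by (simp add: so3_triple_iff_tensor_op)
qed

lemma twist_vector_mem:
  assumes "vec.subspace S" "\<And>i. Y i *v v \<in> S" shows "twist A Y i *v v \<in> S"
proof -
  have "twist A Y i *v v = (\<Sum>j\<in>UNIV. complex_of_real (A $ i $ j) *s (Y j *v v))"
    by (simp add: twist_def sum_3 scaleR_cscale matrix_vector_mult_add_rdistrib cscale_vector)
  then show ?thesis using assms by (simp add: vec.subspace_sum vec.subspace_scale)
qed

lemma twist_irreducible:
  assumes "A \<in> SO3" "irreducible_triple Y" shows "irreducible_triple (twist A Y)"
  unfolding irreducible_triple_def
proof (intro allI impI)
  fix S assume S: "vec.subspace S \<and> (\<forall>i. \<forall>v\<in>S. twist A Y i *v v \<in> S)"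
  have "Y i *v v \<in> S" if "v \<in> S" for i v
  proof -
    have "twist (transpose A) (twist A Y) i *v v \<in> S"
      by (rule twist_vector_mem) (use S that in auto)
    then show ?thesis by (simp add: twist_transpose[OF assms(1)])
  qed
  then show "S = {0} \<or> S = UNIV" using assms(2) S unfolding irreducible_triple_def by blast
qed

lemma twist_dot_adjoint:
  assumes "A \<in> SO3"
  shows "(\<Sum>l\<in>UNIV. twist A C l ** cadjoint (twist A C l)) = (\<Sum>l\<in>UNIV. C l ** cadjoint (C l))"
proof -
  have "(\<Sum>l\<in>UNIV. twist A C l ** cadjoint (twist A C l))
      = (\<Sum>l\<in>UNIV. \<Sum>j\<in>UNIV. \<Sum>k\<in>UNIV. (A $ l $ j * A $ l $ k) *\<^sub>R (C j ** cadjoint (C k)))"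
    by (simp only: twist_def scaleR_cscale cadjoint_sum matrix_sum_left)
      (simp add: matrix_sum_right cscale_sum_right mult.commute)
  also have "\<dots> = (\<Sum>j\<in>UNIV. \<Sum>l\<in>UNIV. \<Sum>k\<in>UNIV. (A $ l $ j * A $ l $ k) *\<^sub>R (C j ** cadjoint (C k)))"
    by (rule sum.swap)
  also have "\<dots> = (\<Sum>j\<in>UNIV. \<Sum>k\<in>UNIV. (\<Sum>l\<in>UNIV. A $ l $ j * A $ l $ k) *\<^sub>R (C j ** cadjoint (C k)))"
    unfolding scaleR_sum_left by (intro sum.cong[OF refl] sum.swap)
  also have "\<dots> = (\<Sum>l\<in>UNIV. C l ** cadjoint (C l))"
    by (simp add: SO3_columns[OF assms] if_distrib[of "\<lambda>x. x *\<^sub>R _"] cong: if_cong)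
  finally show ?thesis .
qed

text \<open>The rotated triple is irreducible of the same dimension, so the isometric intertwiner
  with \<open>K = 0\<close> is square and hence unitary.\<close>

lemma twist_unitary_equiv:
  fixes Y :: "3 \<Rightarrow> complex^'m^'m"
  assumes "A \<in> SO3" "so3_triple Y" "irreducible_triple Y"
  obtains u where "cadjoint u ** u = mat 1" "\<And>i. twist A Y i = cadjoint u ** Y i ** u"
proof -
  have "\<exists>v. v \<noteq> 0 \<and> (0 :: complex^'m^'m) *v v = 0"
    by (intro exI[of _ "1"]) simp
  then obtain u where u: "\<And>i. Y i ** u = u ** twist A Y i" "cadjoint u ** u = mat 1"
    using isometric_intertwiner[OF assms(2) casimir_irreducible[OF assms(2,3)]
        twist_so3_triple[OF assms(1,2)] twist_irreducible[OF assms(1,3)], of "0 :: complex^'m^'m"]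
    by auto
  have "cadjoint u ** Y i ** u = (cadjoint u ** u) ** twist A Y i" for i
    by (simp only: matrix_mul_assoc[symmetric] u(1))
  then show thesis using that[of u] u(2) by simp
qed

context nahm_pair
begin

text \<open>The unitaries \<open>u\<close> and \<open>v\<close> rotate the diagonal blocks. Then
  \<open>F\<close> is a vector operator for the rotated generators, hence \<open>s\<close> times the
  rotated \<open>B\<close>, and the normalisation gives \<open>s\<close> modulus 1. Putting
  \<open>cnj s\<close> into the second block removes it. The resulting \<open>U\<close> is
  independent of \<open>a\<close>, \<open>b\<close>, \<open>g\<close>, so one \<open>U\<close> works
  at all times.\<close>

lemma R_spherically_symmetric:
  assumes A: "A \<in> SO3"
  obtains U where "U \<in> SU" "\<And>a b g i. twist A (R a b g) i = cadjoint U ** R a b g i ** U"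
proof -
  obtain u where u: "cadjoint u ** u = mat 1" "\<And>i. twist A Y i = cadjoint u ** Y i ** u"
    using twist_unitary_equiv[OF A Y] by blast
  obtain v where v: "cadjoint v ** v = mat 1" "\<And>i. twist A Z i = cadjoint v ** Z i ** v"
    using twist_unitary_equiv[OF A Z] by blast
  have u': "u ** cadjoint u = mat 1" and v': "v ** cadjoint v = mat 1"
    using u(1) v(1) unitary_swap by blast+
  define F where "F i = cadjoint u ** B i ** v" for i
  have l: "(cadjoint u ** Y i ** u) ** F j = cadjoint u ** (Y i ** B j) ** v" for i j
  proof -
    have "(cadjoint u ** Y i ** u) ** F j = cadjoint u ** Y i ** (u ** cadjoint u) ** B j ** v"
      by (simp only: F_def matrix_mul_assoc)
    then show ?thesis by (simp add: u' matrix_mul_assoc)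
  qed
  have r: "F j ** (cadjoint v ** Z i ** v) = cadjoint u ** (B j ** Z i) ** v" for i j
  proof -
    have "F j ** (cadjoint v ** Z i ** v) = cadjoint u ** B j ** (v ** cadjoint v) ** Z i ** v"
      by (simp only: F_def matrix_mul_assoc)
    then show ?thesis by (simp add: v' matrix_mul_assoc)
  qed
  have "tensor_op (twist A Y) (twist A Z) F"
    unfolding tensor_op_def u(2) v(2) l r
    using B by (auto simp: tensor_op_def F_def mat_distribs)
  from twist_tensor_op[OF SO3_transpose[OF A] this]
  have "tensor_op Y Z (twist (transpose A) F)" by (simp add: twist_transpose[OF A])
  then obtain s where s: "\<And>i. twist (transpose A) F i = s *\<^sub>C B i" using B_unique by blast
  have F: "F i = s *\<^sub>C twist A B i" for i
  proof -
    have "F i = twist A (twist (transpose A) F) i" by (simp add: twist_transpose'[OF A])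
    also have "twist (transpose A) F = (\<lambda>i. s *\<^sub>C B i)" using s by auto
    finally show ?thesis by (simp add: twist_def scaleR_cscale cscale_sum_right mult.commute)
  qed
  have "(\<Sum>l\<in>UNIV. F l ** cadjoint (F l)) = cadjoint u ** (\<Sum>l\<in>UNIV. B l ** D l) ** u"
  proof -
    have "F l ** cadjoint (F l) = cadjoint u ** (B l ** D l) ** u" for l
    proof -
      have "F l ** cadjoint (F l) = cadjoint u ** B l ** (v ** cadjoint v) ** D l ** u"
        by (simp only: F_def cadjoint_mult cadjoint_cadjoint matrix_mul_assoc)
      then show ?thesis by (simp add: v' matrix_mul_assoc)
    qed
    then show ?thesis by (simp add: matrix_sum_left matrix_sum_right)
  qed
  then have "(\<Sum>l\<in>UNIV. F l ** cadjoint (F l)) = mat 1" by (simp add: norm u(1))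
  moreover have "(\<Sum>l\<in>UNIV. F l ** cadjoint (F l)) = (s * cnj s) *\<^sub>C mat 1"
  proof -
    have "(\<Sum>l\<in>UNIV. F l ** cadjoint (F l)) = (s * cnj s) *\<^sub>C (\<Sum>l\<in>UNIV. twist A B l ** cadjoint (twist A B l))"
      by (simp add: F cscale_sum_right mult.commute)
    then show ?thesis by (simp only: twist_dot_adjoint[OF A] norm)
  qed
  ultimately have "(s * cnj s) *\<^sub>C (mat 1 :: complex^'p^'p) = 1 *\<^sub>C mat 1" by simp
  then have ss: "s * cnj s = 1" using cscale_eq_iff_of_nonzero mat_one_neq_zero by blast
  then have ss': "cnj s * s = 1" by (simp add: mult.commute)
  define U0 where "U0 = block_mat u 0 0 (cnj s *\<^sub>C v)"
  have U0: "cadjoint U0 ** U0 = mat 1"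
    using u(1) v(1) ss ss'
    by (simp add: U0_def cadjoint_block_mat block_mat_mult block_mat_one block_mat_linear block_mat_eq_iff)
  have tw: "twist A (R a b g) i = cadjoint U0 ** R a b g i ** U0" for a b g i
  proof -
    have "twist A (R a b g) i = block_mat (of_real a *\<^sub>C twist A Y i) (of_real g *\<^sub>C twist A B i)
        (- (of_real g *\<^sub>C cadjoint (twist A B i))) (of_real b *\<^sub>C twist A Z i)"
      unfolding twist_adjoint[symmetric]
      by (simp add: twist_def sum_3 R_def scaleR_cscale block_mat_linear block_mat_eq_iff cscale_add_right mult_ac)
    moreover have "cnj s *\<^sub>C (cadjoint u ** B i ** v) = twist A B i"
      using F[of i] ss' by (simp add: F_def)
    moreover have "s *\<^sub>C (cadjoint v ** D i ** u) = cadjoint (twist A B i)"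
      unfolding calculation(2)[symmetric] by (simp add: matrix_mul_assoc)
    moreover have "cadjoint U0 ** R a b g i ** U0 = block_mat (of_real a *\<^sub>C (cadjoint u ** Y i ** u))
        (of_real g *\<^sub>C cnj s *\<^sub>C (cadjoint u ** B i ** v))
        (- (of_real g *\<^sub>C s *\<^sub>C (cadjoint v ** D i ** u))) (of_real b *\<^sub>C (cadjoint v ** Z i ** v))"
      using ss' by (simp add: U0_def cadjoint_block_mat block_mat_mult R_def block_mat_eq_iff)
        (simp add: vec_eq_iff mult_ac)
    ultimately show ?thesis by (simp only: u(2) v(2))
  qed
  obtain c where c: "cnj c * c = 1" "c *\<^sub>C U0 \<in> SU" using unitary_rescale_SU[OF U0] by blast
  have "cadjoint (c *\<^sub>C U0) ** M ** (c *\<^sub>C U0) = cadjoint U0 ** M ** U0" for M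
    using c(1) by (simp add: mult.commute)
  then show thesis using that[OF c(2)] tw by simp
qed

end

section \<open>Differential equations and analyticity\<close>

text \<open>Gronwall's argument: with a bound \<open>L\<close> for the modulus of \<open>h\<close>
  on the segment, the square of \<open>y\<close> times \<open>exp (- 2 * L * t)\<close> cannot
  increase after \<open>t0\<close>, and times \<open>exp (2 * L * t)\<close> it cannot decrease
  before \<open>t0\<close>.\<close>

lemma linear_ode_zero:
  fixes y h :: "real \<Rightarrow> real"
  assumes I: "is_interval I" and h: "continuous_on I h"
    and y: "\<And>t. t \<in> I \<Longrightarrow> (y has_real_derivative h t * y t) (at t)"
    and t0: "t0 \<in> I" "y t0 = 0" and t: "t \<in> I"
  shows "y t = 0"
proof -
  define a b where "a = min t0 t" and "b = max t0 t"
  have ab: "a \<le> b" "a \<in> I" "b \<in> I" using t0(1) t by (auto simp: a_def b_def min_def max_def)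
  have sub: "{a..b} \<subseteq> I" using I ab unfolding is_interval_1 by (meson atLeastAtMost_iff subsetI)
  have "compact (h ` {a..b})"
    by (intro compact_continuous_image continuous_on_subset[OF h sub]) auto
  then have "bounded (h ` {a..b})" by (rule compact_imp_bounded)
  then obtain L where "\<forall>z\<in>h ` {a..b}. norm z \<le> L" unfolding bounded_iff by blast
  then have L: "\<bar>h s\<bar> \<le> L" if "s \<in> {a..b}" for s using that by simp
  have der: "((\<lambda>s. (y s)\<^sup>2 * exp (c * s)) has_real_derivative (2 * h s + c) * ((y s)\<^sup>2 * exp (c * s))) (at s)"
    if "s \<in> {a..b}" for s c
  proof -
    have dy: "(y has_real_derivative h s * y s) (at s)" by (rule y[OF subsetD[OF sub that]])
    have de: "((\<lambda>s. exp (c * s)) has_real_derivative exp (c * s) * c) (at s)"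
      by (rule DERIV_fun_exp[OF DERIV_cmult_Id])
    show ?thesis
      using DERIV_mult[OF DERIV_mult[OF dy dy] de] by (simp add: power2_eq_square algebra_simps)
  qed
  show ?thesis
  proof (cases "t0 \<le> t")
    case True
    have "(y t)\<^sup>2 * exp (- 2 * L * t) \<le> (y t0)\<^sup>2 * exp (- 2 * L * t0)"
    proof (rule DERIV_nonpos_imp_nonincreasing[OF True])
      fix s assume "t0 \<le> s" "s \<le> t"
      then have s: "s \<in> {a..b}" using True by (simp add: a_def b_def)
      have "(2 * h s + - 2 * L) * ((y s)\<^sup>2 * exp (- 2 * L * s)) \<le> 0"
        using L[OF s] by (intro mult_nonpos_nonneg) auto
      then show "\<exists>z. ((\<lambda>s. (y s)\<^sup>2 * exp (- 2 * L * s)) has_real_derivative z) (at s) \<and> z \<le> 0"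
        using der[OF s, of "- 2 * L"] by blast
    qed
    then show ?thesis using t0(2) by (simp add: mult_le_0_iff)
  next
    case False
    then have le: "t \<le> t0" by simp
    have "(y t)\<^sup>2 * exp (2 * L * t) \<le> (y t0)\<^sup>2 * exp (2 * L * t0)"
    proof (rule DERIV_nonneg_imp_nondecreasing[OF le])
      fix s assume "t \<le> s" "s \<le> t0"
      then have s: "s \<in> {a..b}" using le by (simp add: a_def b_def)
      have "0 \<le> (2 * h s + 2 * L) * ((y s)\<^sup>2 * exp (2 * L * s))"
        using L[OF s] by (intro mult_nonneg_nonneg) auto
      then show "\<exists>z. ((\<lambda>s. (y s)\<^sup>2 * exp (2 * L * s)) has_real_derivative z) (at s) \<and> 0 \<le> z"
        using der[OF s, of "2 * L"] by blast
    qed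
    then show ?thesis using t0(2) by (simp add: mult_le_0_iff)
  qed
qed

text \<open>
  Taylor coefficients of the solution of \<open>x' = Q x x\<close> with \<open>x = v\<close> at the base point.
\<close>

fun quad_coeff :: "('a \<Rightarrow> 'a \<Rightarrow> 'a) \<Rightarrow> 'a \<Rightarrow> nat \<Rightarrow> 'a::real_vector" where
  "quad_coeff Q v 0 = v"
| "quad_coeff Q v (Suc k) = (1 / real (Suc k)) *\<^sub>R (\<Sum>i\<le>k. Q (quad_coeff Q v i) (quad_coeff Q v (k - i)))"

text \<open>Each summand of the Cauchy product obeys the bound, and the prefactor cancels the number
  of summands.\<close>

lemma quad_coeff_bound:
  fixes v :: "'a::real_normed_vector"
  assumes Q: "\<And>a b. norm (Q a b) \<le> norm a * norm b * C" and "C \<ge> 0" and v: "norm v \<le> M"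
  shows "norm (quad_coeff Q v k) \<le> C ^ k * M ^ Suc k"
proof (induction k rule: less_induct)
  case (less k)
  show ?case
  proof (cases k)
    case 0
    then show ?thesis using v by simp
  next
    case (Suc m)
    have M: "M \<ge> 0" using v norm_ge_zero order_trans by blast
    have "norm (Q (quad_coeff Q v i) (quad_coeff Q v (m - i))) \<le> C ^ Suc m * M ^ Suc (Suc m)" if "i \<le> m" for i
    proof -
      have "norm (Q (quad_coeff Q v i) (quad_coeff Q v (m - i)))
          \<le> norm (quad_coeff Q v i) * norm (quad_coeff Q v (m - i)) * C" by (rule Q)
      also have "\<dots> \<le> (C ^ i * M ^ Suc i) * (C ^ (m - i) * M ^ Suc (m - i)) * C"
        using less[of i] less[of "m - i"] that Suc assms(2) M
        by (intro mult_right_mono mult_mono) auto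
      also have "\<dots> = C ^ Suc (i + (m - i)) * M ^ Suc (Suc (i + (m - i)))"
        by (simp add: power_add mult_ac)
      finally show ?thesis using that by simp
    qed
    then have "norm (\<Sum>i\<le>m. Q (quad_coeff Q v i) (quad_coeff Q v (m - i))) \<le> (\<Sum>i\<le>m. C ^ Suc m * M ^ Suc (Suc m))"
      by (intro order_trans[OF norm_sum] sum_mono) auto
    then have "norm (\<Sum>i\<le>m. Q (quad_coeff Q v i) (quad_coeff Q v (m - i))) / real (Suc m) \<le> C ^ Suc m * M ^ Suc (Suc m)"
      by (simp add: divide_le_eq mult.commute)
    then show ?thesis unfolding Suc by (simp add: divide_inverse mult.commute)
  qed
qed

text \<open>This makes \<open>fact k\<close> times the coefficient the \<open>k\<close>-th
  derivative of the solution. By the product rule the term \<open>Q u_i u_(m+1-i)\<close> occurs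
  with weights \<open>m+1-i\<close> and \<open>i\<close>, whose sum does not depend on
  \<open>i\<close>.\<close>

lemma quad_coeff_deriv:
  fixes x :: "real \<Rightarrow> 'a::real_normed_vector"
  assumes Q: "bounded_bilinear Q" and x: "(x has_vector_derivative Q (x t) (x t)) (at t)"
  shows "((\<lambda>s. quad_coeff Q (x s) k) has_vector_derivative real (Suc k) *\<^sub>R quad_coeff Q (x t) (Suc k)) (at t)"
proof (induction k rule: less_induct)
  case (less k)
  interpret Q: bounded_bilinear Q by (rule Q)
  show ?case
  proof (cases k)
    case 0
    then show ?thesis using x by simp
  next
    case (Suc m)
    let ?u = "\<lambda>i. quad_coeff Q (x t) i"
    let ?q = "\<lambda>i. Q (?u i) (?u (Suc m - i))"
    have "((\<lambda>s. \<Sum>i\<le>m. Q (quad_coeff Q (x s) i) (quad_coeff Q (x s) (m - i))) has_vector_derivative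
        (\<Sum>i\<le>m. Q (?u i) (real (Suc (m - i)) *\<^sub>R ?u (Suc (m - i))) + Q (real (Suc i) *\<^sub>R ?u (Suc i)) (?u (m - i)))) (at t)"
      by (intro has_vector_derivative_sum Q.has_vector_derivative less) (auto simp: Suc)
    then have "((\<lambda>s. (1 / real (Suc m)) *\<^sub>R (\<Sum>i\<le>m. Q (quad_coeff Q (x s) i) (quad_coeff Q (x s) (m - i))))
      has_vector_derivative (1 / real (Suc m)) *\<^sub>R
        (\<Sum>i\<le>m. Q (?u i) (real (Suc (m - i)) *\<^sub>R ?u (Suc (m - i))) + Q (real (Suc i) *\<^sub>R ?u (Suc i)) (?u (m - i)))) (at t)"
      by (rule bounded_linear.has_vector_derivative[OF bounded_linear_scaleR_right])
    moreover have "(\<Sum>i\<le>m. Q (?u i) (real (Suc (m - i)) *\<^sub>R ?u (Suc (m - i))) + Q (real (Suc i) *\<^sub>R ?u (Suc i)) (?u (m - i)))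
        = real (Suc m) *\<^sub>R (\<Sum>i\<le>Suc m. ?q i)"
    proof -
      have "(\<Sum>i\<le>m. Q (?u i) (real (Suc (m - i)) *\<^sub>R ?u (Suc (m - i))))
          = (\<Sum>i\<le>m. real (Suc m - i) *\<^sub>R ?q i)"
        by (intro sum.cong) (auto simp: Q.scaleR_right Suc_diff_le)
      also have "\<dots> = (\<Sum>i\<le>Suc m. real (Suc m - i) *\<^sub>R ?q i)" by simp
      finally have 1: "(\<Sum>i\<le>m. Q (?u i) (real (Suc (m - i)) *\<^sub>R ?u (Suc (m - i))))
          = (\<Sum>i\<le>Suc m. real (Suc m - i) *\<^sub>R ?q i)" .
      have "(\<Sum>i\<le>m. Q (real (Suc i) *\<^sub>R ?u (Suc i)) (?u (m - i))) = (\<Sum>i\<le>m. real (Suc i) *\<^sub>R ?q (Suc i))"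
        by (simp only: Q.scaleR_left diff_Suc_Suc)
      also have "\<dots> = (\<Sum>i\<le>Suc m. real i *\<^sub>R ?q i)" by (subst sum.atMost_Suc_shift) simp
      finally have 2: "(\<Sum>i\<le>m. Q (real (Suc i) *\<^sub>R ?u (Suc i)) (?u (m - i))) = (\<Sum>i\<le>Suc m. real i *\<^sub>R ?q i)" .
      have "(\<Sum>i\<le>Suc m. real (Suc m - i) *\<^sub>R ?q i) + (\<Sum>i\<le>Suc m. real i *\<^sub>R ?q i)
          = (\<Sum>i\<le>Suc m. real (Suc m) *\<^sub>R ?q i)"
        unfolding sum.distrib[symmetric]
        by (intro sum.cong refl) (simp only: scaleR_add_left[symmetric] of_nat_add[symmetric] atMost_iff le_add_diff_inverse2)
      then show ?thesis by (simp only: sum.distrib 1 2 scaleR_sum_right)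
    qed
    moreover have "real (Suc k) *\<^sub>R quad_coeff Q (x t) (Suc k) = (\<Sum>i\<le>Suc m. ?q i)"
      unfolding Suc by (simp del: sum.atMost_Suc)
    ultimately show ?thesis unfolding Suc by simp
  qed
qed

text \<open>The Lagrange remainder is a coefficient at an intermediate time, so the uniform bound on
  a compact ball makes it at most \<open>M * K\<close> times the \<open>k\<close>-th power of
  \<open>C * M * \<bar>s - c\<bar>\<close>. The functional \<open>L\<close> makes the function
  real-valued, as that form of the remainder requires.\<close>

lemma quadratic_ode_analytic:
  fixes x :: "real \<Rightarrow> 'a::real_normed_vector" and L :: "'a \<Rightarrow> real"
  assumes Q: "bounded_bilinear Q" and L: "bounded_linear L" and I: "open I"
    and x: "\<And>t. t \<in> I \<Longrightarrow> (x has_vector_derivative Q (x t) (x t)) (at t)"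
  shows "real_analytic_on (\<lambda>t. L (x t)) I"
  unfolding real_analytic_on_def
proof
  fix c assume c: "c \<in> I"
  obtain e where e: "e > 0" "cball c e \<subseteq> I" using I c open_contains_cball by blast
  obtain C where C: "C > 0" "\<And>a b. norm (Q a b) \<le> norm a * norm b * C"
    using bounded_bilinear.pos_bounded[OF Q] by blast
  obtain K where K: "K > 0" "\<And>v. norm (L v) \<le> norm v * K"
    using bounded_linear.pos_bounded[OF L] by blast
  have "continuous_on I x"
    using x by (intro continuous_at_imp_continuous_on ballI has_vector_derivative_continuous) blast
  then have "compact (x ` cball c e)"
    by (intro compact_continuous_image) (auto intro: continuous_on_subset[OF _ e(2)])
  then have "bounded (x ` cball c e)" by (rule compact_imp_bounded)
  then obtain M where "M > 0" "\<forall>z\<in>x ` cball c e. norm z \<le> M" unfolding bounded_pos by blast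
  then have M: "M > 0" "\<And>s. s \<in> cball c e \<Longrightarrow> norm (x s) \<le> M" by simp_all
  define \<delta> where "\<delta> = min e (1 / (C * M))"
  define diff where "diff m t = fact m * L (quad_coeff Q (x t) m)" for m t
  have ball: "s \<in> I" "norm (x s) \<le> M" if "\<bar>s - c\<bar> \<le> e" for s
    using that e(2) M(2)[of s] by (auto simp: dist_real_def abs_minus_commute subset_iff)
  have der: "(diff m has_real_derivative diff (Suc m) t) (at t)" if "t \<in> I" for m t
  proof -
    have "((\<lambda>s. L (quad_coeff Q (x s) m)) has_vector_derivative
        L (real (Suc m) *\<^sub>R quad_coeff Q (x t) (Suc m))) (at t)"
      by (rule bounded_linear.has_vector_derivative[OF L quad_coeff_deriv[OF Q x[OF that]]])
    then have "((\<lambda>s. L (quad_coeff Q (x s) m)) has_real_derivative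
        real (Suc m) * L (quad_coeff Q (x t) (Suc m))) (at t)"
      unfolding has_real_derivative_iff_has_vector_derivative
      by (simp only: linear_cmul[OF bounded_linear.linear[OF L]] real_scaleR_def)
    from DERIV_cmult[OF this, of "fact m"] show ?thesis
      unfolding diff_def by (simp only: fact_Suc mult_ac)
  qed
  have "(\<lambda>k. L (quad_coeff Q (x c) k) * (s - c) ^ k) sums L (x s)" if s: "\<bar>s - c\<bar> < \<delta>" for s
  proof (cases "s = c")
    case True
    then show ?thesis using powser_sums_zero[of "\<lambda>k. L (quad_coeff Q (x c) k)"] by simp
  next
    case False
    have se: "\<bar>s - c\<bar> < e" and r1: "C * M * \<bar>s - c\<bar> < 1"
      using s C(1) M(1) by (auto simp: \<delta>_def field_simps)
    define r where "r = C * M * \<bar>s - c\<bar>"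
    have r: "0 \<le> r" "r < 1" using r1 C(1) M(1) by (auto simp: r_def)
    have bnd: "\<bar>L (x s) - (\<Sum>m<k. L (quad_coeff Q (x c) m) * (s - c) ^ m)\<bar> \<le> (M * K) * r ^ k" if "k > 0" for k
    proof -
      have "\<exists>t. (if s < c then s < t \<and> t < c else c < t \<and> t < s) \<and>
          L (x s) = (\<Sum>m<k. diff m c / fact m * (s - c) ^ m) + diff k t / fact k * (s - c) ^ k"
      proof (rule Taylor[OF \<open>k > 0\<close>, of diff "\<lambda>t. L (x t)" "c - e" "c + e"])
        show "diff 0 = (\<lambda>t. L (x t))" by (simp add: diff_def fun_eq_iff)
        show "\<forall>m t. m < k \<and> c - e \<le> t \<and> t \<le> c + e \<longrightarrow> (diff m has_real_derivative diff (Suc m) t) (at t)"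
          using der ball(1) by (auto simp: abs_le_iff)
      qed (use se e(1) False in auto)
      then obtain t where t: "if s < c then s < t \<and> t < c else c < t \<and> t < s"
        and eq: "L (x s) = (\<Sum>m<k. diff m c / fact m * (s - c) ^ m) + diff k t / fact k * (s - c) ^ k"
        by blast
      have "\<bar>t - c\<bar> \<le> e" using t se by (auto split: if_splits)
      then have "norm (quad_coeff Q (x t) k) \<le> C ^ k * M ^ Suc k"
        using quad_coeff_bound[of Q C "x t" M k] C ball(2) by simp
      then have "\<bar>L (quad_coeff Q (x t) k)\<bar> \<le> C ^ k * M ^ Suc k * K"
        using K(2)[of "quad_coeff Q (x t) k"] K(1) by (smt (verit) mult_right_mono real_norm_def)
      then have "\<bar>L (quad_coeff Q (x t) k)\<bar> * \<bar>s - c\<bar> ^ k \<le> (C ^ k * M ^ Suc k * K) * \<bar>s - c\<bar> ^ k"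
        by (intro mult_right_mono) auto
      also have "\<dots> = (M * K) * r ^ k" by (simp add: r_def power_mult_distrib)
      finally show ?thesis unfolding eq by (simp add: diff_def abs_mult power_abs)
    qed
    have "(\<lambda>k. (M * K) * r ^ k) \<longlonglongrightarrow> (M * K) * 0"
      using r by (intro tendsto_mult tendsto_const LIMSEQ_power_zero) auto
    moreover have "\<forall>\<^sub>F k in sequentially.
        norm (L (x s) - (\<Sum>m<k. L (quad_coeff Q (x c) m) * (s - c) ^ m)) \<le> (M * K) * r ^ k"
      by (rule eventually_sequentiallyI[of 1]) (use bnd in auto)
    ultimately have "(\<lambda>k. L (x s) - (\<Sum>m<k. L (quad_coeff Q (x c) m) * (s - c) ^ m)) \<longlonglongrightarrow> 0"
      by (auto intro: Lim_null_comparison)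
    then have "(\<lambda>k. L (x s) - (L (x s) - (\<Sum>m<k. L (quad_coeff Q (x c) m) * (s - c) ^ m))) \<longlonglongrightarrow> L (x s) - 0"
      by (intro tendsto_diff tendsto_const)
    then show ?thesis by (simp add: sums_def)
  qed
  moreover have "\<delta> > 0" using e(1) C(1) M(1) by (simp add: \<delta>_def)
  ultimately show "\<exists>\<delta>>0. \<exists>a. \<forall>s\<in>I. \<bar>s - c\<bar> < \<delta> \<longrightarrow> (\<lambda>k. a k * (s - c) ^ k) sums L (x s)"
    by (intro exI[of _ \<delta>] conjI exI[of _ "\<lambda>k. L (quad_coeff Q (x c) k)"]) auto
qed

lemma reduced_solution_analytic:
  assumes I: "open I" and s: "reduced_solution n I fp fm g"
  shows "real_analytic_on fp I" "real_analytic_on fm I" "real_analytic_on g I"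
proof -
  define k1 k2 c1 c2 where "k1 = 2 / (real n + 1)" and "k2 = 2 * (real n + 2) / (real n * (real n + 1))"
    and "c1 = (real n + 3) / 2" and "c2 = (real n - 1) / 2"
  \<comment> \<open>Any bilinear map with the right-hand side of the system on its diagonal will do;
    this one is not symmetric.\<close>
  define Q :: "real \<times> real \<times> real \<Rightarrow> real \<times> real \<times> real \<Rightarrow> real \<times> real \<times> real" where
    "Q v w = (fst v * fst w + k1 * (snd (snd v) * snd (snd w)),
       fst (snd v) * fst (snd w) - k2 * (snd (snd v) * snd (snd w)),
       (c1 * fst v - c2 * fst (snd v)) * snd (snd w))" for v w
  have "bilinear Q"
    unfolding bilinear_def by (auto intro!: linearI simp: Q_def algebra_simps)
  then have Q: "bounded_bilinear Q" by (simp only: bilinear_conv_bounded_bilinear)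
  define x where "x t = (fp t, fm t, g t)" for t
  have x: "(x has_vector_derivative Q (x t) (x t)) (at t)" if "t \<in> I" for t
    using s that unfolding reduced_solution_def x_def k1_def[symmetric] k2_def[symmetric]
      c1_def[symmetric] c2_def[symmetric]
    by (auto simp: Q_def power2_eq_square has_real_derivative_iff_has_vector_derivative mult.assoc
        intro!: has_vector_derivative_Pair)
  have an: "real_analytic_on (\<lambda>t. L (x t)) I" if "bounded_linear L" for L
    by (rule quadratic_ode_analytic[OF Q that I x])
  show "real_analytic_on fp I" using an[OF bounded_linear_fst] by (simp add: x_def)
  show "real_analytic_on fm I"
    using an[OF bounded_linear_compose[OF bounded_linear_fst bounded_linear_snd]] by (simp add: x_def)
  show "real_analytic_on g I"
    using an[OF bounded_linear_compose[OF bounded_linear_snd bounded_linear_snd]] by (simp add: x_def)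
qed

section \<open>The explicit solution\<close>

text \<open>With \<open>x = t - p\<close> and \<open>d = p - q\<close>, the product of
  \<open>x\<close> with \<open>h t\<close> is \<open>R\<close> plus \<open>x / (x + d)\<close> times
  \<open>R'\<close>; the latter factor is a geometric series in \<open>- x / d\<close> without
  constant term.\<close>

lemma has_simple_pole_residue_sum:
  fixes R R' :: "'a::real_normed_vector"
  assumes "p islimpt I" "p \<notin> I" "R \<noteq> 0" and pq: "p \<noteq> q"
    and h: "\<And>t. t \<in> I \<Longrightarrow> h t = (1 / (t - p)) *\<^sub>R R + (1 / (t - q)) *\<^sub>R R'"
  shows "has_simple_pole_residue h I p R"
proof -
  define d where "d = p - q"
  have d: "d \<noteq> 0" using pq by (simp add: d_def)
  define a where "a k = (if k = 0 then R else 0) + ((if k = 0 then 1 else 0) - (- 1 / d) ^ k) *\<^sub>R R'" for k :: nat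
  have "(\<lambda>k. (t - p) ^ k *\<^sub>R a k) sums ((t - p) *\<^sub>R h t)" if t: "t \<in> I" "\<bar>t - p\<bar> < \<bar>d\<bar>" for t
  proof -
    define x where "x = t - p"
    have x: "x \<noteq> 0" using assms(2) t(1) by (auto simp: x_def)
    have xd: "x + d \<noteq> 0" "\<bar>- x / d\<bar> < 1" using t(2) d by (auto simp: x_def field_simps)
    have "(\<lambda>k. (- x / d) ^ k) sums (1 / (1 - (- x / d)))"
      using xd(2) by (intro geometric_sums) simp
    moreover have "(\<lambda>k. if k = 0 then 1 else 0 :: real) sums 1" by (rule sums_single)
    ultimately have "(\<lambda>k. (if k = 0 then 1 else 0) - (- x / d) ^ k) sums (1 - 1 / (1 - (- x / d)))"
      by (rule sums_diff[rotated])
    moreover have "1 - 1 / (1 - (- x / d)) = x / (x + d)" using d xd(1) by (simp add: field_simps)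
    ultimately have "(\<lambda>k. ((if k = 0 then 1 else 0) - (- x / d) ^ k) *\<^sub>R R') sums ((x / (x + d)) *\<^sub>R R')"
      by (intro bounded_linear.sums[OF bounded_linear_scaleR_left]) simp
    moreover have "(\<lambda>k. if k = 0 then R else 0) sums R" by (rule sums_single)
    ultimately have "(\<lambda>k. (if k = 0 then R else 0) + ((if k = 0 then 1 else 0) - (- x / d) ^ k) *\<^sub>R R')
        sums (R + (x / (x + d)) *\<^sub>R R')" by (rule sums_add[rotated])
    moreover have "(if k = 0 then R else 0) + ((if k = 0 then 1 else 0) - (- x / d) ^ k) *\<^sub>R R' = x ^ k *\<^sub>R a k" for k
    proof -
      have "(- x / d) ^ k = x ^ k * (- 1 / d) ^ k" by (simp flip: power_mult_distrib)
      then show ?thesis by (cases "k = 0") (simp_all add: a_def algebra_simps)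
    qed
    moreover have "R + (x / (x + d)) *\<^sub>R R' = x *\<^sub>R h t"
      using x unfolding h[OF t(1)] by (simp add: x_def d_def scaleR_add_right)
    ultimately show ?thesis by (simp add: x_def)
  qed
  moreover have "a 0 = R" by (simp add: a_def)
  moreover have "\<bar>d\<bar> > 0" using d by simp
  ultimately show ?thesis
    using assms(1-3) unfolding has_simple_pole_residue_def by blast
qed

text \<open>Half of the constant in \<open>g_sol\<close>, the modulus of its residue at either
  end.\<close>

definition g_res :: "nat \<Rightarrow> real" where
  "g_res n = sqrt (real n / (2 * (real n + 1)))"

lemma g_res_sq: "(g_res n)\<^sup>2 = real n / (2 * (real n + 1))"
  by (simp add: g_res_def)

lemma sol_partial_fractions:
  assumes "t\<^sup>2 \<noteq> 1"
  shows "fp_sol n t = (1 / (t - 1)) * (- real n / (real n + 1)) + (1 / (t + 1)) * (- 1 / (real n + 1))" (is ?fp)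
    and "fm_sol n t = (1 / (t - 1)) * (- (real n + 2) / (real n + 1)) + (1 / (t + 1)) * (1 / (real n + 1))" (is ?fm)
    and "g_sol n t = (1 / (t - 1)) * g_res n + (1 / (t + 1)) * (- g_res n)" (is ?g)
proof -
  have n: "real n + 1 \<noteq> 0" by linarith
  have t: "t - 1 \<noteq> 0" "t + 1 \<noteq> 0" using assms by (auto simp: power2_eq_square add_eq_0_iff)
  have f: "t\<^sup>2 - 1 = (t - 1) * (t + 1)" by (simp add: power2_eq_square algebra_simps)
  show ?fp
    unfolding fp_sol_def f using n t by (simp add: divide_simps) (simp add: algebra_simps)
  show ?fm
    unfolding fm_sol_def f using n t by (simp add: divide_simps) (simp add: algebra_simps)
  have "2 * real n / (real n + 1) = 4 * (real n / (2 * (real n + 1)))"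
    using n by (simp add: divide_simps)
  then have "sqrt (2 * real n / (real n + 1)) = sqrt (4 * (real n / (2 * (real n + 1))))"
    by (simp only:)
  also have "\<dots> = 2 * g_res n" by (simp only: real_sqrt_mult g_res_def) simp
  finally have s: "sqrt (2 * real n / (real n + 1)) = 2 * g_res n" .
  show ?g
    unfolding g_sol_def f s using t by (simp add: divide_simps) (simp add: algebra_simps)
qed

lemma sol_reduced_solution:
  assumes "n \<ge> 2"
  shows "reduced_solution n {-1<..<1} (fp_sol n) (fm_sol n) (g_sol n)"
  unfolding reduced_solution_def
proof
  fix t :: real assume t: "t \<in> {-1<..<1}"
  \<comment> \<open>The three functions are linear in \<open>X\<close> and \<open>Y\<close>, whose
    derivatives are minus their squares, so the system becomes polynomial identities in
    \<open>X\<close> and \<open>Y\<close>.\<close>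
  define X Y where "X = 1 / (t - 1)" and "Y = 1 / (t + 1)"
  define q where "q = g_res n"
  define m where "m = real n"
  have m: "m \<noteq> 0" "m + 1 \<noteq> 0" using assms by (auto simp: m_def)
  have q: "q * q = m / (2 * (m + 1))" using g_res_sq[of n] by (simp add: q_def m_def power2_eq_square)
  have ne: "s\<^sup>2 \<noteq> 1" if "s \<in> {-1<..<1}" for s :: real
    using that abs_square_eq_1[of s] by auto
  have der: "((\<lambda>s. (1 / (s - 1)) * a + (1 / (s + 1)) * b) has_real_derivative - a * X\<^sup>2 - b * Y\<^sup>2) (at t)" for a b
  proof -
    have "((\<lambda>s. 1 / (s - 1)) has_real_derivative - X\<^sup>2) (at t)" "((\<lambda>s. 1 / (s + 1)) has_real_derivative - Y\<^sup>2) (at t)"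
      using t by (auto intro!: derivative_eq_intros simp: X_def Y_def power2_eq_square)
    from DERIV_add[OF DERIV_cmult_right[OF this(1), of a] DERIV_cmult_right[OF this(2), of b]]
    show ?thesis by (simp add: mult.commute)
  qed
  have tr: "(f has_real_derivative D) (at t)"
    if "((\<lambda>s. (1 / (s - 1)) * a + (1 / (s + 1)) * b) has_real_derivative D) (at t)"
      "\<And>s. s\<^sup>2 \<noteq> 1 \<Longrightarrow> f s = (1 / (s - 1)) * a + (1 / (s + 1)) * b" for f a b D
    by (rule has_field_derivative_transform_within_open[OF that(1) _ t]) (use that(2) ne in auto)
  note pf = sol_partial_fractions[of _ n]
  have v: "fp_sol n t = X * (- m / (m + 1)) + Y * (- 1 / (m + 1))"
    "fm_sol n t = X * (- (m + 2) / (m + 1)) + Y * (1 / (m + 1))"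
    "g_sol n t = X * q + Y * (- q)"
    using pf[OF ne[OF t]] by (simp_all add: X_def Y_def q_def m_def)
  have g2: "(g_sol n t)\<^sup>2 = (X - Y)\<^sup>2 * (m / (2 * (m + 1)))"
    unfolding v q[symmetric] by (simp add: power2_eq_square algebra_simps)
  have "- (- m / (m + 1)) * X\<^sup>2 - (- 1 / (m + 1)) * Y\<^sup>2 = (fp_sol n t)\<^sup>2 + 2 / (real n + 1) * (g_sol n t)\<^sup>2"
    unfolding g2 v(1) m_def[symmetric] using m
    by (simp add: divide_simps) (simp add: power2_eq_square algebra_simps)
  moreover have "- (- (m + 2) / (m + 1)) * X\<^sup>2 - (1 / (m + 1)) * Y\<^sup>2
      = (fm_sol n t)\<^sup>2 - 2 * (real n + 2) / (real n * (real n + 1)) * (g_sol n t)\<^sup>2"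
    unfolding g2 v(2) m_def[symmetric] using m
    by (simp add: divide_simps) (simp add: power2_eq_square algebra_simps)
  moreover have "- q * X\<^sup>2 - - q * Y\<^sup>2
      = ((real n + 3) / 2 * fp_sol n t - (real n - 1) / 2 * fm_sol n t) * g_sol n t"
    unfolding v m_def[symmetric] using m
    by (simp add: divide_simps) (simp add: power2_eq_square algebra_simps)
  ultimately show "(fp_sol n has_real_derivative (fp_sol n t)\<^sup>2 + 2 / (real n + 1) * (g_sol n t)\<^sup>2) (at t) \<and>
      (g_sol n has_real_derivative ((real n + 3) / 2 * fp_sol n t - (real n - 1) / 2 * fm_sol n t) * g_sol n t) (at t) \<and>
      (fm_sol n has_real_derivative (fm_sol n t)\<^sup>2 - 2 * (real n + 2) / (real n * (real n + 1)) * (g_sol n t)\<^sup>2) (at t)"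
    using tr[OF der pf(1)] tr[OF der pf(2)] tr[OF der pf(3)] by (simp add: m_def q_def)
qed

lemma sol_maximal:
  assumes "n \<ge> 2"
  shows "maximal_reduced_solution n {-1<..<1} (fp_sol n) (fm_sol n) (g_sol n)"
proof -
  define c where "c = sqrt (2 * real n / (real n + 1))"
  have c: "c > 0" using assms by (simp add: c_def)
  have False
    if J: "open J" "is_interval J" "{-1<..<1} \<subset> J" and s: "reduced_solution n J fp fm g"
      and e: "\<forall>t\<in>{-1<..<1}. fp t = fp_sol n t \<and> fm t = fm_sol n t \<and> g t = g_sol n t" for J fp fm g
  proof -
    obtain y where y: "y \<in> J" "y \<notin> {-1<..<1}" using J(3) by blast
    have "(0 :: real) \<in> {-1<..<1}" by simp
    then have J0: "0 \<in> J" using J(3) by blast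
    obtain p where p: "p \<in> J" "p\<^sup>2 = 1"
    proof (cases "y \<ge> 1")
      case True
      then have "1 \<in> J" using J(2) y(1) J0 unfolding is_interval_1 by (meson zero_le_one)
      then show thesis using that[of 1] by simp
    next
      case False
      then have "y \<le> -1" using y(2) by auto
      then have "-1 \<in> J" using J(2) y(1) J0 unfolding is_interval_1 by (meson neg_le_0_iff_le zero_le_one)
      then show thesis using that[of "-1"] by simp
    qed
    \<comment> \<open>On \<open>(-1,1)\<close> the function \<open>(t\<^sup>2 - 1) g(t)\<close> is the constant \<open>c\<close>, but it vanishes at \<open>p\<close>.\<close>
    have "isCont g p" using s p(1) unfolding reduced_solution_def by (meson DERIV_isCont)
    then have "((\<lambda>t. (t\<^sup>2 - 1) * g t) \<longlongrightarrow> (p\<^sup>2 - 1) * g p) (at p)"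
      by (intro tendsto_intros) (simp add: isCont_def)
    then have lim: "((\<lambda>t. (t\<^sup>2 - 1) * g t) \<longlongrightarrow> 0) (at p within {-1<..<1})"
      using p(2) by (auto intro: tendsto_within_subset)
    have "((\<lambda>t. (t\<^sup>2 - 1) * g t) \<longlongrightarrow> c) (at p within {-1<..<1})"
    proof (rule tendsto_eventually)
      have "(t\<^sup>2 - 1) * g t = c" if "t \<in> {-1<..<1}" for t
        using e that abs_square_eq_1[of t] by (auto simp: g_sol_def c_def)
      then show "\<forall>\<^sub>F t in at p within {-1<..<1}. (t\<^sup>2 - 1) * g t = c"
        by (auto simp: eventually_at_filter)
    qed
    moreover have "at p within {-1<..<1} \<noteq> bot"
    proof -
      have "p = 1 \<or> p = -1" using p(2) by (simp add: power2_eq_1_iff)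
      then have "p islimpt {-1<..<1::real}" by (auto simp: islimpt_greaterThanLessThan1 islimpt_greaterThanLessThan2)
      then show ?thesis by (simp add: trivial_limit_within)
    qed
    ultimately have "c = 0" using lim tendsto_unique by blast
    then show False using c by simp
  qed
  then show ?thesis
    unfolding maximal_reduced_solution_def using sol_reduced_solution[OF assms] by blast
qed

text \<open>The partial fraction coefficients, merged into one formula in \<open>s\<close>: at
  \<open>1\<close> and \<open>-1\<close> they are \<open>-n/(n+1)\<close> and
  \<open>-1/(n+1)\<close> for \<open>fp_sol\<close>, and \<open>-(n+2)/(n+1)\<close> and
  \<open>1/(n+1)\<close> for \<open>fm_sol\<close>. The opening English text gives other values for
  \<open>f^+\<close> at \<open>-1\<close> and for \<open>f^-\<close> at both ends; those do not fit
  the displayed functions.\<close>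

lemma sol_residues:
  assumes "n \<ge> 2" and s: "s \<in> {1, -1::real}"
  shows "has_simple_pole_residue (fp_sol n) {-1<..<1} s (- 1 / 2 - s * (real n - 1) / (2 * (real n + 1)))" (is ?fp)
    and "has_simple_pole_residue (fm_sol n) {-1<..<1} s (- 1 / 2 - s * (real n + 3) / (2 * (real n + 1)))" (is ?fm)
    and "has_simple_pole_residue (g_sol n) {-1<..<1} s (s * sqrt (real n / (2 * (real n + 1))))" (is ?g)
proof -
  have n: "real n + 1 \<noteq> 0" "real n > 0" using assms by auto
  have lim: "s islimpt {-1<..<1::real}" "s \<notin> {-1<..<1}" "s \<noteq> - s"
    using s by (auto simp: islimpt_greaterThanLessThan1 islimpt_greaterThanLessThan2)
  have pole: "has_simple_pole_residue h {-1<..<1} s r"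
    if h: "\<And>t. t\<^sup>2 \<noteq> 1 \<Longrightarrow> h t = (1 / (t - 1)) * a + (1 / (t + 1)) * b"
      and r: "r = (if s = 1 then a else b)" "r \<noteq> 0" for h r and a b :: real
  proof (rule has_simple_pole_residue_sum[OF lim(1,2) r(2) lim(3)])
    fix t :: real assume "t \<in> {-1<..<1}"
    then have "t\<^sup>2 \<noteq> 1" using abs_square_eq_1[of t] by auto
    then show "h t = (1 / (t - s)) *\<^sub>R r + (1 / (t - - s)) *\<^sub>R (if s = 1 then b else a)"
      using h s r(1) by auto
  qed
  show ?fp
    by (rule pole[OF sol_partial_fractions(1)]) (use s n in \<open>auto simp: divide_simps\<close>)
  show ?fm
    by (rule pole[OF sol_partial_fractions(2)]) (use s n in \<open>auto simp: divide_simps, simp add: algebra_simps\<close>)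
  show ?g
    by (rule pole[OF sol_partial_fractions(3)]) (use s n in \<open>auto simp: g_res_def\<close>)
qed

section \<open>Reduction of spherically symmetric solutions\<close>

lemma conj_mult:
  fixes U :: "complex^'n^'n"
  assumes "cadjoint U ** U = mat 1"
  shows "(U ** A ** cadjoint U) ** (U ** B ** cadjoint U) = U ** (A ** B) ** cadjoint U"
proof -
  have "(U ** A ** cadjoint U) ** (U ** B ** cadjoint U) = U ** A ** (cadjoint U ** U) ** B ** cadjoint U"
    by (simp only: matrix_mul_assoc)
  then show ?thesis by (simp add: assms matrix_mul_assoc)
qed

lemma conj_mcomm:
  fixes U :: "complex^'n^'n"
  assumes "cadjoint U ** U = mat 1"
  shows "mcomm (U ** A ** cadjoint U) (U ** B ** cadjoint U) = U ** mcomm A B ** cadjoint U"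
  by (simp only: mcomm_def conj_mult[OF assms] matrix_diff_ldistrib matrix_diff_rdistrib)

lemma conj_tensor_op:
  fixes U :: "complex^'n^'n"
  assumes "cadjoint U ** U = mat 1" "tensor_op Y Y T"
  shows "tensor_op (\<lambda>i. U ** Y i ** cadjoint U) (\<lambda>i. U ** Y i ** cadjoint U) (\<lambda>i. U ** T i ** cadjoint U)"
  using assms(2) unfolding tensor_op_def conj_mult[OF assms(1)]
  by (auto simp: mat_distribs)

lemma nahm_datum_cyc:
  assumes "nahm_datum I T" "t \<in> I" "cyc i j k"
  shows "(T i has_vector_derivative mcomm (T j t) (T k t)) (at t)"
  by (cases rule: cyc_cases[OF assms(3)]) (use assms(1,2) in \<open>simp_all add: nahm_datum_def\<close>)

lemma entry_has_vector_derivative: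
  fixes F :: "real \<Rightarrow> complex^'n^'m" and f :: "real \<Rightarrow> complex"
  assumes I: "open I" "t \<in> I" and F: "(F has_vector_derivative F') (at t)"
    and e: "\<And>s. s \<in> I \<Longrightarrow> F s $ x $ y = f s * c" "F' $ x $ y = f' * c" and c: "c \<noteq> 0"
  shows "(f has_vector_derivative f') (at t)"
proof -
  have "bounded_linear (\<lambda>M :: complex^'n^'m. M $ x $ y / c)"
    by (intro bounded_linear_compose[OF bounded_linear_divide]
        bounded_linear_compose[OF bounded_linear_vec_nth bounded_linear_vec_nth])
  from bounded_linear.has_vector_derivative[OF this F]
  have "((\<lambda>s. F s $ x $ y / c) has_vector_derivative f') (at t)" using e(2) c by simp
  then show ?thesis
    by (rule has_vector_derivative_transform_within_open[OF _ I]) (use e(1) c in auto)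
qed

section \<open>Gauge fixing: from an abstract symmetric datum to real coefficient functions\<close>

context nahm_pair
begin

text \<open>The block form before the phase is fixed, with a complex off-diagonal coefficient;
  conjugation by \<open>phase w\<close> multiplies that coefficient by \<open>w\<close>.\<close>

definition Rc :: "real \<Rightarrow> real \<Rightarrow> complex \<Rightarrow> 3 \<Rightarrow> complex^('p + 'm)^('p + 'm)" where
  "Rc a b z i = block_mat (of_real a *\<^sub>C Y i) (z *\<^sub>C B i) (- (cnj z *\<^sub>C D i)) (of_real b *\<^sub>C Z i)"

lemma Rc_of_real: "Rc a b (of_real g) = R a b g"
  by (simp add: Rc_def R_def fun_eq_iff)

definition phase :: "complex \<Rightarrow> complex^('p + 'm)^('p + 'm)" where
  "phase w = block_mat (w *\<^sub>C mat 1) 0 0 (mat 1)"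

lemma phase_unitary: "cnj w * w = 1 \<Longrightarrow> cadjoint (phase w) ** phase w = mat 1"
  by (simp add: phase_def cadjoint_block_mat block_mat_mult block_mat_one block_mat_eq_iff mult.commute)

lemma phase_Rc:
  assumes "cnj w * w = 1"
  shows "phase w ** Rc a b z i ** cadjoint (phase w) = Rc a b (w * z) i"
proof -
  have "w * cnj w = 1" using assms by (simp add: mult.commute)
  then show ?thesis
    by (simp add: phase_def Rc_def cadjoint_block_mat block_mat_mult block_mat_eq_iff)
      (simp add: vec_eq_iff mult_ac)
qed

text \<open>Conjugation by a phase reduces the bracket to \<open>R_mcomm\<close>, with the modulus
  of \<open>z\<close> as real off-diagonal coefficient.\<close>

lemma Rc_mcomm:
  assumes "cyc i j k"
  shows "mcomm (Rc a b z j) (Rc a b z k)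
    = Rc (Ra a (cmod z)) (Rb b (cmod z)) (((N + 3) / 2 * of_real a - (N - 1) / 2 * of_real b) * z) i"
proof -
  \<comment> \<open>The phase of \<open>z\<close>; at \<open>z = 0\<close> any unit serves.\<close>
  define w where "w = (if z = 0 then 1 else sgn z)"
  have w: "cnj w * w = 1" "w * of_real (cmod z) = z"
  proof -
    have "cmod w = 1" by (simp add: w_def norm_sgn)
    then show "cnj w * w = 1" using complex_norm_square[of w] by (simp add: mult.commute)
    show "w * of_real (cmod z) = z" by (simp add: w_def sgn_eq)
  qed
  have e: "Rc a b z i = phase w ** R a b (cmod z) i ** cadjoint (phase w)" for a b i
    using phase_Rc[OF w(1), of a b "of_real (cmod z)" i] by (simp add: w(2) Rc_of_real)
  have "mcomm (Rc a b z j) (Rc a b z k)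
      = phase w ** Rc (Ra a (cmod z)) (Rb b (cmod z)) (of_real (Rg a b (cmod z))) i ** cadjoint (phase w)"
    unfolding e conj_mcomm[OF phase_unitary[OF w(1)]] R_mcomm[OF assms] Rc_of_real ..
  also have "\<dots> = Rc (Ra a (cmod z)) (Rb b (cmod z)) (w * of_real (Rg a b (cmod z))) i"
    by (rule phase_Rc[OF w(1)])
  also have "w * of_real (Rg a b (cmod z))
      = ((N + 3) / 2 * of_real a - (N - 1) / 2 * of_real b) * (w * of_real (cmod z))"
    by (simp add: Rg_def)
  finally show ?thesis by (simp only: w(2))
qed

text \<open>Polar decomposition of the intertwiner. \<open>P ** cadjoint P\<close> commutes with the
  generators, so by Schur and the absence of maps between the two summands it is a scalar on each
  block. Its inverse square root is therefore the explicit \<open>S\<close>, and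
  \<open>S ** P\<close> is a unitary intertwiner.\<close>

lemma gauge_unitary_generators:
  fixes Y' :: "3 \<Rightarrow> complex^('p + 'm)^('p + 'm)"
  assumes Y': "\<And>i. cadjoint (Y' i) = - Y' i" and P: "invertible P" "\<And>i. P ** Y' i = R 1 1 0 i ** P"
  obtains U where "cadjoint U ** U = mat 1" "\<And>i. U ** Y' i ** cadjoint U = R 1 1 0 i"
proof -
  let ?M = "P ** cadjoint P"
  have PG: "Y' i ** cadjoint P = cadjoint P ** R 1 1 0 i" for i
    using arg_cong[where f = cadjoint, OF P(2)[of i]] by (simp add: Y' R_adjoint)
  have comm: "?M ** R 1 1 0 i = R 1 1 0 i ** ?M" for i
  proof -
    have "?M ** R 1 1 0 i = P ** Y' i ** cadjoint P" by (simp only: matrix_mul_assoc[symmetric] PG)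
    then show ?thesis by (simp only: P(2) matrix_mul_assoc)
  qed
  obtain M11 M12 M21 M22 where M: "?M = block_mat M11 M12 M21 M22" by (rule block_mat_cases)
  have G: "R 1 1 0 i = block_mat (Y i) 0 0 (Z i)" for i by (simp add: R_def)
  have c: "M11 ** Y i = Y i ** M11" "M12 ** Z i = Y i ** M12" "M21 ** Y i = Z i ** M21" "M22 ** Z i = Z i ** M22" for i
    using comm[of i] unfolding M G by (simp_all add: block_mat_mult block_mat_eq_iff)
  have z: "M12 = 0" "M21 = 0"
    using intertwiner_zero[of M12] intertwiner_zero'[of M21] c by simp_all
  have "cadjoint ?M = ?M" by simp
  then have "cadjoint M11 = M11" "cadjoint M22 = M22"
    unfolding M by (simp_all add: cadjoint_block_mat block_mat_eq_iff)
  then obtain r q where rq: "M11 = of_real r *\<^sub>C mat 1" "M22 = of_real q *\<^sub>C mat 1"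
    using schur_hermitian[OF Y(2) c(1)] schur_hermitian[OF Z(2) c(4)] by blast
  have M': "?M = block_mat (of_real r *\<^sub>C mat 1) 0 0 (of_real q *\<^sub>C mat 1)"
    using M by (simp add: z rq)
  \<comment> \<open>Diagonal entries are sums of squares, which makes \<open>r\<close> and
    \<open>q\<close> nonnegative; invertibility of \<open>P\<close> then excludes zero.\<close>
  have diag: "?M $ x $ x = of_real (\<Sum>k\<in>UNIV. (cmod (P $ x $ k))\<^sup>2)" for x
    by (simp add: matrix_mult_nth complex_norm_square del: of_real_power)
  have nonneg: "c \<ge> 0" if "?M $ x $ x = of_real c" for x c
  proof -
    have "c = (\<Sum>k\<in>UNIV. (cmod (P $ x $ k))\<^sup>2)" using that unfolding diag of_real_eq_iff by simp
    then show ?thesis by (simp add: sum_nonneg)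
  qed
  have r0: "r \<ge> 0" by (rule nonneg[of "Inl undefined"]) (simp add: M' mat_def)
  have q0: "q \<ge> 0" by (rule nonneg[of "Inr undefined"]) (simp add: M' mat_def)
  obtain Q where Q: "P ** Q = mat 1" "Q ** P = mat 1" using P(1) unfolding invertible_def by blast
  have "?M ** (cadjoint Q ** Q) = mat 1"
  proof -
    have "?M ** (cadjoint Q ** Q) = P ** cadjoint (Q ** P) ** Q" by (simp add: matrix_mul_assoc)
    then show ?thesis by (simp only: Q cadjoint_one matrix_mul_rid)
  qed
  moreover obtain K11 K12 K21 K22 where K: "cadjoint Q ** Q = block_mat K11 K12 K21 K22" by (rule block_mat_cases)
  ultimately have "block_mat (of_real r *\<^sub>C K11) (of_real r *\<^sub>C K12) (of_real q *\<^sub>C K21) (of_real q *\<^sub>C K22) = mat 1"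
    unfolding M' by (simp add: block_mat_mult)
  then have "of_real r *\<^sub>C K11 = mat 1" "of_real q *\<^sub>C K22 = mat 1"
    unfolding block_mat_one block_mat_eq_iff by blast+
  then have "r \<noteq> 0" "q \<noteq> 0" by auto
  then have rq0: "r > 0" "q > 0" using r0 q0 by auto
  define S where "S = block_mat (of_real (1 / sqrt r) *\<^sub>C mat 1 :: complex^'p^'p) 0 0 (of_real (1 / sqrt q) *\<^sub>C mat 1 :: complex^'m^'m)"
  have S_adj: "cadjoint S = S" by (simp add: S_def cadjoint_block_mat)
  have sq: "complex_of_real (1 / sqrt x) * (of_real x * of_real (1 / sqrt x)) = 1" if "x > 0" for x
  proof -
    have "1 / sqrt x * (x * (1 / sqrt x)) = 1" using that by (simp add: field_simps)
    then show ?thesis by (metis of_real_1 of_real_mult)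
  qed
  have "S ** ?M ** S = mat 1"
    unfolding M' S_def block_mat_mult block_mat_one block_mat_eq_iff
    using sq[OF rq0(1)] sq[OF rq0(2)] by (simp add: mult_ac)
  moreover have "(S ** P) ** cadjoint (S ** P) = S ** ?M ** S"
    by (simp add: S_adj matrix_mul_assoc)
  ultimately have U: "(S ** P) ** cadjoint (S ** P) = mat 1" by simp
  have SG: "S ** R 1 1 0 i = R 1 1 0 i ** S" for i
    by (simp add: S_def G block_mat_mult block_mat_eq_iff)
  have "(S ** P) ** Y' i ** cadjoint (S ** P) = R 1 1 0 i" for i
  proof -
    have "(S ** P) ** Y' i = S ** (R 1 1 0 i ** P)" by (simp only: matrix_mul_assoc[symmetric] P(2))
    also have "\<dots> = R 1 1 0 i ** (S ** P)" by (simp only: matrix_mul_assoc SG)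
    finally have "(S ** P) ** Y' i ** cadjoint (S ** P) = R 1 1 0 i ** ((S ** P) ** cadjoint (S ** P))"
      by (simp only: matrix_mul_assoc)
    then show ?thesis by (simp only: U matrix_mul_rid)
  qed
  then show thesis using that U unitary_swap[of "S ** P"] by blast
qed

text \<open>For block diagonal generators the four blocks are separate vector operators, each fixed
  up to a scalar by \<open>tensor_op_self\<close> or \<open>B_unique\<close>. Anti-Hermiticity makes
  the diagonal scalars real and ties the lower left block to the upper right one.\<close>

lemma tensor_op_R_form:
  assumes t: "tensor_op (R 1 1 0) (R 1 1 0) T" and adj: "\<And>i. cadjoint (T i) = - T i"
  obtains a b z where "T = Rc a b z"
proof -
  define A where "A i = (\<chi> x y. T i $ Inl x $ Inl y)" for i
  define F where "F i = (\<chi> x y. T i $ Inl x $ Inr y)" for i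
  define E where "E i = (\<chi> x y. T i $ Inr x $ Inl y)" for i
  define H where "H i = (\<chi> x y. T i $ Inr x $ Inr y)" for i
  have T: "T i = block_mat (A i) (F i) (E i) (H i)" for i
    by (rule block_mat_eqI) (simp_all add: A_def F_def E_def H_def)
  have G: "R 1 1 0 = (\<lambda>i. block_mat (Y i) 0 0 (Z i))" by (simp add: R_def fun_eq_iff)
  have ts: "tensor_op Y Y A" "tensor_op Y Z F" "tensor_op Z Z H"
    using t unfolding G block_mat_diag_tensor_op[where T = T, OF T] by blast+
  have ad: "cadjoint (A i) = - A i" "cadjoint (F i) = - E i" "cadjoint (H i) = - H i" for i
    using adj[of i] unfolding T by (simp_all add: cadjoint_block_mat block_mat_linear block_mat_eq_iff)
  obtain a where a: "\<And>i. A i = a *\<^sub>C Y i" using tensor_op_self[OF Y ts(1)] cardp by auto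
  obtain b where b: "\<And>i. H i = b *\<^sub>C Z i" using tensor_op_self[OF Z ts(3)] cardm n2 by auto
  obtain z where z: "\<And>i. F i = z *\<^sub>C B i" using B_unique[OF ts(2)] by blast
  have "cnj a *\<^sub>C Y i = a *\<^sub>C Y i" "cnj b *\<^sub>C Z i = b *\<^sub>C Z i" for i
    using ad(1)[of i] ad(3)[of i] by (simp_all add: a b so3_tripleD(1)[OF Y(1)] so3_tripleD(1)[OF Z(1)])
  then have "cnj a = a" "cnj b = b"
    using Y_nz Z_nz cscale_eq_iff_of_nonzero by metis+
  then obtain a' b' where r: "a = of_real a'" "b = of_real b'" by (metis Reals_cnj_iff Reals_cases)
  have "E i = - (cnj z *\<^sub>C D i)" for i
    using ad(2)[of i] by (simp add: z)
  then have "T = Rc a' b' z" by (simp add: fun_eq_iff T Rc_def a b z r)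
  then show thesis by (rule that)
qed

lemma reduce:
  fixes T :: "3 \<Rightarrow> real \<Rightarrow> complex^('p + 'm)^('p + 'm)"
  assumes I: "open I" "is_interval I"
    and der: "\<And>t i j k. t \<in> I \<Longrightarrow> cyc i j k \<Longrightarrow> (T i has_vector_derivative mcomm (T j t) (T k t)) (at t)"
    and adj: "\<And>t i. t \<in> I \<Longrightarrow> cadjoint (T i t) = - T i t"
    and sym: "\<And>t. t \<in> I \<Longrightarrow> tensor_op (R 1 1 0) (R 1 1 0) (\<lambda>i. T i t)"
  obtains w fp fm g where "cnj w * w = 1" "reduced_solution n I fp fm g"
    "\<And>t i. t \<in> I \<Longrightarrow> phase w ** T i t ** cadjoint (phase w) = R (fp t) (fm t) (g t) i"
proof -
  have "\<forall>t. \<exists>x. t \<in> I \<longrightarrow> (\<lambda>i. T i t) = Rc (fst x) (fst (snd x)) (snd (snd x))"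
    using tensor_op_R_form[OF sym adj] by (metis fst_conv snd_conv)
  then obtain x where "\<And>t. t \<in> I \<Longrightarrow> (\<lambda>i. T i t) = Rc (fst (x t)) (fst (snd (x t))) (snd (snd (x t)))"
    by metis
  then obtain a b z where form: "\<And>t i. t \<in> I \<Longrightarrow> T i t = Rc (a t) (b t) (z t) i"
    using that[of "\<lambda>t. fst (x t)" "\<lambda>t. fst (snd (x t))" "\<lambda>t. snd (snd (x t))"] by metis
  define h where "h t = (real n + 3) / 2 * a t - (real n - 1) / 2 * b t" for t
  have der': "(T i has_vector_derivative Rc (Ra (a t) (cmod (z t))) (Rb (b t) (cmod (z t))) (of_real (h t) * z t) i) (at t)"
    if t: "t \<in> I" for t i
  proof -
    obtain j k where c: "cyc i j k" using cyc_ex by blast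
    show ?thesis
      using der[OF t c] unfolding form[OF t] Rc_mcomm[OF c] by (simp add: h_def)
  qed
  have re: "(f has_real_derivative f') (at t)"
    if "((\<lambda>s. complex_of_real (f s)) has_vector_derivative of_real f') (at t)" for f f' t
    using bounded_linear.has_vector_derivative[OF bounded_linear_Re that]
    by (simp add: has_real_derivative_iff_has_vector_derivative)
  \<comment> \<open>Each coefficient function inherits its derivative from a matrix entry at which
    the fixed matrix multiplying it is nonzero.\<close>
  have da: "(a has_real_derivative Ra (a t) (cmod (z t))) (at t)" if t: "t \<in> I" for t
  proof -
    obtain i x y where nz: "Y i $ x $ y \<noteq> 0" using Y_nz by (auto simp: vec_eq_iff)
    show ?thesis
      by (rule re, rule entry_has_vector_derivative[OF I(1) t der'[OF t, of i],
            where x = "Inl x" and y = "Inl y" and c = "Y i $ x $ y"])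
        (simp_all add: form Rc_def nz)
  qed
  have db: "(b has_real_derivative Rb (b t) (cmod (z t))) (at t)" if t: "t \<in> I" for t
  proof -
    obtain i x y where nz: "Z i $ x $ y \<noteq> 0" using Z_nz by (auto simp: vec_eq_iff)
    show ?thesis
      by (rule re, rule entry_has_vector_derivative[OF I(1) t der'[OF t, of i],
            where x = "Inr x" and y = "Inr y" and c = "Z i $ x $ y"])
        (simp_all add: form Rc_def nz)
  qed
  have dz: "(z has_vector_derivative of_real (h t) * z t) (at t)" if t: "t \<in> I" for t
  proof -
    obtain i x y where nz: "B i $ x $ y \<noteq> 0" using B_nz by (auto simp: vec_eq_iff)
    show ?thesis
      by (rule entry_has_vector_derivative[OF I(1) t der'[OF t, of i],
            where x = "Inl x" and y = "Inr y" and c = "B i $ x $ y"])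
        (simp_all add: form Rc_def nz)
  qed
  have hc: "continuous_on I h"
    unfolding h_def
    by (intro continuous_intros continuous_at_imp_continuous_on ballI DERIV_isCont[OF da] DERIV_isCont[OF db])
  have dw: "((\<lambda>s. Re (w * z s)) has_real_derivative h t * Re (w * z t)) (at t)"
    "((\<lambda>s. Im (w * z s)) has_real_derivative h t * Im (w * z t)) (at t)" if t: "t \<in> I" for w t
  proof -
    have d: "((\<lambda>s. w * z s) has_vector_derivative w * (of_real (h t) * z t)) (at t)"
      by (rule bounded_linear.has_vector_derivative[OF bounded_linear_mult_right dz[OF t]])
    have e: "w * (of_real (h t) * z t) = of_real (h t) * (w * z t)" by simp
    show "((\<lambda>s. Re (w * z s)) has_real_derivative h t * Re (w * z t)) (at t)"
      using bounded_linear.has_vector_derivative[OF bounded_linear_Re d]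
      unfolding e has_real_derivative_iff_has_vector_derivative by simp
    show "((\<lambda>s. Im (w * z s)) has_real_derivative h t * Im (w * z t)) (at t)"
      using bounded_linear.has_vector_derivative[OF bounded_linear_Im d]
      unfolding e has_real_derivative_iff_has_vector_derivative by simp
  qed
  \<comment> \<open>The imaginary part of \<open>w * z\<close> solves a linear equation with the
    real coefficient \<open>h\<close>. Choosing \<open>w\<close> to cancel the phase of
    \<open>z\<close> at one time makes it vanish at all times.\<close>
  obtain w where w: "cnj w * w = 1" "\<And>t. t \<in> I \<Longrightarrow> Im (w * z t) = 0"
  proof (cases "\<exists>t0\<in>I. z t0 \<noteq> 0")
    case True
    then obtain t0 where t0: "t0 \<in> I" "z t0 \<noteq> 0" by blast
    define w where "w = cnj (sgn (z t0))"
    have "cmod w = 1" using t0 by (simp add: w_def norm_sgn)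
    then have w1: "cnj w * w = 1" using complex_norm_square[of w] by (simp add: mult.commute)
    have "w * z t0 = of_real (cmod (z t0)) * (w * cnj w)"
      using t0 by (simp add: w_def sgn_eq)
    moreover have "w * cnj w = 1" using w1 by (simp add: mult.commute)
    ultimately have "w * z t0 = of_real (cmod (z t0))" by (simp only: mult_1_right)
    then have "Im (w * z t0) = 0" by (simp only: Im_complex_of_real)
    then have "Im (w * z t) = 0" if "t \<in> I" for t
      using linear_ode_zero[where y = "\<lambda>s. Im (w * z s)", OF I(2) hc dw(2) t0(1) _ that]
      by blast
    then show thesis using that w1 by blast
  next
    case False
    then show thesis using that[of 1] by simp
  qed
  define g where "g t = Re (w * z t)" for t
  have gz: "w * z t = of_real (g t)" if "t \<in> I" for t
    using w(2)[OF that] by (simp add: complex_eq_iff g_def)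
  have g2: "(cmod (z t))\<^sup>2 = (g t)\<^sup>2" if "t \<in> I" for t
  proof -
    have "complex_of_real ((cmod w)\<^sup>2) = 1" using w(1) by (simp only: complex_norm_square mult.commute)
    then have "(cmod w)\<^sup>2 = 1" using of_real_eq_1_iff by blast
    then have "(cmod (z t))\<^sup>2 = (cmod (w * z t))\<^sup>2" by (simp add: norm_mult power_mult_distrib)
    then show ?thesis by (simp add: gz[OF that])
  qed
  have "reduced_solution n I a b g"
    unfolding reduced_solution_def
  proof (intro ballI conjI)
    fix t assume t: "t \<in> I"
    show "(a has_real_derivative (a t)\<^sup>2 + 2 / (real n + 1) * (g t)\<^sup>2) (at t)"
      using da[OF t] by (simp add: Ra_def g2[OF t])
    show "(b has_real_derivative (b t)\<^sup>2 - 2 * (real n + 2) / (real n * (real n + 1)) * (g t)\<^sup>2) (at t)"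
      using db[OF t] by (simp add: Rb_def g2[OF t])
    show "(g has_real_derivative ((real n + 3) / 2 * a t - (real n - 1) / 2 * b t) * g t) (at t)"
      using dw(1)[OF t, of w] unfolding g_def[symmetric] h_def .
  qed
  moreover have "phase w ** T i t ** cadjoint (phase w) = R (a t) (b t) (g t) i" if t: "t \<in> I" for t i
    unfolding form[OF t] phase_Rc[OF w(1)] gz[OF t] Rc_of_real ..
  ultimately show thesis using that w(1) by blast
qed

lemma spherically_symmetric_reduction:
  fixes T :: "3 \<Rightarrow> real \<Rightarrow> complex^('p + 'm)^('p + 'm)"
  assumes I: "open I" "is_interval I" and T: "nahm_datum I T" and gen: "symmetry_generators I T Y'"
    and P: "invertible P" "\<And>i. P ** Y' i = R 1 1 0 i ** P"
  obtains U fp fm g where "U \<in> SU" "reduced_solution n I fp fm g"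
    "\<And>t i. t \<in> I \<Longrightarrow> gauge_act U (T i t) = R (fp t) (fm t) (g t) i"
proof -
  have Y': "cadjoint (Y' i) = - Y' i" for i
    using gen by (simp add: symmetry_generators_def su_def)
  obtain U where U: "cadjoint U ** U = mat 1" "\<And>i. U ** Y' i ** cadjoint U = R 1 1 0 i"
    using gauge_unitary_generators[OF Y' P] by blast
  define T' where "T' i t = U ** T i t ** cadjoint U" for i t
  have "linear (\<lambda>M. U ** M ** cadjoint U)"
    by (rule linearI) (simp_all add: mat_distribs scaleR_cscale)
  then have bl: "bounded_linear (\<lambda>M. U ** M ** cadjoint U)" using linear_conv_bounded_linear by blast
  have der: "(T' i has_vector_derivative mcomm (T' j t) (T' k t)) (at t)" if "t \<in> I" "cyc i j k" for t i j k
    using bounded_linear.has_vector_derivative[OF bl nahm_datum_cyc[OF T that]]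
    unfolding T'_def conj_mcomm[OF U(1)] .
  have adj: "cadjoint (T' i t) = - T' i t" if "t \<in> I" for t i
  proof -
    have "cadjoint (T i t) = - T i t" using T that by (simp add: nahm_datum_def su_def)
    then show ?thesis by (simp add: T'_def matrix_mul_assoc)
  qed
  have sym: "tensor_op (R 1 1 0) (R 1 1 0) (\<lambda>i. T' i t)" if "t \<in> I" for t
  proof -
    have "tensor_op Y' Y' (\<lambda>i. T i t)"
      unfolding tensor_op_iff using gen that by (simp add: symmetry_generators_def mcomm_def)
    from conj_tensor_op[OF U(1) this] show ?thesis
      unfolding U(2) T'_def by simp
  qed
  obtain w fp fm g where w: "cnj w * w = 1" "reduced_solution n I fp fm g"
    "\<And>t i. t \<in> I \<Longrightarrow> phase w ** T' i t ** cadjoint (phase w) = R (fp t) (fm t) (g t) i"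
    using reduce[OF I der adj sym] by blast
  have V: "cadjoint (phase w ** U) ** (phase w ** U) = mat 1"
  proof -
    have "cadjoint (phase w ** U) ** (phase w ** U) = cadjoint U ** (cadjoint (phase w) ** phase w) ** U"
      by (simp add: matrix_mul_assoc)
    then show ?thesis by (simp add: phase_unitary[OF w(1)] U(1))
  qed
  \<comment> \<open>\<open>U\<close> and \<open>phase w\<close> are only unitary; the factor
    \<open>c\<close> makes the determinant 1 and cancels in the conjugation.\<close>
  obtain c where c: "cnj c * c = 1" "c *\<^sub>C (phase w ** U) \<in> SU"
    using unitary_rescale_SU[OF V] by blast
  have "gauge_act (c *\<^sub>C (phase w ** U)) (T i t) = R (fp t) (fm t) (g t) i" if t: "t \<in> I" for t i
  proof -
    have "cadjoint (c *\<^sub>C (phase w ** U)) ** (c *\<^sub>C (phase w ** U)) = mat 1"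
      using c(2) by (simp add: SU_def)
    then have "gauge_act (c *\<^sub>C (phase w ** U)) (T i t)
        = (c *\<^sub>C (phase w ** U)) ** T i t ** cadjoint (c *\<^sub>C (phase w ** U))"
      by (rule gauge_act_unitary)
    also have "\<dots> = phase w ** T' i t ** cadjoint (phase w)"
      using c(1) by (simp add: T'_def matrix_mul_assoc mult.commute)
    finally show ?thesis by (simp only: w(3)[OF t])
  qed
  then show thesis using that c(2) w(2) by blast
qed

section \<open>The datum of the explicit solution\<close>

lemma R_solution_nahm_datum:
  assumes "reduced_solution n I fp fm g"
  shows "nahm_datum I (\<lambda>i t. R (fp t) (fm t) (g t) i)"
proof -
  have lin: "R a b c i = a *\<^sub>R R 1 0 0 i + b *\<^sub>R R 0 1 0 i + c *\<^sub>R R 0 0 1 i" for a b c i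
    by (simp add: R_scaleR R_add)
  have der: "((\<lambda>t. R (fp t) (fm t) (g t) i) has_vector_derivative mcomm (R (fp t) (fm t) (g t) j) (R (fp t) (fm t) (g t) k)) (at t)"
    if t: "t \<in> I" and c: "cyc i j k" for t i j k
  proof -
    have d: "(fp has_real_derivative Ra (fp t) (g t)) (at t)" "(fm has_real_derivative Rb (fm t) (g t)) (at t)"
      "(g has_real_derivative Rg (fp t) (fm t) (g t)) (at t)"
      using assms t by (auto simp: reduced_solution_def Ra_def Rb_def Rg_def)
    have s: "((\<lambda>t. f t *\<^sub>R M) has_vector_derivative f' *\<^sub>R M) (at t)"
      if "(f has_real_derivative f') (at t)" for f f' and M :: "complex^('p + 'm)^('p + 'm)"
      using has_vector_derivative_scaleR[OF that has_vector_derivative_const[of M]] by simp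
    have "((\<lambda>t. R (fp t) (fm t) (g t) i) has_vector_derivative
        R (Ra (fp t) (g t)) (Rb (fm t) (g t)) (Rg (fp t) (fm t) (g t)) i) (at t)"
      unfolding lin[of "fp _"] lin[of "Ra _ _"] by (intro has_vector_derivative_add s d)
    then show ?thesis by (simp only: R_mcomm[OF c])
  qed
  have "R a b c i \<in> su" for a b c i by (simp add: su_def R_adjoint R_trace)
  then show ?thesis using der cyc_123 unfolding nahm_datum_def by blast
qed

lemma R_datum_spherically_symmetric: "spherically_symmetric I (\<lambda>i t. R (fp t) (fm t) (g t) i)"
  unfolding spherically_symmetric_def
proof
  fix A :: "real^3^3" assume A: "A \<in> SO3"
  obtain U where U: "U \<in> SU" "\<And>a b g i. twist A (R a b g) i = cadjoint U ** R a b g i ** U"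
    using R_spherically_symmetric[OF A] by blast
  have "cadjoint U ** U = mat 1" using U(1) by (simp add: SU_def)
  then show "\<exists>U\<in>SU. \<forall>t\<in>I. \<forall>i. (\<Sum>j\<in>UNIV. A $ i $ j *\<^sub>R R (fp t) (fm t) (g t) j)
      = gauge_act (matrix_inv U) (R (fp t) (fm t) (g t) i)"
    using U by (intro bexI[of _ U]) (simp_all add: gauge_act_unitary_inv twist_def)
qed

section \<open>Irreducibility and pole structure of the explicit datum\<close>

definition vjoin :: "complex^'p \<Rightarrow> complex^'m \<Rightarrow> complex^('p + 'm)" where
  "vjoin x y = (\<chi> i. case i of Inl a \<Rightarrow> x $ a | Inr b \<Rightarrow> y $ b)"

lemma vjoin_nth [simp]: "vjoin x y $ Inl a = x $ a" "vjoin x y $ Inr b = y $ b"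
  by (simp_all add: vjoin_def)

lemma vjoin_eqI:
  assumes "\<And>a. v $ Inl a = w $ Inl a" "\<And>b. v $ Inr b = w $ Inr b"
  shows "v = (w :: complex^('p + 'm))"
  unfolding vec_eq_iff
proof
  fix i show "v $ i = w $ i" using assms by (cases i) auto
qed

lemma vjoin_cases: obtains x y where "v = vjoin x y"
proof
  show "v = vjoin (\<chi> a. v $ Inl a) (\<chi> b. v $ Inr b)" by (rule vjoin_eqI) simp_all
qed

lemma block_mat_vjoin: "block_mat K L M K' *v vjoin x y = vjoin (K *v x + L *v y) (M *v x + K' *v y)"
  by (rule vjoin_eqI) (simp_all add: matrix_vector_mult_def sum_UNIV_Plus)

lemma vjoin_linear: "vjoin x y + vjoin x' y' = vjoin (x + x') (y + y')" "c *s vjoin x y = vjoin (c *s x) (c *s y)"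
  "vjoin 0 0 = 0"
  by (rule vjoin_eqI; simp)+

lemma R_irreducible:
  assumes S: "vec.subspace S" and G: "\<And>i v. v \<in> S \<Longrightarrow> R 1 1 0 i *v v \<in> S"
    and T: "\<And>i v. v \<in> S \<Longrightarrow> R a b g i *v v \<in> S" and g: "g \<noteq> 0"
  shows "S = {0} \<or> S = UNIV"
proof -
  note cl = vec.subspace_add[OF S] vec.subspace_scale[OF S]
  have G': "vjoin (Y i *v x) (Z i *v y) \<in> S" if "vjoin x y \<in> S" for i x y
    using G[OF that, of i] by (simp add: R_def block_mat_vjoin)
  define cY where "cY = - ((N + 1) * (N + 3) / 4)"
  define cZ where "cZ = - ((N - 1) * (N + 1) / 4)"
  have cas: "vjoin (cY *s x) (cZ *s y) \<in> S" if "vjoin x y \<in> S" for x y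
  proof -
    have "vjoin (Y i *v (Y i *v x)) (Z i *v (Z i *v y)) \<in> S" for i using G' that by blast
    then have "vjoin (casimir Y *v x) (casimir Z *v y) \<in> S"
      using cl(1) by (simp add: casimir_def sum_3 matrix_vector_mult_add_rdistrib
          matrix_vector_mul_assoc vjoin_linear[symmetric])
    then show ?thesis by (simp add: casY casZ cY_def cZ_def cscale_vector del: minus_add_distrib cscale_minus_left)
  qed
  have d: "cY - cZ \<noteq> 0" using cas_diff N_nz(2) by (simp add: cY_def cZ_def del: minus_add_distrib)
  \<comment> \<open>The Casimir operators of the two summands differ, so the projections preserve \<open>S\<close>.\<close>
  have proj: "vjoin x 0 \<in> S \<and> vjoin 0 y \<in> S" if v: "vjoin x y \<in> S" for x y
  proof -
    have "vjoin (cY *s x) (cZ *s y) + (- cZ) *s vjoin x y \<in> S" using cl cas[OF v] v by blast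
    moreover have "vjoin (cY *s x) (cZ *s y) + (- cZ) *s vjoin x y = (cY - cZ) *s vjoin x 0"
      by (rule vjoin_eqI) (simp_all add: algebra_simps)
    ultimately have "(cY - cZ) *s vjoin x 0 \<in> S" by (simp only:)
    then have "(1 / (cY - cZ)) *s ((cY - cZ) *s vjoin x 0) \<in> S" by (rule cl(2))
    moreover have "(1 / (cY - cZ)) *s ((cY - cZ) *s vjoin x 0) = vjoin x 0"
      unfolding vector_smult_assoc using d by simp
    ultimately have 1: "vjoin x 0 \<in> S" by (simp only:)
    have "vjoin x y + (- 1) *s vjoin x 0 \<in> S" using cl v 1 by blast
    moreover have "vjoin x y + (- 1) *s vjoin x 0 = vjoin 0 y" by (rule vjoin_eqI) simp_all
    ultimately show ?thesis using 1 by simp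
  qed
  define Sp where "Sp = {x. vjoin x 0 \<in> S}"
  define Sm where "Sm = {y. vjoin 0 y \<in> S}"
  have vj: "vjoin (x + x') 0 = vjoin x 0 + vjoin x' 0" "vjoin (c *s x) 0 = c *s vjoin x 0"
    "vjoin 0 (y + y') = vjoin 0 y + vjoin 0 y'" "vjoin 0 (c *s y) = c *s vjoin 0 y" "vjoin 0 0 = 0" for x x' y y' c
    by (rule vjoin_eqI; simp)+
  have "vec.subspace Sp"
    unfolding vec.subspace_def Sp_def
    by (auto simp: vj cl vec.subspace_0[OF S])
  moreover have "\<forall>i. \<forall>x\<in>Sp. Y i *v x \<in> Sp" using G'[of _ 0] by (simp add: Sp_def)
  ultimately have Sp: "Sp = {0} \<or> Sp = UNIV" using Y(2) unfolding irreducible_triple_def by blast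
  have "vec.subspace Sm"
    unfolding vec.subspace_def Sm_def
    by (auto simp: vj cl vec.subspace_0[OF S])
  moreover have "\<forall>i. \<forall>y\<in>Sm. Z i *v y \<in> Sm" using G'[of 0] by (simp add: Sm_def)
  ultimately have Sm: "Sm = {0} \<or> Sm = UNIV" using Z(2) unfolding irreducible_triple_def by blast
  obtain i where Bi: "B i \<noteq> 0" using B_nz by blast
  then have Di: "D i \<noteq> 0" by simp
  have neg: "(- (of_real g *\<^sub>C D i)) *v x = (- of_real g) *s (D i *v x)" for x
    using cscale_vector[of "- of_real g" "D i" x] by simp
  \<comment> \<open>Since \<open>g\<close> is nonzero, the off-diagonal blocks carry vectors of one
    summand to nonzero vectors of the other, so \<open>S\<close> contains both summands or
    neither.\<close>
  have pm: "Sm = UNIV" if "Sp = UNIV"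
  proof -
    obtain x where x: "D i *v x \<noteq> 0" using Di matrix_eq[of "D i" 0] by auto
    have "vjoin x 0 \<in> S" using that by (auto simp: Sp_def)
    from T[OF this, of i] have "vjoin 0 ((- of_real g) *s (D i *v x)) \<in> S"
      using proj by (simp add: R_def block_mat_vjoin neg)
    then have "(- of_real g) *s (D i *v x) \<in> Sm" by (simp add: Sm_def)
    moreover have "(- complex_of_real g) *s (D i *v x) \<noteq> 0" using x g by (simp add: vec_eq_iff)
    ultimately show ?thesis using Sm by auto
  qed
  have mp: "Sp = UNIV" if "Sm = UNIV"
  proof -
    obtain y where y: "B i *v y \<noteq> 0" using Bi matrix_eq[of "B i" 0] by auto
    have "vjoin 0 y \<in> S" using that by (auto simp: Sm_def)
    from T[OF this, of i] have "vjoin (of_real g *s (B i *v y)) 0 \<in> S"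
      using proj by (simp add: R_def block_mat_vjoin cscale_vector)
    then have "of_real g *s (B i *v y) \<in> Sp" by (simp add: Sp_def)
    moreover have "complex_of_real g *s (B i *v y) \<noteq> 0" using y g by (simp add: vec_eq_iff)
    ultimately show ?thesis using Sp by auto
  qed
  show ?thesis
  proof (cases "Sp = UNIV")
    case True
    have "v \<in> S" for v
    proof -
      obtain x y where v: "v = vjoin x y" by (rule vjoin_cases)
      have "vjoin x 0 \<in> S" "vjoin 0 y \<in> S" using True pm by (auto simp: Sp_def Sm_def)
      then have "vjoin x 0 + vjoin 0 y \<in> S" by (rule cl(1))
      then show ?thesis by (simp add: v vjoin_linear)
    qed
    then show ?thesis by blast
  next
    case False
    then have z: "Sp = {0}" "Sm = {0}" using Sp Sm mp by blast+
    have "v = 0" if "v \<in> S" for v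
    proof -
      obtain x y where v: "v = vjoin x y" by (rule vjoin_cases)
      have "x \<in> Sp" "y \<in> Sm" using proj that v by (auto simp: Sp_def Sm_def)
      then show ?thesis using z by (simp add: v vjoin_linear)
    qed
    moreover have "0 \<in> S" using S by (rule vec.subspace_0)
    ultimately show ?thesis by blast
  qed
qed

text \<open>Spin 1/2 and orbital spin n/2 written in the decomposition by total spin. On total spin
  (n+1)/2 their shares of the generators are \<open>1/(n+1)\<close> and \<open>n/(n+1)\<close>, on
  (n-1)/2 they are \<open>-1/(n+1)\<close> and \<open>(n+2)/(n+1)\<close>. They are the negated
  residues of the datum at \<open>-1\<close> and \<open>1\<close>.\<close>

definition S_gen :: "3 \<Rightarrow> complex^('p + 'm)^('p + 'm)" where
  "S_gen = R (1 / (real n + 1)) (- (1 / (real n + 1))) (g_res n)"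

definition L_gen :: "3 \<Rightarrow> complex^('p + 'm)^('p + 'm)" where
  "L_gen = R (real n / (real n + 1)) ((real n + 2) / (real n + 1)) (- g_res n)"

lemma S_gen_triple: "so3_triple S_gen"
proof -
  have n: "real n \<noteq> 0" "real n + 1 \<noteq> 0" using n2 by auto
  show ?thesis
    unfolding S_gen_def
  proof (rule R_so3_triple)
    show "Ra (1 / (real n + 1)) (g_res n) = 1 / (real n + 1)"
      unfolding Ra_def g_res_sq using n by (simp add: divide_simps power2_eq_square) (simp add: algebra_simps)
    show "Rb (- (1 / (real n + 1))) (g_res n) = - (1 / (real n + 1))"
      unfolding Rb_def g_res_sq using n by (simp add: divide_simps power2_eq_square) (simp add: algebra_simps)
    have "(real n + 3) / 2 * (1 / (real n + 1)) - (real n - 1) / 2 * (- (1 / (real n + 1))) = 1"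
      using n by (simp add: divide_simps)
    then show "Rg (1 / (real n + 1)) (- (1 / (real n + 1))) (g_res n) = g_res n"
      unfolding Rg_def by simp
  qed
qed

lemma L_gen_triple: "so3_triple L_gen"
proof -
  have n: "real n \<noteq> 0" "real n + 1 \<noteq> 0" using n2 by auto
  show ?thesis
    unfolding L_gen_def
  proof (rule R_so3_triple)
    show "Ra (real n / (real n + 1)) (- g_res n) = real n / (real n + 1)"
      unfolding Ra_def power2_minus g_res_sq using n by (simp add: divide_simps power2_eq_square) (simp add: algebra_simps)
    show "Rb ((real n + 2) / (real n + 1)) (- g_res n) = (real n + 2) / (real n + 1)"
      unfolding Rb_def power2_minus g_res_sq using n by (simp add: divide_simps power2_eq_square) (simp add: algebra_simps)
    have "(real n + 3) / 2 * (real n / (real n + 1)) - (real n - 1) / 2 * ((real n + 2) / (real n + 1)) = 1"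
      using n by (simp add: divide_simps) (simp add: algebra_simps)
    then show "Rg (real n / (real n + 1)) ((real n + 2) / (real n + 1)) (- g_res n) = - g_res n"
      unfolding Rg_def by simp
  qed
qed

text \<open>The constant is that of the two-dimensional irreducible representation,
  \<open>(2^2 - 1)/4\<close>; in \<open>L_gen_casimir\<close> it is that of dimension
  \<open>n + 1\<close>.\<close>

lemma S_gen_casimir: "casimir S_gen = of_real (- (3 / 4)) *\<^sub>C mat 1"
proof -
  have n: "real n \<noteq> 0" "real n + 1 \<noteq> 0" using n2 by auto
  show ?thesis
    unfolding S_gen_def
    by (rule R_casimir; unfold g_res_sq; use n in \<open>simp add: divide_simps power2_eq_square\<close>; simp add: algebra_simps)
qed

lemma L_gen_casimir: "casimir L_gen = of_real (- (((real n + 1)\<^sup>2 - 1) / 4)) *\<^sub>C mat 1"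
proof -
  have n: "real n \<noteq> 0" "real n + 1 \<noteq> 0" using n2 by auto
  show ?thesis
    unfolding L_gen_def
    by (rule R_casimir; unfold g_res_sq power2_minus; use n in \<open>simp add: divide_simps power2_eq_square\<close>; simp add: algebra_simps)
qed

text \<open>One vanishing generator forces the other two to vanish through the commutators, and with
  them the Casimir. A pole in the sense of \<open>has_simple_pole_residue\<close> requires each
  residue to be nonzero.\<close>

lemma so3_triple_nonzero:
  assumes "so3_triple T" "casimir T = of_real c *\<^sub>C mat 1" "c \<noteq> 0" shows "T i \<noteq> 0"
proof
  assume z: "T i = 0"
  obtain j k where c: "cyc i j k" using cyc_ex by blast
  have "T k = 0" using so3_tripleD(2)[OF assms(1) c] by (simp add: z)
  moreover have "T j = 0" using so3_tripleD(2)[OF assms(1) cyc_rotate2[OF c]] by (simp add: z)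
  ultimately have "casimir T = 0" by (simp add: casimir_def sum_cyc[OF c] z)
  then show False using assms(2,3) by simp
qed

lemma sol_datum:
  assumes "t \<in> {-1<..<1}"
  shows "R (fp_sol n t) (fm_sol n t) (g_sol n t) i = (1 / (t - 1)) *\<^sub>R (- L_gen i) + (1 / (t + 1)) *\<^sub>R (- S_gen i)"
proof -
  have "t\<^sup>2 \<noteq> 1" using assms abs_square_eq_1[of t] by auto
  have m: "- R a b g i = R (- a) (- b) (- g) i" for a b g
    using R_scaleR[of "-1" a b g i] by simp
  show ?thesis
    unfolding sol_partial_fractions[OF \<open>t\<^sup>2 \<noteq> 1\<close>] L_gen_def S_gen_def m R_scaleR R_add
    by (simp only: minus_divide_left minus_minus)
qed

lemma sol_poles:
  shows "has_simple_pole_residue (\<lambda>t. R (fp_sol n t) (fm_sol n t) (g_sol n t) i) {-1<..<1} 1 (- L_gen i)" (is ?L)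
    and "has_simple_pole_residue (\<lambda>t. R (fp_sol n t) (fm_sol n t) (g_sol n t) i) {-1<..<1} (-1) (- S_gen i)" (is ?S)
proof -
  have "- (((real n + 1)\<^sup>2 - 1) / 4) \<noteq> 0"
  proof -
    have "(real n + 1)\<^sup>2 - 1 = real n * (real n + 2)" by (simp add: power2_eq_square algebra_simps)
    then show ?thesis using n2 by simp
  qed
  then have nz: "- L_gen i \<noteq> 0" "- S_gen i \<noteq> 0"
    using so3_triple_nonzero[OF L_gen_triple L_gen_casimir] so3_triple_nonzero[OF S_gen_triple S_gen_casimir] by simp_all
  show ?L
    by (rule has_simple_pole_residue_sum[where q = "-1" and R' = "- S_gen i"])
      (use nz(1) sol_datum in \<open>auto simp: islimpt_greaterThanLessThan2\<close>)
  show ?S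
    by (rule has_simple_pole_residue_sum[where q = 1 and R' = "- L_gen i"])
      (use nz(2) sol_datum in \<open>auto simp: islimpt_greaterThanLessThan1\<close>)
qed

lemma sol_irreducible: "irreducible_datum {-1<..<1} (\<lambda>i t. R (fp_sol n t) (fm_sol n t) (g_sol n t) i)"
  unfolding irreducible_datum_def
proof (intro allI impI)
  fix S :: "(complex^('p + 'm)) set"
  let ?T = "\<lambda>i t. R (fp_sol n t) (fm_sol n t) (g_sol n t) i"
  assume S: "vec.subspace S \<and> (\<forall>t\<in>{-1<..<1}. \<forall>i. \<forall>v\<in>S. ?T i t *v v \<in> S)"
  \<comment> \<open>Two times suffice to recover the generators: the datum is \<open>L - S\<close>
    at 0 and \<open>2 L - (2/3) S\<close> at 1/2, so \<open>L + S\<close> is 3/2 times the latter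
    minus twice the former.\<close>
  have "R 1 1 0 i *v v \<in> S" if v: "v \<in> S" for i v
  proof -
    have n: "real n + 1 \<noteq> 0" by linarith
    have "real n / (real n + 1) + 1 / (real n + 1) = 1"
      "(real n + 2) / (real n + 1) + - (1 / (real n + 1)) = 1" "- g_res n + g_res n = 0"
      using n by (simp_all add: divide_simps)
    then have "L_gen i + S_gen i = R 1 1 0 i"
      unfolding L_gen_def S_gen_def R_add by (simp only:)
    moreover have "?T i 0 = L_gen i - S_gen i" using sol_datum[of 0 i] by simp
    moreover have "?T i (1/2) = 2 *\<^sub>R L_gen i - (2/3) *\<^sub>R S_gen i" using sol_datum[of "1/2" i] by simp
    moreover have "L_gen i + S_gen i
        = (3/2) *\<^sub>C (2 *\<^sub>R L_gen i - (2/3) *\<^sub>R S_gen i) - 2 *\<^sub>C (L_gen i - S_gen i)"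
      by (simp add: scaleR_cscale vec_eq_iff algebra_simps)
    ultimately have e: "R 1 1 0 i = (3/2) *\<^sub>C ?T i (1/2) - 2 *\<^sub>C ?T i 0"
      by (simp only:)
    have "?T i (1/2) *v v \<in> S" "?T i 0 *v v \<in> S" using S v by auto
    then have "(3/2) *s (?T i (1/2) *v v) - 2 *s (?T i 0 *v v) \<in> S"
      using S by (simp add: vec.subspace_diff vec.subspace_scale)
    then show ?thesis unfolding e by (simp add: matrix_vector_mult_diff_rdistrib cscale_vector)
  qed
  moreover have "g_sol n 0 \<noteq> 0" using n2 by (simp add: g_sol_def)
  moreover have "?T i 0 *v v \<in> S" if "v \<in> S" for i v using S that by auto
  ultimately show "S = {0} \<or> S = UNIV" using R_irreducible[of S] S by blast
qed

end

theorem theorem4p14: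
  fixes n :: nat
    and \<rho>p :: "real^3^3 \<Rightarrow> complex^'p^'p"
    and \<rho>m :: "real^3^3 \<Rightarrow> complex^'m^'m"
    and \<rho>r :: "real^3^3 \<Rightarrow> complex^'r^'r"
    and \<rho>2 :: "real^3^3 \<Rightarrow> complex^2^2"
    and B :: "3 \<Rightarrow> complex^'m^'p"
  assumes "n \<ge> 2"
    and "CARD('p) = n + 2" and "CARD('m) = n" and "CARD('r) = n + 1"
    and "so3_unitary_irrep \<rho>p" and "so3_unitary_irrep \<rho>m"
    and "so3_unitary_irrep \<rho>r" and "so3_unitary_irrep \<rho>2"
    and "intertwining_triple \<rho>p \<rho>m B"
  shows
    "(\<forall>(I :: real set) (T :: 3 \<Rightarrow> real \<Rightarrow> complex^('p + 'm)^('p + 'm)) Y \<rho>.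
        open I \<and> is_interval I \<and>
        nahm_datum I T \<and> spherically_symmetric I T \<and>
        symmetry_generators I T Y \<and> induces_rep Y \<rho> \<and>
        so3_rep_iso \<rho> (rep_sum \<rho>p \<rho>m)
        \<longrightarrow>
        (\<exists>U\<in>SU. \<exists>fp fm g.
           real_analytic_on fp I \<and> real_analytic_on fm I \<and> real_analytic_on g I \<and>
           (\<forall>t\<in>I. \<forall>i. gauge_act U (T i t) = reduced_datum \<rho>p \<rho>m B fp fm g i t) \<and>
           reduced_solution n I fp fm g)) \<and>
     (let I = {-1<..<1};
          T = reduced_datum \<rho>p \<rho>m B (fp_sol n) (fm_sol n) (g_sol n)
      in
        maximal_reduced_solution n I (fp_sol n) (fm_sol n) (g_sol n) \<and>
        irreducible_datum I T \<and>
        (\<forall>s\<in>{1, -1}.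
           has_simple_pole_residue (fp_sol n) I s (- 1 / 2 - s * (real n - 1) / (2 * (real n + 1))) \<and>
           has_simple_pole_residue (fm_sol n) I s (- 1 / 2 - s * (real n + 3) / (2 * (real n + 1))) \<and>
           has_simple_pole_residue (g_sol n) I s (s * sqrt (real n / (2 * (real n + 1))))) \<and>
        nahm_datum I T \<and> spherically_symmetric I T \<and>
        (\<exists>\<rho>. induces_rep_at I T 1 \<rho> \<and>
           so3_rep_iso \<rho> (rep_copies \<rho>r :: real^3^3 \<Rightarrow> complex^(2 \<times> 'r)^(2 \<times> 'r))) \<and>
        (\<exists>\<rho>. induces_rep_at I T (-1) \<rho> \<and>
           so3_rep_iso \<rho> (rep_copies \<rho>2 :: real^3^3 \<Rightarrow> complex^('r \<times> 2)^('r \<times> 2))))"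
proof -
  interpret P: nahm_pair n "\<lambda>i. \<rho>p (so3_basis i)" "\<lambda>i. \<rho>m (so3_basis i)" B
  proof
    show "so3_triple (\<lambda>i. \<rho>p (so3_basis i))" "irreducible_triple (\<lambda>i. \<rho>p (so3_basis i))"
      "so3_triple (\<lambda>i. \<rho>m (so3_basis i))" "irreducible_triple (\<lambda>i. \<rho>m (so3_basis i))"
      using so3_unitary_irrep_triple assms(5,6) by blast+
    show "tensor_op (\<lambda>i. \<rho>p (so3_basis i)) (\<lambda>i. \<rho>m (so3_basis i)) B"
      by (rule intertwining_triple_tensor_op[OF assms(9)])
    show "(\<Sum>i\<in>UNIV. B i ** cadjoint (B i)) = mat 1"
      using assms(9) by (simp add: intertwining_triple_def)
  qed (use assms(1-3) in simp_all)
  have datum: "reduced_datum \<rho>p \<rho>m B fp fm g = (\<lambda>i t. P.R (fp t) (fm t) (g t) i)" for fp fm g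
    by (simp add: fun_eq_iff reduced_datum_def P.R_def scaleR_cscale)
  have reduction: "\<exists>U\<in>SU. \<exists>fp fm g.
       real_analytic_on fp I \<and> real_analytic_on fm I \<and> real_analytic_on g I \<and>
       (\<forall>t\<in>I. \<forall>i. gauge_act U (T i t) = P.R (fp t) (fm t) (g t) i) \<and> reduced_solution n I fp fm g"
    if a: "open I \<and> is_interval I \<and> nahm_datum I T \<and> spherically_symmetric I T \<and>
        symmetry_generators I T Y \<and> induces_rep Y \<rho> \<and> so3_rep_iso \<rho> (rep_sum \<rho>p \<rho>m)"
    for I :: "real set" and T :: "3 \<Rightarrow> real \<Rightarrow> complex^('p + 'm)^('p + 'm)" and Y \<rho>
  proof -
    from a obtain Q :: "complex^('p + 'm)^('p + 'm)"
      where Q: "invertible Q" "\<And>A. A \<in> so3 \<Longrightarrow> Q ** \<rho> A = rep_sum \<rho>p \<rho>m A ** Q"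
      unfolding so3_rep_iso_def by blast
    have Q': "Q ** Y i = P.R 1 1 0 i ** Q" for i
    proof -
      have "\<rho> (so3_basis i) = Y i" using a by (simp add: induces_rep_def)
      then show ?thesis
        using Q(2)[OF so3_basis_mem, of i] by (simp add: rep_sum_def P.R_def)
    qed
    obtain U fp fm g where U: "U \<in> SU" "reduced_solution n I fp fm g"
      "\<And>t i. t \<in> I \<Longrightarrow> gauge_act U (T i t) = P.R (fp t) (fm t) (g t) i"
      using P.spherically_symmetric_reduction[of I T Y Q] a Q(1) Q' by blast
    then show ?thesis using reduced_solution_analytic[OF _ U(2)] a by blast
  qed
  let ?T = "\<lambda>i t. P.R (fp_sol n t) (fm_sol n t) (g_sol n t) i"
  have sol: "reduced_solution n {-1<..<1} (fp_sol n) (fm_sol n) (g_sol n)"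
    by (rule sol_reduced_solution[OF assms(1)])
  \<comment> \<open>The total dimension \<open>2 n + 2\<close> leaves room for two copies of
    dimension \<open>n + 1\<close> here, and for \<open>n + 1\<close> copies of dimension 2 in the
    next fact.\<close>
  have L: "so3_rep_iso (triple_rep P.L_gen) (rep_copies \<rho>r :: real^3^3 \<Rightarrow> complex^(2 \<times> 'r)^(2 \<times> 'r))"
    by (rule triple_rep_iso_copies[OF P.L_gen_triple _ assms(7)])
      (use P.L_gen_casimir assms(2-4) in \<open>simp_all add: add.commute\<close>)
  have S: "so3_rep_iso (triple_rep P.S_gen) (rep_copies \<rho>2 :: real^3^3 \<Rightarrow> complex^('r \<times> 2)^('r \<times> 2))"
    by (rule triple_rep_iso_copies[OF P.S_gen_triple _ assms(8)])
      (use P.S_gen_casimir assms(2-4) in simp_all)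
  \<comment> \<open>\<open>G\<close> is the negated residue triple, in accordance with the sign in
    \<open>induces_rep_at\<close>.\<close>
  have pole: "induces_rep_at {-1<..<1} ?T s (triple_rep G)"
    if "\<And>i. has_simple_pole_residue (?T i) {-1<..<1} s (- G i)" for s G
    unfolding induces_rep_at_def
    by (intro exI[of _ "\<lambda>i. - G i"] conjI allI that) (simp add: triple_rep_basis_sum sum_negf)
  show ?thesis
    unfolding Let_def datum
  proof (intro conjI allI impI ballI)
    show "\<exists>\<rho>. induces_rep_at {-1<..<1} ?T 1 \<rho> \<and>
        so3_rep_iso \<rho> (rep_copies \<rho>r :: real^3^3 \<Rightarrow> complex^(2 \<times> 'r)^(2 \<times> 'r))"
      using pole[OF P.sol_poles(1)] L by blast
    show "\<exists>\<rho>. induces_rep_at {-1<..<1} ?T (-1) \<rho> \<and>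
        so3_rep_iso \<rho> (rep_copies \<rho>2 :: real^3^3 \<Rightarrow> complex^('r \<times> 2)^('r \<times> 2))"
      using pole[OF P.sol_poles(2)] S by blast
  qed (rule reduction sol_maximal[OF assms(1)] P.sol_irreducible sol_residues[OF assms(1)]
      P.R_solution_nahm_datum[OF sol] P.R_datum_spherically_symmetric | assumption)+
qed

end
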